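(* Let $\Sigma$ be a simple family of implications on a finite set $E$ such that $\mathcal{F}(\Sigma)$ is a modular semilattice. Then an optimal implicational base of $\mathcal{F}(\Sigma)$ can be obtained in polynomial time.
   Context: An implication on $E$ is a pair $A\to B$ with $A,B\subseteq E$; it is proper if $B\neq\emptyset$. $\mathcal{F}(\Sigma)\subseteq 2^E$ consists of the sets $X$ such that both of the following hold: - $A\subseteq X$ implies $B\subseteq X$ for every proper $A\to B\in\Sigma$; - $A\not\subseteq X$ for every $A\to\emptyset\in\Sigma$. $\mathcal{F}(\Sigma)$ is $\cap$-closed and is regarded as a meet-semilattice under inclusion. A semilattice is modular if both of the following hold: every principal ideal is a modular lattice; and $x\vee y\vee z$ exists whenever the three pairwise joins exist. An element is $\vee$-irreducible if it is not the minimum and $l=a\vee b$ implies $l=a$ or $l=b$. $\mathcal{F}^{\mathrm{ir}}(\Sigma)$ is the set of $\vee$-irreducible elements of $\mathcal{F}(\Sigma)$. $\Sigma$ is simple if the map $e\mapsto\bigcap\{X\in\mathcal{F}(\Sigma)\mid e\in X\}$ is a bijection from $E$ to $\mathcal{F}^{\mathrm{ir}}(\Sigma)$. $\Sigma'$ is an implicational base of $\mathcal{F}(\Sigma)$ if $\mathcal{F}(\Sigma')=\mathcal{F}(\Sigma)$. Its size is $s(\Sigma')=\sum_{(A\to B)\in\Sigma'}(|A|+|B|)$. It is optimal if its size is minimum among all implicational bases. *)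

theory Defs
  imports "HOL-Algebra.Lattice" "HOL-Computational_Algebra.Polynomial"
begin

section \<open>Modular semilattices\<close>

definition principal_ideal :: "('a, 'b) gorder_scheme \<Rightarrow> 'a \<Rightarrow> ('a, 'b) gorder_scheme" where
  "principal_ideal L a = L\<lparr>carrier := {x \<in> carrier L. x \<sqsubseteq>\<^bsub>L\<^esub> a}\<rparr>"

definition modular_lattice :: "('a, 'b) gorder_scheme \<Rightarrow> bool" where
  "modular_lattice L \<longleftrightarrow> lattice L \<and>
     (\<forall>x\<in>carrier L. \<forall>y\<in>carrier L. \<forall>z\<in>carrier L.
        x \<sqsubseteq>\<^bsub>L\<^esub> z \<longrightarrow> x \<squnion>\<^bsub>L\<^esub> (y \<sqinter>\<^bsub>L\<^esub> z) = (x \<squnion>\<^bsub>L\<^esub> y) \<sqinter>\<^bsub>L\<^esub> z)"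

text \<open>In a semilattice joins are partial: \<open>is_join L s A\<close> says that the join of \<open>A\<close>
  exists and equals \<open>s\<close>.\<close>

definition is_join :: "('a, 'b) gorder_scheme \<Rightarrow> 'a \<Rightarrow> 'a set \<Rightarrow> bool" where
  "is_join L s A \<longleftrightarrow> least L s (Upper L A)"

definition modular_semilattice :: "('a, 'b) gorder_scheme \<Rightarrow> bool" where
  "modular_semilattice L \<longleftrightarrow> lower_semilattice L \<and>
     (\<forall>a\<in>carrier L. modular_lattice (principal_ideal L a)) \<and>
     (\<forall>x\<in>carrier L. \<forall>y\<in>carrier L. \<forall>z\<in>carrier L.
        (\<exists>s. is_join L s {x, y}) \<and> (\<exists>s. is_join L s {y, z}) \<and> (\<exists>s. is_join L s {x, z}) \<longrightarrow>
        (\<exists>s. is_join L s {x, y, z}))"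

definition join_irreducibles :: "('a, 'b) gorder_scheme \<Rightarrow> 'a set" where
  "join_irreducibles L = {l \<in> carrier L. \<not> least L l (carrier L) \<and>
     (\<forall>a\<in>carrier L. \<forall>b\<in>carrier L. is_join L l {a, b} \<longrightarrow> l = a \<or> l = b)}"


section \<open>Implications\<close>

type_synonym 'a implication = "'a set \<times> 'a set"

definition implications_on :: "'a set \<Rightarrow> 'a implication set \<Rightarrow> bool" where
  "implications_on E \<Sigma> \<longleftrightarrow> (\<forall>(A, B)\<in>\<Sigma>. A \<subseteq> E \<and> B \<subseteq> E)"

definition closed_sets :: "'a set \<Rightarrow> 'a implication set \<Rightarrow> 'a set set" where
  "closed_sets E \<Sigma> = {X. X \<subseteq> E \<and>
     (\<forall>(A, B)\<in>\<Sigma>. B \<noteq> {} \<longrightarrow> A \<subseteq> X \<longrightarrow> B \<subseteq> X) \<and>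
     (\<forall>(A, B)\<in>\<Sigma>. B = {} \<longrightarrow> \<not> A \<subseteq> X)}"

definition inclusion_order :: "'a set set \<Rightarrow> 'a set gorder" where
  "inclusion_order F = \<lparr>carrier = F, eq = (=), le = (\<subseteq>)\<rparr>"

definition simple_implications :: "'a set \<Rightarrow> 'a implication set \<Rightarrow> bool" where
  "simple_implications E \<Sigma> \<longleftrightarrow>
     bij_betw (\<lambda>e. \<Inter>{X \<in> closed_sets E \<Sigma>. e \<in> X}) E
       (join_irreducibles (inclusion_order (closed_sets E \<Sigma>)))"

definition implicational_base ::
    "'a set \<Rightarrow> 'a set set \<Rightarrow> 'a implication set \<Rightarrow> bool" where
  "implicational_base E F \<Sigma> \<longleftrightarrow> implications_on E \<Sigma> \<and> closed_sets E \<Sigma> = F"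

definition implications_size :: "'a implication set \<Rightarrow> nat" where
  "implications_size \<Sigma> = (\<Sum>(A, B)\<in>\<Sigma>. card A + card B)"

definition optimal_base :: "'a set \<Rightarrow> 'a set set \<Rightarrow> 'a implication set \<Rightarrow> bool" where
  "optimal_base E F \<Sigma> \<longleftrightarrow> implicational_base E F \<Sigma> \<and>
     (\<forall>\<Sigma>'. implicational_base E F \<Sigma>' \<longrightarrow> implications_size \<Sigma> \<le> implications_size \<Sigma>')"


section \<open>A machine model for polynomial time\<close>

text \<open>
  The machine model is the one-variable WHILE language \<open>I\<close> of
  N. D. Jones, Computability and Complexity from a Programming Perspective:
  the store is a single binary tree, which programs inspect and rebuild with the
  LISP-style operations nil, cons, hd and tl. Instead of unit costs, every evaluation
  of a subexpression is charged the number of nodes of its value. Hence a run of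
  cost \<open>t\<close> only ever handles trees of size at most \<open>t\<close> plus the input size, a Turing
  machine simulates it in time polynomial in \<open>t\<close> plus the input size, and conversely a
  step of a Turing machine (its tape kept as two lists of symbols) costs at most linearly
  in the size of its configuration. Polynomial time in this model, also for functions with
  large outputs, is therefore the usual polynomial time.
\<close>

datatype tree = Leaf | Node (left: tree) (right: tree)
  where "left Leaf = Leaf" | "right Leaf = Leaf"

fun nodes :: "tree \<Rightarrow> nat" where
  "nodes Leaf = 1"
| "nodes (Node s t) = 1 + nodes s + nodes t"

datatype expr = EVar | ENil | ECons expr expr | EHd expr | ETl expr

fun eval_expr :: "expr \<Rightarrow> tree \<Rightarrow> tree" where
  "eval_expr EVar x = x"
| "eval_expr ENil x = Leaf"
| "eval_expr (ECons e f) x = Node (eval_expr e x) (eval_expr f x)"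
| "eval_expr (EHd e) x = left (eval_expr e x)"
| "eval_expr (ETl e) x = right (eval_expr e x)"

fun expr_cost :: "expr \<Rightarrow> tree \<Rightarrow> nat" where
  "expr_cost EVar x = nodes x"
| "expr_cost ENil x = 1"
| "expr_cost (ECons e f) x = expr_cost e x + expr_cost f x + nodes (eval_expr (ECons e f) x)"
| "expr_cost (EHd e) x = expr_cost e x + nodes (eval_expr (EHd e) x)"
| "expr_cost (ETl e) x = expr_cost e x + nodes (eval_expr (ETl e) x)"

datatype prog = Assign expr | Seq prog prog | While expr prog

text \<open>\<open>runs c x t y\<close>: started on the store \<open>x\<close>, the program \<open>c\<close> halts at cost \<open>t\<close> with
  the store \<open>y\<close>. The loop test of \<^const>\<open>While\<close> succeeds iff its value is not
  \<^const>\<open>Leaf\<close>.\<close>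

inductive runs :: "prog \<Rightarrow> tree \<Rightarrow> nat \<Rightarrow> tree \<Rightarrow> bool" where
  Assign: "runs (Assign e) x (1 + expr_cost e x) (eval_expr e x)"
| Seq: "runs c x t y \<Longrightarrow> runs d y u z \<Longrightarrow> runs (Seq c d) x (1 + t + u) z"
| While_end: "eval_expr e x = Leaf \<Longrightarrow> runs (While e c) x (1 + expr_cost e x) x"
| While_step: "eval_expr e x \<noteq> Leaf \<Longrightarrow> runs c x t y \<Longrightarrow> runs (While e c) y u z \<Longrightarrow>
    runs (While e c) x (1 + expr_cost e x + t + u) z"

text \<open>Since runs are deterministic, the existence of a halting run with
  a given property determines the behaviour of the program on that input.\<close>

lemma runs_deterministic:
  "runs c x t y \<Longrightarrow> runs c x u z \<Longrightarrow> u = t \<and> z = y"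
proof (induction arbitrary: u z rule: runs.induct)
  case (Assign e x)
  then show ?case by (auto elim: runs.cases)
next
  case (Seq c x t y d u' z')
  from Seq.prems show ?case
    by (cases rule: runs.cases) (use Seq.IH in blast)+
next
  case (While_end e x c)
  from While_end.prems While_end.hyps show ?case
    by (cases rule: runs.cases) auto
next
  case (While_step e x c t y u' z')
  from While_step.prems show ?case
    by (cases rule: runs.cases) (use While_step.IH While_step.hyps in blast)+
qed


section \<open>Encodings\<close>

text \<open>Numbers are encoded as lists of binary digits, least significant digit first.\<close>

fun enc_nat :: "nat \<Rightarrow> tree" where
  "enc_nat n = (if n = 0 then Leaf
     else Node (if odd n then Node Leaf Leaf else Leaf) (enc_nat (n div 2)))"

declare enc_nat.simps [simp del]

fun enc_list :: "('a \<Rightarrow> tree) \<Rightarrow> 'a list \<Rightarrow> tree" where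
  "enc_list f [] = Leaf"
| "enc_list f (x # xs) = Node (f x) (enc_list f xs)"

text \<open>A finite family of implications is presented to and by a program as a list of pairs of
  lists. The order of the entries is arbitrary, and repetitions are allowed.\<close>

type_synonym implication_list = "(nat list \<times> nat list) list"

definition family_of :: "implication_list \<Rightarrow> nat implication set" where
  "family_of ps = (\<lambda>(as, bs). (set as, set bs)) ` set ps"

definition enc_implications :: "implication_list \<Rightarrow> tree" where
  "enc_implications = enc_list (\<lambda>(as, bs). Node (enc_list enc_nat as) (enc_list enc_nat bs))"

definition enc_instance :: "nat list \<Rightarrow> implication_list \<Rightarrow> tree" where
  "enc_instance es ps = Node (enc_list enc_nat es) (enc_implications ps)"

end

(*
Write cl for the closure operator of the family, and low p for cl {p} minus p, which is closed.
In a modular semilattice a set is closed iff it contains cl {p, q} for any two of its elements, in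
particular no inconsistent pair. Group the implications A -> B of a base by cl A (by UNIV if A is
inconsistent); the groups can be optimised independently of each other.

In the group of cl {p}, the right-hand sides must generate low p, and by the Kurosh-Ore theorem
any irredundant generating set of low p has minimum size. If C = cl {p, q} for incomparable p and q,
the intersection N of the maximal closed proper subsets of C lies exactly two levels below C. So these
subsets M_1, ..., M_n intersect pairwise in N. For n >= 3, no M_i Un M_j with i < j is closed, which
forces a separate implication of size at least 3 for each such pair. This is attained by choosing
r_i in M_i - N and the implications {r_i, r_j} -> {r_k}, where k = k(i, j) is such that every pair
generates all of r_1, ..., r_n. In the inconsistent group, each minimal set that is inconsistent
and closed under the other groups costs at least 2, which is attained by one pair in it.

The representatives, generating sets and pairs come out of one greedy removal of redundant list
elements, in which redundancy is decided by forward chaining.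
*)

theory Submission
  imports Defs
begin


section \<open>Closed sets of a modular semilattice\<close>

text \<open>Modularity is used mainly through one consequence: if a closed \<open>y\<close> misses
  \<open>g\<close> and \<open>insert g y\<close> is consistent, then
  \<open>cl (low g \<union> y)\<close> is the largest closed set between \<open>y\<close> and
  \<open>cl (insert g y)\<close> that misses \<open>g\<close>. So in this interval joins of sets
  that miss \<open>g\<close> miss it again. Many pairs have the same closure \<open>C\<close>; core
  and branches must be recognisable from \<open>C\<close> alone, for otherwise each pair would
  contribute rules of its own and the base would be too large. In the inconsistent group
  \<open>cl\<close> is constantly \<open>UNIV\<close> and gives no information. It is replaced by
  the closure \<open>gen\<close> under the proper rules: a set closed under these contains the
  closure of each of its consistent subsets, so an implication of an arbitrary base that fails in it
  has an inconsistent premise. For the running time the danger is a loop whose store grows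
  geometrically. Hence lists are processed by folds whose accumulator grows only additively.\<close>

locale modular_family =
  fixes E :: "'a set" and F :: "'a set set"
  assumes finite_E: "finite E"
    and E_neq_UNIV: "E \<noteq> UNIV"
    and F_sub: "X \<in> F \<Longrightarrow> X \<subseteq> E"
    and empty_F: "{} \<in> F"
    and Int_F: "X \<in> F \<Longrightarrow> Y \<in> F \<Longrightarrow> X \<inter> Y \<in> F"
    and modular: "W \<in> F \<Longrightarrow> X \<in> F \<Longrightarrow> Y \<in> F \<Longrightarrow> Z \<in> F \<Longrightarrow> X \<subseteq> Z \<Longrightarrow> Y \<subseteq> W \<Longrightarrow> Z \<subseteq> W \<Longrightarrow>
      (\<lambda>V. V \<in> F) hull (X \<union> (Y \<inter> Z)) = ((\<lambda>V. V \<in> F) hull (X \<union> Y)) \<inter> Z"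
    and Helly: "X \<in> F \<Longrightarrow> Y \<in> F \<Longrightarrow> Z \<in> F \<Longrightarrow> \<exists>W\<in>F. X \<union> Y \<subseteq> W \<Longrightarrow> \<exists>W\<in>F. Y \<union> Z \<subseteq> W \<Longrightarrow>
      \<exists>W\<in>F. X \<union> Z \<subseteq> W \<Longrightarrow> \<exists>W\<in>F. X \<union> Y \<union> Z \<subseteq> W"
    and single_F: "e \<in> E \<Longrightarrow> (\<lambda>V. V \<in> F) hull {e} \<in> F"
    and lower_F: "e \<in> E \<Longrightarrow> (\<lambda>V. V \<in> F) hull {e} - {e} \<in> F"
begin

abbreviation cl :: "'a set \<Rightarrow> 'a set" where "cl A \<equiv> (\<lambda>V. V \<in> F) hull A"

definition consistent :: "'a set \<Rightarrow> bool" where "consistent A \<longleftrightarrow> (\<exists>W\<in>F. A \<subseteq> W)"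

definition low :: "'a \<Rightarrow> 'a set" where "low p = cl {p} - {p}"

section \<open>The closure operator and consistency\<close>

lemma finite_F: "finite F"
  using F_sub finite_E by (meson Pow_iff finite_Pow_iff finite_subset subsetI)

lemma finite_subset_E: "X \<subseteq> E \<Longrightarrow> finite X"
  using finite_E finite_subset by blast

lemma finite_in_F: "X \<in> F \<Longrightarrow> finite X"
  by (simp add: F_sub finite_subset_E)

lemma Inter_F: "finite G \<Longrightarrow> G \<noteq> {} \<Longrightarrow> G \<subseteq> F \<Longrightarrow> \<Inter>G \<in> F"
  by (induction G rule: finite_ne_induct) (auto intro: Int_F)

lemma cl_F: "consistent A \<Longrightarrow> cl A \<in> F"
  unfolding hull_def consistent_def
  by (rule Inter_F) (use finite_F in auto)

lemma UNIV_notin_F: "UNIV \<notin> F"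
  using F_sub E_neq_UNIV by blast

text \<open>The hull of an inconsistent set is the intersection of the empty family. Since
  \<open>E \<noteq> UNIV\<close>, this value is never a member of \<open>F\<close> and can serve as
  a mark of inconsistency.\<close>

lemma cl_inconsistent: "\<not> consistent A \<Longrightarrow> cl A = UNIV"
  unfolding consistent_def hull_def by auto

lemma consistent_iff: "consistent A \<longleftrightarrow> cl A \<in> F"
  using cl_F cl_inconsistent UNIV_notin_F by metis

lemma consistent_iff': "consistent A \<longleftrightarrow> cl A \<noteq> UNIV"
  using cl_F cl_inconsistent UNIV_notin_F by metis

lemma cl_least: "A \<subseteq> X \<Longrightarrow> X \<in> F \<Longrightarrow> cl A \<subseteq> X"
  by (rule hull_minimal)

lemma cl_ext: "A \<subseteq> cl A"
  by (rule hull_subset)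

lemma cl_mono: "A \<subseteq> B \<Longrightarrow> cl A \<subseteq> cl B"
  by (rule hull_mono)

lemma cl_id: "X \<in> F \<Longrightarrow> cl X = X"
  by (rule hull_same)

lemma consistentI: "A \<subseteq> W \<Longrightarrow> W \<in> F \<Longrightarrow> consistent A"
  unfolding consistent_def by blast

lemma cl_F_sub: "A \<subseteq> X \<Longrightarrow> X \<in> F \<Longrightarrow> cl A \<in> F"
  by (rule cl_F[OF consistentI])

lemma consistent_mono: "A \<subseteq> B \<Longrightarrow> consistent B \<Longrightarrow> consistent A"
  unfolding consistent_def by blast

lemma cl_sub_E: "consistent A \<Longrightarrow> cl A \<subseteq> E"
  using cl_F F_sub by blast

lemma cl_subset_iff: "X \<in> F \<Longrightarrow> cl A \<subseteq> X \<longleftrightarrow> A \<subseteq> X"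
  by (rule subset_hull)

lemma cl_trans: "A \<subseteq> cl B \<Longrightarrow> cl A \<subseteq> cl B"
  using hull_mono[of A "cl B" "\<lambda>V. V \<in> F"] by simp

lemma cl_Un_cl: "cl (A \<union> cl B) = cl (A \<union> B)"
  by (rule hull_Un_right[symmetric])

lemma cl_cl_Un: "cl (cl A \<union> B) = cl (A \<union> B)"
  by (rule hull_Un_left[symmetric])

lemma consistent_single: "p \<in> E \<Longrightarrow> consistent {p}"
  using single_F consistent_iff by blast

lemma consistent_empty: "consistent {}"
  using empty_F consistentI by blast

lemma in_cl_single: "p \<in> cl {p}"
  using cl_ext by blast

lemma low_F: "p \<in> E \<Longrightarrow> low p \<in> F"
  using lower_F low_def by simp

lemma low_notin: "p \<notin> low p"
  unfolding low_def by simp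

lemma low_sub: "low p \<subseteq> cl {p}"
  unfolding low_def by blast

lemma cl_single_eq: "cl {p} = insert p (low p)"
  unfolding low_def using in_cl_single by blast

lemma cl_single_sub_low:
  assumes "X \<in> F" "p \<notin> X"
  shows "cl {p} \<inter> X \<subseteq> low p"
  using assms low_def by blast

lemma cl_single_inj:
  assumes "p \<in> E" "cl {p} = cl {q}"
  shows "p = q"
proof (rule ccontr)
  assume "p \<noteq> q"
  then have "q \<in> low p"
    using in_cl_single[of q] assms(2) unfolding low_def by auto
  then have "cl {q} \<subseteq> low p"
    using low_F[OF assms(1)] cl_least by auto
  then show False using assms(2) in_cl_single low_notin by blast
qed

lemma cl_single_irreducible:
  assumes "p \<in> E" "cl (A \<union> B) = cl {p}" "A \<in> F" "B \<in> F"
  shows "p \<in> A \<or> p \<in> B"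
proof (rule ccontr)
  assume n: "\<not> ?thesis"
  have "A \<union> B \<subseteq> cl {p}" using cl_ext assms(2) by metis
  then have "A \<union> B \<subseteq> low p" using n unfolding low_def by blast
  then have "cl (A \<union> B) \<subseteq> low p" using low_F[OF assms(1)] cl_least by auto
  then show False using assms(2) in_cl_single low_notin by blast
qed

section \<open>The modular law for an element and its lower set\<close>

lemma modular_Un:
  assumes "X \<in> F" "Y \<in> F" "Z \<in> F" "X \<subseteq> Z" "consistent (Y \<union> Z)"
  shows "cl (X \<union> (Y \<inter> Z)) = cl (X \<union> Y) \<inter> Z"
  using assms modular unfolding consistent_def by (metis le_sup_iff)

text \<open>By the modular law \<open>cl (low p \<union> M) \<inter> cl {p}\<close> is generated by
  \<open>low p\<close> and \<open>M \<inter> cl {p}\<close>. The latter lies in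
  \<open>low p\<close>, because \<open>M\<close> misses \<open>p\<close>.\<close>

lemma notin_cl_low:
  assumes M: "M \<in> F" and p: "p \<in> E" "p \<notin> M" and c: "consistent (insert p M)"
  shows "p \<notin> cl (low p \<union> M)"
proof -
  have c': "consistent (M \<union> cl {p})"
    using c by (simp add: consistent_iff cl_Un_cl)
  have "cl (low p \<union> (M \<inter> cl {p})) = cl (low p \<union> M) \<inter> cl {p}"
    by (rule modular_Un) (use M p low_F low_sub single_F c' in auto)
  moreover have "low p \<union> (M \<inter> cl {p}) = low p"
    using cl_single_sub_low[OF M p(2)] by blast
  ultimately have "cl (low p \<union> M) \<inter> cl {p} = low p"
    using cl_id low_F[OF p(1)] by simp
  then show ?thesis using low_notin in_cl_single by blast
qed

text \<open>The modular law writes \<open>Z\<close> as the join of \<open>y\<close> and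
  \<open>cl {g} \<inter> Z\<close>, and this intersection is contained in
  \<open>low g\<close>.\<close>

lemma sub_cl_low:
  assumes y: "y \<in> F" and g: "g \<in> E" and Z: "Z \<in> F" "g \<notin> Z" "y \<subseteq> Z" "Z \<subseteq> cl (insert g y)"
    and c: "consistent (insert g y)"
  shows "Z \<subseteq> cl (low g \<union> y)"
proof -
  have g1: "cl {g} \<union> Z \<subseteq> cl (insert g y)"
    using Z(4) cl_mono[of "{g}" "insert g y"] by auto
  have c': "consistent (cl {g} \<union> Z)"
    using consistentI[OF g1 cl_F[OF c]] .
  have "cl (y \<union> (cl {g} \<inter> Z)) = cl (y \<union> cl {g}) \<inter> Z"
    by (rule modular_Un) (use y Z single_F g c' in auto)
  moreover have "cl (y \<union> cl {g}) = cl (insert g y)"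
    using cl_Un_cl[of y "{g}"] by simp
  ultimately have "Z = cl (y \<union> (cl {g} \<inter> Z))" using Z(4) by blast
  moreover have "cl {g} \<inter> Z \<subseteq> low g" by (rule cl_single_sub_low[OF Z(1,2)])
  ultimately show ?thesis
    by (metis Un_commute Un_mono cl_mono order_refl)
qed

section \<open>Reduction of closedness and consistency to pairs of elements\<close>

lemma principalI:
  assumes a: "a \<in> F" "a \<noteq> {}"
    and irr: "\<And>a1 a2. a1 \<in> F \<Longrightarrow> a2 \<in> F \<Longrightarrow> a1 \<subseteq> a \<Longrightarrow> a2 \<subseteq> a \<Longrightarrow> cl (a1 \<union> a2) = a \<Longrightarrow> a1 = a \<or> a2 = a"
  shows "\<exists>p\<in>a. cl {p} = a"
proof (rule ccontr)
  assume n: "\<not> ?thesis"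
  have "S \<subseteq> a \<Longrightarrow> cl S \<noteq> a" if "finite S" for S
    using that
  proof (induction S)
    case empty
    then show ?case using cl_id[OF empty_F] a by simp
  next
    case (insert d S)
    have "cl S \<in> F" "cl {d} \<in> F"
      using insert.prems a(1) cl_F consistentI by auto
    moreover have "cl S \<subseteq> a" "cl {d} \<subseteq> a"
      using insert.prems a(1) cl_least by auto
    moreover have "cl (insert d S) = cl (cl S \<union> cl {d})"
      by (simp only: cl_cl_Un cl_Un_cl) (simp add: Un_commute)
    ultimately show ?case using irr[of "cl S" "cl {d}"] insert n by auto
  qed
  then show False using a(1) cl_id finite_in_F by blast
qed

text \<open>If \<open>a\<close> were the join of two smaller closed sets, then by minimality neither
  of them would produce \<open>r\<close> together with \<open>b\<close>. Both would lie in the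
  largest closed set between \<open>b\<close> and \<open>cl (insert r b)\<close> that misses
  \<open>r\<close>, and so would \<open>a \<union> b\<close>, although
  \<open>r \<in> cl (a \<union> b)\<close>.\<close>

lemma principal_if_minimal:
  assumes a: "a \<in> F" and b: "b \<in> F" and c: "consistent (a \<union> b)"
    and r: "r \<in> cl (a \<union> b)" "r \<notin> b"
    and mina: "\<And>a1. a1 \<in> F \<Longrightarrow> a1 \<subset> a \<Longrightarrow> r \<notin> cl (a1 \<union> b)"
  shows "\<exists>p\<in>a. cl {p} = a"
proof (rule principalI[OF a])
  have rE: "r \<in> E" using r c cl_sub_E by blast
  show "a \<noteq> {}" using r cl_id[OF b] by auto
  fix a1 a2
  assume A: "a1 \<in> F" "a2 \<in> F" "a1 \<subseteq> a" "a2 \<subseteq> a" "cl (a1 \<union> a2) = a"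
  show "a1 = a \<or> a2 = a"
  proof (rule ccontr)
    assume n: "\<not> ?thesis"
    have crb: "insert r b \<subseteq> cl (a \<union> b)" using r cl_ext[of "a \<union> b"] by auto
    have cons: "consistent (insert r b)" using crb cl_F[OF c] consistentI by blast
    define Z where "Z = cl (insert r b)"
    have Z: "Z \<in> F" "b \<subseteq> Z" "r \<in> Z"
      using cl_F[OF cons] cl_ext[of "insert r b"] by (auto simp: Z_def)
    have ZW: "Z \<subseteq> cl (a \<union> b)" unfolding Z_def using crb cl_trans by blast
    have cz: "consistent (a \<union> Z)"
      using consistentI[of "a \<union> Z" "cl (a \<union> b)"] ZW cl_ext[of "a \<union> b"] cl_F[OF c] by auto
    \<comment> \<open>\<open>a \<inter> Z\<close> also produces \<open>r\<close> together with
      \<open>b\<close>, so minimality puts \<open>a\<close> inside \<open>Z\<close>, into the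
      interval where \<open>sub_cl_low\<close> applies.\<close>
    have "cl (b \<union> (a \<inter> Z)) = cl (b \<union> a) \<inter> Z"
      by (rule modular_Un[OF b a Z(1,2) cz])
    then have "r \<in> cl ((a \<inter> Z) \<union> b)" using r Z by (simp add: Un_commute)
    then have "a \<inter> Z = a" using mina[of "a \<inter> Z"] Int_F[OF a Z(1)] by blast
    then have aZ: "a \<subseteq> Z" by blast
    have low: "ai \<subseteq> cl (low r \<union> b)" if ai: "ai \<in> F" "ai \<subset> a" for ai
    proof -
      have s: "ai \<union> b \<subseteq> Z" using aZ ai Z by blast
      have "cl (ai \<union> b) \<subseteq> cl (low r \<union> b)"
      proof (rule sub_cl_low[OF b rE])
        show "cl (ai \<union> b) \<in> F" using cl_F consistentI[OF s Z(1)] by blast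
        show "r \<notin> cl (ai \<union> b)" using mina ai by blast
        show "b \<subseteq> cl (ai \<union> b)" using cl_ext by blast
        show "cl (ai \<union> b) \<subseteq> cl (insert r b)" using s Z_def cl_trans by blast
      qed (rule cons)
      then show ?thesis using cl_ext[of "ai \<union> b"] by blast
    qed
    have "a1 \<union> a2 \<subseteq> cl (low r \<union> b)" using low A n by blast
    then have "a \<subseteq> cl (low r \<union> b)" using A(5) cl_trans by blast
    then have "a \<union> b \<subseteq> cl (low r \<union> b)" using cl_ext[of "low r \<union> b"] by blast
    then have "r \<in> cl (low r \<union> b)" using r cl_trans by blast
    moreover have "r \<notin> cl (low r \<union> b)"
      by (rule notin_cl_low) (use b rE r cons in auto)
    ultimately show False by blast
  qed
qed

text \<open>Shrink \<open>a\<close> and \<open>b\<close> as long as \<open>r\<close> remains in the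
  closure of their union. When neither can shrink, both are principal by
  \<open>principal_if_minimal\<close>, and their generators form the pair.\<close>

lemma pair_split:
  assumes "a \<in> F" "b \<in> F" "consistent (a \<union> b)" "r \<in> cl (a \<union> b)"
  shows "r \<in> a \<or> r \<in> b \<or> (\<exists>p\<in>a. \<exists>q\<in>b. r \<in> cl {p, q})"
  using assms
proof (induction "card a + card b" arbitrary: a b rule: less_induct)
  case less
  have fin: "finite a" "finite b" using less.prems finite_in_F by auto
  show ?case
  proof (cases "r \<in> a \<or> r \<in> b")
    case False
    consider (A) a1 where "a1 \<in> F" "a1 \<subset> a" "r \<in> cl (a1 \<union> b)"
      | (B) b1 where "b1 \<in> F" "b1 \<subset> b" "r \<in> cl (a \<union> b1)"
      | (C) "\<And>a1. a1 \<in> F \<Longrightarrow> a1 \<subset> a \<Longrightarrow> r \<notin> cl (a1 \<union> b)"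
         "\<And>b1. b1 \<in> F \<Longrightarrow> b1 \<subset> b \<Longrightarrow> r \<notin> cl (b1 \<union> a)"
      by (metis Un_commute)
    then show ?thesis
    proof cases
      case A
      have "card a1 + card b < card a + card b" using A psubset_card_mono fin by auto
      moreover have "consistent (a1 \<union> b)"
        by (rule consistent_mono[OF _ less.prems(3)]) (use A in blast)
      ultimately have "r \<in> a1 \<or> r \<in> b \<or> (\<exists>p\<in>a1. \<exists>q\<in>b. r \<in> cl {p, q})"
        using less.hyps A less.prems by blast
      then show ?thesis using A by blast
    next
      case B
      have "card a + card b1 < card a + card b" using B psubset_card_mono fin by auto
      moreover have "consistent (a \<union> b1)"
        by (rule consistent_mono[OF _ less.prems(3)]) (use B in blast)
      ultimately have "r \<in> a \<or> r \<in> b1 \<or> (\<exists>p\<in>a. \<exists>q\<in>b1. r \<in> cl {p, q})"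
        using less.hyps B less.prems by blast
      then show ?thesis using B by blast
    next
      case C
      obtain p where p: "p \<in> a" "cl {p} = a"
        using principal_if_minimal[OF less.prems(1,2,3,4) _ C(1)] False by blast
      obtain q where q: "q \<in> b" "cl {q} = b"
        using principal_if_minimal[OF less.prems(2,1) _ _ _ C(2)] False less.prems(3,4)
        by (metis Un_commute)
      have "cl (a \<union> b) = cl {p, q}"
        using p q by (metis cl_cl_Un cl_Un_cl insert_is_Un)
      then show ?thesis using p q less.prems by auto
    qed
  qed blast
qed

text \<open>One member \<open>X\<close> is removed and every other member \<open>Y\<close> is
  replaced by \<open>cl (X \<union> Y)\<close>. By the ternary condition \<open>Helly\<close>, a
  common bound of \<open>X\<close>, \<open>Y\<close> and \<open>Z\<close> bounds two such sets, so
  the smaller family is pairwise bounded again.\<close>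

lemma bounded_if_pairwise_bounded:
  assumes "finite G" "G \<subseteq> F" "\<And>X Y. X \<in> G \<Longrightarrow> Y \<in> G \<Longrightarrow> consistent (X \<union> Y)"
  shows "consistent (\<Union>G)"
  using assms
proof (induction "card G" arbitrary: G rule: less_induct)
  case less
  show ?case
  proof (cases "G = {}")
    case True
    then show ?thesis using consistent_empty by simp
  next
    case nonempty: False
    then obtain X where "X \<in> G" by blast
    define G' where "G' = G - {X}"
    have G: "G = insert X G'" "X \<notin> G'" "finite G'"
      using \<open>X \<in> G\<close> less.prems(1) by (auto simp: G'_def)
    show ?thesis
    proof (cases "G' = {}")
      case True
      then show ?thesis using less.prems(3)[of X X] G by simp
    next
      case False
      define H where "H = (\<lambda>Y. cl (X \<union> Y)) ` G'"
      have HF: "H \<subseteq> F" unfolding H_def using less.prems G cl_F by auto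
      have Hp: "consistent (U \<union> V)" if UV: "U \<in> H" "V \<in> H" for U V
      proof -
        obtain Y Z where YZ: "Y \<in> G'" "Z \<in> G'" "U = cl (X \<union> Y)" "V = cl (X \<union> Z)"
          using UV unfolding H_def by auto
        have m: "X \<in> G" "Y \<in> G" "Z \<in> G" using YZ G by auto
        note p = less.prems(3)[unfolded consistent_def]
        have "\<exists>W\<in>F. X \<union> Y \<union> Z \<subseteq> W"
          by (rule Helly[OF _ _ _ p[OF m(1,2)] p[OF m(2,3)] p[OF m(1,3)]])
            (use m less.prems(2) in blast)+
        then have "consistent (X \<union> Y \<union> (X \<union> Z))"
          unfolding consistent_def by blast
        then have "consistent (cl (X \<union> Y) \<union> cl (X \<union> Z))"
          by (simp only: consistent_iff cl_cl_Un cl_Un_cl)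
        then show ?thesis using YZ by simp
      qed
      have "card H \<le> card G'" unfolding H_def using G card_image_le by blast
      then have "card H < card G" using G by simp
      moreover have "finite H" unfolding H_def using G by simp
      ultimately have "consistent (\<Union>H)" by (intro less.hyps HF Hp)
      moreover have "\<Union>G \<subseteq> \<Union>H"
      proof -
        have "X \<union> Y \<subseteq> \<Union>H" if "Y \<in> G'" for Y
          using that cl_ext[of "X \<union> Y"] unfolding H_def by blast
        then show ?thesis using False G(1) by blast
      qed
      ultimately show ?thesis using consistent_mono by blast
    qed
  qed
qed

lemma obtain_maximal:
  assumes "X \<in> F" "P X"
  obtains S where "S \<in> F" "P S" "\<And>T. T \<in> F \<Longrightarrow> P T \<Longrightarrow> S \<subseteq> T \<Longrightarrow> T = S"
proof -
  have "finite {S \<in> F. P S}" "{S \<in> F. P S} \<noteq> {}"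
    using finite_F assms by auto
  from finite_has_maximal[OF this] obtain S
    where S: "S \<in> {S \<in> F. P S}" and m: "\<forall>T\<in>{S \<in> F. P S}. S \<subseteq> T \<longrightarrow> S = T"
    by (rule bexE)
  show thesis
  proof (rule that)
    show "S \<in> F" "P S" using S by auto
    fix T assume "T \<in> F" "P T" "S \<subseteq> T"
    then show "T = S" using m[THEN bspec, of T] by simp
  qed
qed

lemma consistent_if_pairs:
  assumes "X \<subseteq> E" "\<And>p q. p \<in> X \<Longrightarrow> q \<in> X \<Longrightarrow> consistent {p, q}"
  shows "consistent X"
proof -
  have "consistent (\<Union>((\<lambda>p. cl {p}) ` X))"
  proof (rule bounded_if_pairwise_bounded)
    show "finite ((\<lambda>p. cl {p}) ` X)" using assms finite_subset_E by blast
    show "(\<lambda>p. cl {p}) ` X \<subseteq> F" using assms single_F by blast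
    fix U V
    assume "U \<in> (\<lambda>p. cl {p}) ` X" "V \<in> (\<lambda>p. cl {p}) ` X"
    then obtain p q where "p \<in> X" "q \<in> X" "U = cl {p}" "V = cl {q}" by blast
    moreover have "cl (cl {p} \<union> cl {q}) = cl {p, q}"
      by (simp only: cl_cl_Un cl_Un_cl) (simp add: insert_commute)
    ultimately show "consistent (U \<union> V)" using assms(2) consistent_iff by metis
  qed
  moreover have "X \<subseteq> \<Union>((\<lambda>p. cl {p}) ` X)" using in_cl_single by blast
  ultimately show ?thesis using consistent_mono by blast
qed

text \<open>A maximal closed \<open>S\<close> inside \<open>X\<close> absorbs every
  \<open>x \<in> X\<close>: by \<open>pair_split\<close> each element of
  \<open>cl (S \<union> cl {x})\<close> is in \<open>S\<close>, in \<open>cl {x}\<close> or in the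
  closure of a pair from \<open>X\<close>. Consistency is included in the hypothesis, as the closure
  \<open>UNIV\<close> of an inconsistent pair does not fit into \<open>X\<close>.\<close>

theorem closed_if_pairs:
  assumes X: "X \<subseteq> E" and pairs: "\<And>p q. p \<in> X \<Longrightarrow> q \<in> X \<Longrightarrow> cl {p, q} \<subseteq> X"
  shows "X \<in> F"
proof -
  have "consistent {p, q}" if "p \<in> X" "q \<in> X" for p q
    using pairs[OF that] X E_neq_UNIV consistent_iff' by blast
  then have cX: "consistent X" using consistent_if_pairs X by blast
  obtain S where S: "S \<in> F" "S \<subseteq> X"
    and mx: "\<And>T. T \<in> F \<Longrightarrow> T \<subseteq> X \<Longrightarrow> S \<subseteq> T \<Longrightarrow> T = S"
    using obtain_maximal[of "{}" "\<lambda>S. S \<subseteq> X"] empty_F by auto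
  have "X \<subseteq> S"
  proof
    fix x assume x: "x \<in> X"
    have xX: "cl {x} \<subseteq> X" using pairs[OF x x] by simp
    have c: "consistent (S \<union> cl {x})"
      by (rule consistent_mono[OF _ cX]) (use S xX in auto)
    have "cl (S \<union> cl {x}) \<subseteq> X"
    proof
      fix r assume r: "r \<in> cl (S \<union> cl {x})"
      have "cl {x} \<in> F" using single_F x X by blast
      from pair_split[OF S(1) this c r] show "r \<in> X"
        using S(2) xX pairs by blast
    qed
    moreover have "S \<subseteq> cl (S \<union> cl {x})" using cl_ext by blast
    ultimately have "cl (S \<union> cl {x}) = S" using mx cl_F[OF c] by blast
    then show "x \<in> S" using cl_ext[of "S \<union> cl {x}"] in_cl_single[of x] by blast
  qed
  then show ?thesis using S by simp
qed

section \<open>Exchange of generators and irredundant generating sets\<close>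

lemma exchange:
  assumes x: "x \<in> F" and Y: "cl (insert g Y) = x" and D: "D \<noteq> {}" "cl D = x"
  shows "\<exists>d\<in>D. cl (insert d Y) = x"
proof (rule ccontr)
  assume n: "\<not> ?thesis"
  have Ds: "D \<subseteq> x" using D cl_ext by blast
  have gY: "insert g Y \<subseteq> x" using Y cl_ext by blast
  then have gE: "g \<in> E" using x F_sub by blast
  have clY: "cl Y \<in> F" by (rule cl_F_sub[OF _ x]) (use gY in blast)
  have gx: "cl (insert g (cl Y)) = x" using Y cl_Un_cl[of "{g}" Y] by simp
  have cons: "consistent (insert g (cl Y))" using gx x consistent_iff by simp
  have dY: "cl (insert d Y) \<noteq> x" "cl (insert d Y) \<in> F" "cl (insert d Y) \<subseteq> x" if "d \<in> D" for d
  proof -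
    have "insert d Y \<subseteq> x" using gY Ds that by blast
    from cl_F_sub[OF this x] cl_least[OF this x]
    show "cl (insert d Y) \<in> F" "cl (insert d Y) \<subseteq> x" .
    show "cl (insert d Y) \<noteq> x" using n that by blast
  qed
  have gd: "g \<notin> cl (insert d Y)" if "d \<in> D" for d
  proof
    assume "g \<in> cl (insert d Y)"
    then have "insert g Y \<subseteq> cl (insert d Y)" using cl_ext[of "insert d Y"] by blast
    from cl_trans[OF this] show False using Y dY[OF that] by simp
  qed
  \<comment> \<open>Each \<open>cl (insert d Y)\<close> misses \<open>g\<close>, hence lies in the
    largest closed set between \<open>cl Y\<close> and \<open>x\<close> that misses
    \<open>g\<close>. This set would contain all of \<open>D\<close>, contradicting
    \<open>cl D = x\<close>.\<close>
  have "d \<in> cl (low g \<union> cl Y)" if d: "d \<in> D" for d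
  proof -
    have "cl (insert d Y) \<subseteq> cl (low g \<union> cl Y)"
      by (rule sub_cl_low[OF clY gE dY(2)[OF d] gd[OF d] _ _ cons])
        (simp_all add: gx dY[OF d] cl_mono subset_insertI)
    then show ?thesis using cl_ext[of "insert d Y"] by blast
  qed
  then have "x \<subseteq> cl (low g \<union> cl Y)" using D(2) cl_trans[of D "low g \<union> cl Y"] by blast
  then have "g \<in> cl (low g \<union> cl Y)" using gY by blast
  moreover have "g \<notin> cl Y"
  proof -
    obtain d where "d \<in> D" using D(1) by blast
    then show ?thesis using gd cl_mono[of Y "insert d Y"] by blast
  qed
  ultimately show False using notin_cl_low[OF clY gE _ cons] by blast
qed

text \<open>The Kurosh-Ore theorem: the members of \<open>G\<close> are exchanged one at a time for members of \<open>D\<close>.\<close>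

lemma exchange_all:
  assumes "finite G" "x \<in> F" "D \<noteq> {}" "cl D = x" "cl (Y \<union> G) = x"
  shows "\<exists>D'\<subseteq>D. finite D' \<and> card D' \<le> card G \<and> cl (Y \<union> D') = x"
  using assms
proof (induction G arbitrary: Y)
  case empty
  then show ?case by (intro exI[of _ "{}"]) auto
next
  case (insert g G)
  have "cl (insert g (Y \<union> G)) = x" using insert.prems(4) by simp
  from exchange[OF insert.prems(1) this insert.prems(2,3)]
  obtain d where d: "d \<in> D" "cl (insert d (Y \<union> G)) = x" by blast
  then have "cl (insert d Y \<union> G) = x" by simp
  from insert.IH[OF insert.prems(1-3) this]
  obtain D' where D': "D' \<subseteq> D" "finite D'" "card D' \<le> card G" "cl (insert d Y \<union> D') = x" by blast
  have "card (insert d D') \<le> card (insert g G)"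
    using D' insert.hyps by (simp add: card_insert_if)
  then show ?case using d D' by (intro exI[of _ "insert d D'"]) auto
qed

text \<open>Exchanging the members of \<open>G\<close> yields a generating subset of
  \<open>D\<close> with at most \<open>card G\<close> elements. By irredundance this subset is
  \<open>D\<close>.\<close>

lemma irredundant_card_le:
  assumes x: "x \<in> F" and D: "cl D = x" "\<And>d. d \<in> D \<Longrightarrow> cl (D - {d}) \<noteq> x"
    and G: "finite G" "cl G = x"
  shows "card D \<le> card G"
proof (cases "D = {}")
  case False
  have "cl ({} \<union> G) = x" using G by simp
  from exchange_all[OF G(1) x False D(1) this]
  obtain D' where D': "D' \<subseteq> D" "card D' \<le> card G" "cl D' = x" by auto
  have "D' = D"
  proof (rule ccontr)
    assume "D' \<noteq> D"
    then obtain d where d: "d \<in> D" "d \<notin> D'" using D' by blast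
    have "D - {d} \<subseteq> x" using D(1) cl_ext by blast
    then have "cl (D - {d}) \<subseteq> x" using x cl_least by blast
    moreover have "x \<subseteq> cl (D - {d})" using D' d cl_mono[of D' "D - {d}"] by blast
    ultimately show False using D(2) d by blast
  qed
  then show ?thesis using D' by simp
qed simp

section \<open>The interval of height two below the closure of an incomparable pair\<close>

lemma pair_in: "p \<in> cl {p, q}" "q \<in> cl {p, q}" using cl_ext[of "{p, q}"] by auto

definition incomparable :: "'a \<Rightarrow> 'a \<Rightarrow> bool" where
  "incomparable p q \<longleftrightarrow> p \<in> E \<and> q \<in> E \<and> consistent {p, q} \<and> p \<notin> cl {q} \<and> q \<notin> cl {p}"

text \<open>An explicit join in place of the intersection of the maximal closed proper subsets of
  \<open>cl {p, q}\<close>. That it does not depend on the choice of the pair follows from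
  \<open>notin_core_iff\<close>.\<close>

definition core :: "'a \<Rightarrow> 'a \<Rightarrow> 'a set" where "core p q = cl (low p \<union> low q)"

lemma incomparable_sym: "incomparable p q \<Longrightarrow> incomparable q p"
  unfolding incomparable_def by (simp add: insert_commute)

context
  fixes p q
  assumes inc: "incomparable p q"
begin

lemma inc_facts: "p \<in> E" "q \<in> E" "consistent {p, q}" "p \<notin> cl {q}" "q \<notin> cl {p}"
  using inc unfolding incomparable_def by auto

lemma pair_F: "cl {p, q} \<in> F" using inc_facts cl_F by blast

lemma sub_pair:
  assumes "A \<subseteq> cl {p, q}"
  shows "consistent A" "cl A \<subseteq> cl {p, q}" "cl A \<in> F"
  using consistentI[OF assms pair_F] cl_least[OF assms pair_F] cl_F_sub[OF assms pair_F] by auto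

lemma lows_sub: "cl {p} \<subseteq> cl {p, q}" "cl {q} \<subseteq> cl {p, q}" "low p \<subseteq> cl {p, q}" "low q \<subseteq> cl {p, q}"
  using low_sub[of p] low_sub[of q] cl_mono[of "{p}" "{p, q}"] cl_mono[of "{q}" "{p, q}"] by blast+

lemma pair_sub_iff: "X \<in> F \<Longrightarrow> cl {p, q} \<subseteq> X \<longleftrightarrow> p \<in> X \<and> q \<in> X"
  using cl_subset_iff[of X "{p, q}"] by simp

lemma core_F: "core p q \<in> F" and core_sub: "core p q \<subseteq> cl {p, q}"
  unfolding core_def using lows_sub sub_pair[of "low p \<union> low q"] by auto

lemma side_F: "cl (insert q (low p)) \<in> F" and side_sub: "cl (insert q (low p)) \<subseteq> cl {p, q}"
  using lows_sub pair_in sub_pair[of "insert q (low p)"] by auto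

lemma notin_side: "p \<notin> cl (insert q (low p))"
proof -
  have "p \<notin> cl (low p \<union> cl {q})"
  proof (rule notin_cl_low)
    show "consistent (insert p (cl {q}))"
      using lows_sub pair_in sub_pair(1)[of "insert p (cl {q})"] by blast
  qed (use inc_facts single_F in auto)
  then show ?thesis by (simp add: cl_Un_cl)
qed

text \<open>Adjoining \<open>p\<close> to this side gives all of \<open>cl {p, q}\<close>. A proper
  closed \<open>Z\<close> above the side contains \<open>q\<close>, so it misses \<open>p\<close>,
  and \<open>sub_cl_low\<close> bounds it by the join of \<open>low p\<close> with the side, which
  is the side itself.\<close>

lemma side_maximal:
  assumes Z: "Z \<in> F" "cl (insert q (low p)) \<subseteq> Z" "Z \<subseteq> cl {p, q}" "Z \<noteq> cl {p, q}"
  shows "Z = cl (insert q (low p))"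
proof -
  let ?B = "cl (insert q (low p))"
  have "q \<in> Z" using Z(2) cl_ext[of "insert q (low p)"] by blast
  then have p: "p \<notin> Z" using Z pair_sub_iff by blast
  have 1: "insert p ?B \<subseteq> cl {p, q}" using side_sub pair_in by blast
  have 2: "{p, q} \<subseteq> cl (insert p ?B)"
    using cl_ext[of "insert p ?B"] cl_ext[of "insert q (low p)"] by blast
  have e: "cl (insert p ?B) = cl {p, q}"
    by (rule equalityI[OF sub_pair(2)[OF 1] cl_trans[OF 2]])
  have "Z \<subseteq> cl (low p \<union> ?B)"
    by (rule sub_cl_low[OF side_F inc_facts(1) Z(1) p Z(2) _ sub_pair(1)[OF 1]])
      (simp only: e Z(3))
  also have "\<dots> = ?B"
    by (simp add: cl_Un_cl)
  finally show ?thesis using Z(2) by blast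
qed

end

text \<open>The modular law, applied to \<open>low q\<close> below the side of \<open>q\<close>,
  reduces the intersection to the join of \<open>low q\<close> with
  \<open>cl {p} \<inter> cl (insert q (low p))\<close>, which is \<open>low p\<close>.\<close>

lemma sides_Int:
  assumes "incomparable p q"
  shows "cl (insert p (low q)) \<inter> cl (insert q (low p)) = core p q"
proof -
  let ?B = "cl (insert q (low p))"
  note f = inc_facts[OF assms]
  have B: "?B \<in> F" "p \<notin> ?B" "low p \<subseteq> ?B" "q \<in> ?B"
    using side_F[OF assms] notin_side[OF assms] cl_ext[of "insert q (low p)"] by auto
  have "cl {q} \<subseteq> ?B" using B cl_least by blast
  then have qB: "low q \<subseteq> ?B" using low_sub by blast
  have "cl (low q \<union> (cl {p} \<inter> ?B)) = cl (low q \<union> cl {p}) \<inter> ?B"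
  proof (rule modular_Un)
    show "consistent (cl {p} \<union> ?B)"
      by (rule sub_pair(1)[OF assms]) (use lows_sub(1)[OF assms] side_sub[OF assms] in blast)
  qed (use f low_F single_F B qB in auto)
  moreover have "cl {p} \<inter> ?B = low p"
    using cl_single_sub_low[OF B(1,2)] B(3) low_sub by blast
  moreover have "cl (low q \<union> cl {p}) = cl (insert p (low q))"
    by (simp add: cl_Un_cl)
  ultimately show ?thesis by (simp add: core_def Un_commute)
qed

context
  fixes p q
  assumes inc: "incomparable p q"
begin

text \<open>The core is the intersection of all maximal closed proper subsets of \<open>cl {p, q}\<close>.\<close>

lemma cl_Un_core:
  assumes Y: "Y \<in> F" "Y \<subseteq> cl {p, q}" "Y \<noteq> cl {p, q}"
  shows "cl (Y \<union> core p q) \<noteq> cl {p, q}"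
proof -
  obtain M where M: "M \<in> F" "Y \<subseteq> M \<and> M \<subset> cl {p, q}"
    and mx: "\<And>T. T \<in> F \<Longrightarrow> Y \<subseteq> T \<and> T \<subset> cl {p, q} \<Longrightarrow> M \<subseteq> T \<Longrightarrow> T = M"
    by (rule obtain_maximal[of Y "\<lambda>M. Y \<subseteq> M \<and> M \<subset> cl {p, q}"]) (use Y in auto)
  \<comment> \<open>If \<open>g\<close> is not in \<open>M\<close>, then
    \<open>cl (low g \<union> M)\<close> misses \<open>g\<close> as well and is still proper, so by
    maximality it equals \<open>M\<close>.\<close>
  have low_in: "low g \<subseteq> M" if g: "g = p \<or> g = q" for g
  proof (cases "g \<in> M")
    case True
    then show ?thesis using cl_least[of "{g}" M] M low_sub[of g] by blast
  next
    case False
    have gs: "g \<in> cl {p, q}" "g \<in> E" "low g \<subseteq> cl {p, q}"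
      using g pair_in lows_sub[OF inc] inc_facts[OF inc] by auto
    have "g \<notin> cl (low g \<union> M)"
    proof (rule notin_cl_low[OF M(1) gs(2) False])
      show "consistent (insert g M)" by (rule sub_pair(1)[OF inc]) (use gs M in blast)
    qed
    moreover have "low g \<union> M \<subseteq> cl {p, q}" using gs M by blast
    then have "cl (low g \<union> M) \<subseteq> cl {p, q}" "cl (low g \<union> M) \<in> F"
      by (fact sub_pair[OF inc])+
    ultimately have "cl (low g \<union> M) = M"
      using mx[of "cl (low g \<union> M)"] gs M cl_ext[of "low g \<union> M"] by blast
    then show ?thesis using cl_ext[of "low g \<union> M"] by blast
  qed
  have "core p q \<subseteq> M" unfolding core_def by (rule cl_least[OF _ M(1)]) (use low_in in blast)
  then have "cl (Y \<union> core p q) \<subseteq> M" using M(2) by (intro cl_least[OF _ M(1)]) blast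
  then show ?thesis using M by blast
qed

text \<open>If \<open>B\<close> is maximal and meets \<open>Z\<close> in the core, then \<open>Z\<close> covers the core, by modularity.\<close>

lemma eq_if_complement:
  assumes B: "B \<in> F" "B \<subseteq> cl {p, q}" "B \<inter> Z = core p q"
    and mx: "\<And>T. T \<in> F \<Longrightarrow> B \<subseteq> T \<Longrightarrow> T \<subseteq> cl {p, q} \<Longrightarrow> T \<noteq> cl {p, q} \<Longrightarrow> T = B"
    and Y: "Y \<in> F" "core p q \<subseteq> Y" "Y \<noteq> core p q" and Z: "Z \<in> F" "Y \<subseteq> Z" "Z \<subseteq> cl {p, q}"
  shows "Y = Z"
proof -
  have YB: "Y \<union> B \<subseteq> cl {p, q}" by (rule Un_least[OF order_trans[OF Z(2,3)] B(2)])
  have nY: "\<not> Y \<subseteq> B"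
  proof
    assume "Y \<subseteq> B"
    then have "Y \<subseteq> core p q" unfolding B(3)[symmetric] using Z(2) by simp
    then show False using Y(2,3) by simp
  qed
  have YB_eq: "cl (Y \<union> B) = cl {p, q}"
  proof (rule ccontr)
    assume n: "cl (Y \<union> B) \<noteq> cl {p, q}"
    have "B \<subseteq> cl (Y \<union> B)" by (rule order_trans[OF Un_upper2 cl_ext])
    then have "cl (Y \<union> B) = B" using mx[of "cl (Y \<union> B)"] sub_pair(2,3)[OF inc YB] n by simp
    then show False using nY cl_ext[of "Y \<union> B"] by simp
  qed
  have "cl (Y \<union> (B \<inter> Z)) = cl (Y \<union> B) \<inter> Z"
  proof (rule modular_Un[OF Y(1) B(1) Z(1,2)])
    show "consistent (B \<union> Z)" by (rule sub_pair(1)[OF inc Un_least[OF B(2) Z(3)]])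
  qed
  moreover have "Y \<union> core p q = Y" using Y(2) by blast
  ultimately have "Y = cl {p, q} \<inter> Z" using cl_id[OF Y(1)] YB_eq B(3) by simp
  then show ?thesis using Int_absorb1[OF Z(3)] by simp
qed

text \<open>The opposite side is maximal and meets this side exactly in the core, so it serves as
  the complement.\<close>

lemma core_cover_side:
  assumes Y: "Y \<in> F" "core p q \<subseteq> Y" "Y \<noteq> core p q" "Y \<subseteq> cl (insert q (low p))"
  shows "Y = cl (insert q (low p))"
proof (rule eq_if_complement[OF _ _ sides_Int[OF inc] _ Y(1-3) side_F[OF inc] Y(4) side_sub[OF inc]])
  note inc' = incomparable_sym[OF inc]
  show "cl (insert p (low q)) \<in> F" "cl (insert p (low q)) \<subseteq> cl {p, q}"
    using side_F[OF inc'] side_sub[OF inc'] by (simp_all only: insert_commute[of q p])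
  show "T = cl (insert p (low q))"
    if "T \<in> F" "cl (insert p (low q)) \<subseteq> T" "T \<subseteq> cl {p, q}" "T \<noteq> cl {p, q}" for T
    using side_maximal[OF inc' that(1,2)] that(3,4) by (simp only: insert_commute[of q p]) simp
qed

text \<open>If the side \<open>?B\<close> meets \<open>Z\<close> in the core, then \<open>?B\<close>
  is the required complement. Otherwise \<open>?B \<inter> Z\<close> is strictly above the core,
  hence all of \<open>?B\<close>, and \<open>Z = ?B\<close> by maximality. So chains from the core
  to \<open>cl {p, q}\<close> have at most one intermediate set.\<close>

lemma core_cover:
  assumes Y: "Y \<in> F" "core p q \<subseteq> Y" "Y \<noteq> core p q"
    and Z: "Z \<in> F" "Y \<subseteq> Z" "Z \<subseteq> cl {p, q}" "Z \<noteq> cl {p, q}"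
  shows "Y = Z"
proof -
  let ?B = "cl (insert q (low p))"
  note B = side_F[OF inc] side_sub[OF inc]
  show ?thesis
  proof (cases "?B \<inter> Z = core p q")
    case True
    from eq_if_complement[OF B True side_maximal[OF inc] Y Z(1-3)] show ?thesis .
  next
    case False
    have "?B \<inter> Z = ?B"
      by (rule core_cover_side[OF Int_F[OF B(1) Z(1)] _ False Int_lower1])
        (use sides_Int[OF inc] Y(2) Z(2) in blast)
    then have "?B \<subseteq> Z" by blast
    then have "Z = ?B" by (rule side_maximal[OF inc Z(1) _ Z(3,4)])
    then show ?thesis using core_cover_side[OF Y] Z(2) by simp
  qed
qed

section \<open>Branches: the closed sets strictly between the core and
  \<open>cl {p, q}\<close>\<close>

definition branch :: "'a \<Rightarrow> 'a set" where "branch r = cl (insert r (core p q))"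

text \<open>\<open>cl {p, q}\<close> is the join of its proper subsets \<open>cl {p}\<close> and
  \<open>cl {q}\<close>, whereas \<open>cl {r}\<close> is join-irreducible.\<close>

lemma single_neq_pair:
  assumes "r \<in> cl {p, q}"
  shows "cl {r} \<noteq> cl {p, q}"
proof
  assume e: "cl {r} = cl {p, q}"
  have "r \<in> E" using assms pair_F[OF inc] F_sub by blast
  moreover have "cl (cl {p} \<union> cl {q}) = cl {r}"
    using e by (simp only: cl_cl_Un cl_Un_cl) (simp add: insert_commute)
  ultimately have "r \<in> cl {p} \<or> r \<in> cl {q}"
    using cl_single_irreducible single_F inc_facts[OF inc] by blast
  then have "cl {p, q} \<subseteq> cl {p} \<or> cl {p, q} \<subseteq> cl {q}"
    using e cl_trans[of "{r}"] by auto
  then show False using pair_in inc_facts[OF inc] by blast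
qed

lemma proper_Un_core:
  assumes "A \<subseteq> cl {p, q}" "cl A \<noteq> cl {p, q}"
  shows "cl (A \<union> core p q) \<noteq> cl {p, q}"
  using cl_Un_core[of "cl A"] sub_pair[OF inc] assms by (simp add: cl_cl_Un)

context
  fixes r assumes r: "r \<in> cl {p, q}" "r \<notin> core p q"
begin

lemma branch_F: "branch r \<in> F" and branch_sub: "branch r \<subseteq> cl {p, q}"
  using sub_pair[OF inc, of "insert r (core p q)"] r core_sub[OF inc] by (auto simp: branch_def)

lemma branch_in: "r \<in> branch r" and core_sub_branch: "core p q \<subseteq> branch r"
  using cl_ext[of "insert r (core p q)"] unfolding branch_def by auto

lemma branch_neq: "branch r \<noteq> cl {p, q}"
  using proper_Un_core[of "{r}"] single_neq_pair[OF r(1)] r(1) by (simp add: branch_def)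

lemma branch_unique:
  assumes "Z \<in> F" "core p q \<subseteq> Z" "r \<in> Z" "Z \<subseteq> cl {p, q}" "Z \<noteq> cl {p, q}"
  shows "Z = branch r"
proof -
  have "branch r \<subseteq> Z" unfolding branch_def using assms cl_least by auto
  then show ?thesis
    using core_cover[of "branch r" Z] branch_F core_sub_branch branch_in r assms by blast
qed

end

text \<open>Joining the core keeps \<open>cl A\<close> proper, so the result is an intermediate set
  containing \<open>r\<close>, and only \<open>branch r\<close> is one.\<close>

lemma branch_of_proper:
  assumes "A \<subseteq> cl {p, q}" "cl A \<noteq> cl {p, q}" "r \<in> A" "r \<notin> core p q"
  shows "A \<subseteq> branch r"
proof -
  have s: "A \<union> core p q \<subseteq> cl {p, q}" using assms core_sub[OF inc] by blast
  have "cl (A \<union> core p q) = branch r"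
  proof (rule branch_unique)
    show "cl (A \<union> core p q) \<in> F" "cl (A \<union> core p q) \<subseteq> cl {p, q}" using sub_pair[OF inc s] by auto
    show "core p q \<subseteq> cl (A \<union> core p q)" "r \<in> cl (A \<union> core p q)"
      using cl_ext[of "A \<union> core p q"] assms by auto
  qed (use assms proper_Un_core in auto)
  then show ?thesis using cl_ext[of "A \<union> core p q"] by blast
qed

lemma branch_eq:
  assumes "r \<in> cl {p, q}" "r \<notin> core p q" "s \<notin> core p q" "s \<in> branch r"
  shows "branch s = branch r"
proof -
  have "s \<in> cl {p, q}" using branch_sub[OF assms(1,2)] assms by blast
  from branch_unique[OF this assms(3) branch_F[OF assms(1,2)] core_sub_branch[OF assms(1,2)]
      assms(4) branch_sub[OF assms(1,2)] branch_neq[OF assms(1,2)]]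
  show ?thesis by simp
qed

text \<open>Outside the core, not generating \<open>cl {p, q}\<close> together is thus an
  equivalence relation, whose classes are the branches without the core. This allows branches to be
  recognised by closures of pairs alone.\<close>

lemma cl_pair_eq_iff:
  assumes r: "r \<in> cl {p, q}" "r \<notin> core p q" and s: "s \<in> cl {p, q}" "s \<notin> core p q"
  shows "cl {r, s} = cl {p, q} \<longleftrightarrow> branch r \<noteq> branch s"
proof
  assume e: "cl {r, s} = cl {p, q}"
  show "branch r \<noteq> branch s"
  proof
    assume "branch r = branch s"
    then have "{r, s} \<subseteq> branch r" using branch_in[OF r] branch_in[OF s] by simp
    from cl_least[OF this branch_F[OF r]] have "cl {p, q} \<subseteq> branch r" using e by simp
    then show False using branch_sub[OF r] branch_neq[OF r] by blast
  qed
next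
  assume n: "branch r \<noteq> branch s"
  show "cl {r, s} = cl {p, q}"
  proof (rule ccontr)
    assume "cl {r, s} \<noteq> cl {p, q}"
    then have "{r, s} \<subseteq> branch r" using branch_of_proper[of "{r, s}" r] r s(1) by simp
    then show False using branch_eq[OF r s(2)] n by simp
  qed
qed

lemma branches_pq: "p \<notin> core p q" "q \<notin> core p q" "branch p \<noteq> branch q"
proof -
  have "p \<notin> cl (insert q (low p))" by (rule notin_side[OF inc])
  then show p: "p \<notin> core p q" unfolding sides_Int[OF inc, symmetric] by simp
  have "q \<notin> cl (insert p (low q))" by (rule notin_side[OF incomparable_sym[OF inc]])
  then show q: "q \<notin> core p q" unfolding sides_Int[OF inc, symmetric] by simp
  show "branch p \<noteq> branch q" using cl_pair_eq_iff[OF pair_in(1) p pair_in(2) q] by simp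
qed

text \<open>For \<open>r\<close> outside the core, \<open>p\<close> or \<open>q\<close> lies in
  another branch than \<open>r\<close> and generates everything with it. An element of the core
  never helps, since \<open>cl ({s} \<union> core p q)\<close> is proper. The criterion mentions
  only the set \<open>cl {p, q}\<close>, so all pairs with this closure have the same core.\<close>

lemma notin_core_iff:
  assumes r: "r \<in> cl {p, q}"
  shows "r \<notin> core p q \<longleftrightarrow> (\<exists>s\<in>cl {p, q}. cl {r, s} = cl {p, q})"
proof
  assume n: "r \<notin> core p q"
  show "\<exists>s\<in>cl {p, q}. cl {r, s} = cl {p, q}"
  proof (cases "branch r = branch p")
    case True
    then have "cl {r, q} = cl {p, q}"
      using cl_pair_eq_iff[OF r n pair_in(2) branches_pq(2)] branches_pq(3) by simp
    then show ?thesis using pair_in(2) by (rule bexI)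
  next
    case False
    then have "cl {r, p} = cl {p, q}"
      using cl_pair_eq_iff[OF r n pair_in(1) branches_pq(1)] by simp
    then show ?thesis using pair_in(1) by (rule bexI)
  qed
next
  assume "\<exists>s\<in>cl {p, q}. cl {r, s} = cl {p, q}"
  then obtain s where s: "s \<in> cl {p, q}" "cl {r, s} = cl {p, q}" by (rule bexE)
  show "r \<notin> core p q"
  proof
    assume "r \<in> core p q"
    then have "{r, s} \<subseteq> cl ({s} \<union> core p q)" using cl_ext[of "{s} \<union> core p q"] by blast
    from cl_trans[OF this] have 1: "cl {p, q} \<subseteq> cl ({s} \<union> core p q)" using s by simp
    have "{s} \<union> core p q \<subseteq> cl {p, q}" using s(1) core_sub[OF inc] by simp
    from sub_pair(2)[OF inc this] 1 have "cl ({s} \<union> core p q) = cl {p, q}" by (rule equalityI)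
    moreover have "{s} \<subseteq> cl {p, q}" using s(1) by simp
    ultimately show False using proper_Un_core[of "{s}"] single_neq_pair[OF s(1)] by blast
  qed
qed

end

end


section \<open>The optimal base\<close>

definition satisfies :: "'a set \<Rightarrow> 'a implication set \<Rightarrow> bool" where
  "satisfies X \<Sigma> \<longleftrightarrow> (\<forall>A B. (A, B) \<in> \<Sigma> \<longrightarrow> A \<subseteq> X \<longrightarrow> B \<noteq> {} \<and> B \<subseteq> X)"

lemma satisfiesI:
  "(\<And>A B. (A, B) \<in> \<Sigma> \<Longrightarrow> A \<subseteq> X \<Longrightarrow> B \<noteq> {} \<and> B \<subseteq> X) \<Longrightarrow> satisfies X \<Sigma>"
  unfolding satisfies_def by blast

lemma satisfiesD:
  "satisfies X \<Sigma> \<Longrightarrow> (A, B) \<in> \<Sigma> \<Longrightarrow> A \<subseteq> X \<Longrightarrow> B \<noteq> {} \<and> B \<subseteq> X"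
  unfolding satisfies_def by blast

lemma satisfies_Un: "satisfies X (\<Sigma> \<union> \<Sigma>') \<longleftrightarrow> satisfies X \<Sigma> \<and> satisfies X \<Sigma>'"
  unfolding satisfies_def by blast

lemma satisfies_Int: "satisfies X \<Sigma> \<Longrightarrow> satisfies Y \<Sigma> \<Longrightarrow> satisfies (X \<inter> Y) \<Sigma>"
  unfolding satisfies_def by blast

lemma closed_sets_eq: "closed_sets E \<Sigma> = {X. X \<subseteq> E \<and> satisfies X \<Sigma>}"
  unfolding closed_sets_def satisfies_def by blast

text \<open>A choice of the third index for which every pair reaches all indices: the larger index
  climbs to the last one; the last index with \<open>i > 0\<close> yields 0; the last index with 0
  yields 1; and from 0 and 1 everything else is climbed again. With at least three entries the third
  index differs from \<open>i\<close> and \<open>j\<close>.\<close>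

definition line_third :: "'a list \<Rightarrow> nat \<Rightarrow> nat \<Rightarrow> 'a" where
  "line_third rs i j = (if Suc j < length rs then rs ! Suc j else if i = 0 then rs ! 1 else rs ! 0)"

definition lines :: "'a list \<Rightarrow> 'a implication set" where
  "lines rs = (if length rs < 3 then {} else
     {({rs ! i, rs ! j}, {line_third rs i j}) | i j. i < j \<and> j < length rs})"

lemma line_third_in: "i < j \<Longrightarrow> j < length rs \<Longrightarrow> line_third rs i j \<in> set rs"
  unfolding line_third_def by (auto intro!: nth_mem)

lemma lines_generate:
  assumes sat: "satisfies X (lines rs)" and n: "3 \<le> length rs"
    and ij: "i < j" "j < length rs" "rs ! i \<in> X" "rs ! j \<in> X"
  shows "set rs \<subseteq> X"
proof -
  have step: "line_third rs a b \<in> X" if "a < b" "b < length rs" "rs ! a \<in> X" "rs ! b \<in> X" for a b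
  proof -
    have "({rs ! a, rs ! b}, {line_third rs a b}) \<in> lines rs"
      using that n unfolding lines_def by auto
    from satisfiesD[OF sat this] show ?thesis using that by simp
  qed
  have up: "rs ! k \<in> X" if a: "a < b" "b < length rs" "rs ! a \<in> X" "rs ! b \<in> X"
    and k: "b \<le> k" "k < length rs" for a b k
    using k
  proof (induction k rule: dec_induct)
    case base
    then show ?case using a by simp
  next
    case (step k)
    then show ?case using \<open>\<And>a b. _ \<Longrightarrow> _ \<Longrightarrow> _ \<Longrightarrow> _ \<Longrightarrow> line_third rs a b \<in> X\<close>[of a k] a
      by (simp add: line_third_def)
  qed
  obtain l where len: "length rs = Suc l" using n by (cases "length rs") auto
  have l: "rs ! l \<in> X" using up[OF ij, of l] ij n len by simp
  have z: "rs ! 0 \<in> X"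
  proof (cases "i = 0")
    case True
    then show ?thesis using ij by simp
  next
    case False
    then show ?thesis using step[of i l] l ij n len by (simp add: line_third_def)
  qed
  have o: "rs ! 1 \<in> X" using step[of 0 l] l z n len by (simp add: line_third_def)
  have "rs ! k \<in> X" if "k < length rs" for k
    using up[of 0 1 k] z o n that by (cases "k = 0") auto
  then show ?thesis by (auto simp: in_set_conv_nth)
qed

context modular_family
begin

definition line_tops :: "'a set set" where
  "line_tops = {cl {p, q} | p q. incomparable p q}"

text \<open>The complement of the core in \<open>C\<close>, expressed without a generating pair by
  the criterion of \<open>notin_core_iff\<close>.\<close>

definition rim :: "'a set \<Rightarrow> 'a set" where
  "rim C = {r \<in> C. \<exists>s\<in>C. cl {r, s} = C}"

lemma rim_eq: "incomparable p q \<Longrightarrow> rim (cl {p, q}) = cl {p, q} - core p q"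
  using notin_core_iff unfolding rim_def by blast

lemma satisfies_if_closed:
  assumes "closed_sets E \<Sigma> = F" "X \<in> F"
  shows "satisfies X \<Sigma>"
  using assms unfolding closed_sets_eq by blast

lemma violated_if_not_closed:
  assumes "closed_sets E \<Sigma> = F" "X \<notin> F" "X \<subseteq> E"
  obtains A B where "(A, B) \<in> \<Sigma>" "A \<subseteq> X" "B = {} \<or> \<not> B \<subseteq> X"
  using assms unfolding closed_sets_eq satisfies_def by blast

end

text \<open>\<open>R C\<close> represents the branches of \<open>C\<close>: by \<open>R_pair\<close>
  its members lie in different branches, and by \<open>R_cover\<close> each element of the rim
  shares its branch with one of them. The remaining conditions on \<open>Q\<close> refer to
  \<open>gen\<close>, which is built from \<open>D\<close> and \<open>R\<close>, and so form a
  second locale.\<close>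

locale base_data = modular_family +
  fixes D :: "'a \<Rightarrow> 'a set" and R :: "'a set \<Rightarrow> 'a list" and Q :: "('a \<times> 'a) set"
  assumes cl_D: "p \<in> E \<Longrightarrow> cl (D p) = low p"
    and D_irredundant: "p \<in> E \<Longrightarrow> d \<in> D p \<Longrightarrow> cl (D p - {d}) \<noteq> low p"
    and R_distinct: "C \<in> line_tops \<Longrightarrow> distinct (R C)"
    and R_sub: "C \<in> line_tops \<Longrightarrow> set (R C) \<subseteq> rim C"
    and R_pair: "C \<in> line_tops \<Longrightarrow> r \<in> set (R C) \<Longrightarrow> s \<in> set (R C) \<Longrightarrow> r \<noteq> s \<Longrightarrow> cl {r, s} = C"
    and R_cover: "C \<in> line_tops \<Longrightarrow> r \<in> rim C \<Longrightarrow> \<exists>s\<in>set (R C). cl {r, s} \<noteq> C"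
    and Q_sub: "(r, s) \<in> Q \<Longrightarrow> r \<in> E \<and> s \<in> E \<and> cl {r, s} \<notin> F"
begin

definition low_rules :: "'a implication set" where
  "low_rules = {({p}, D p) | p. p \<in> E \<and> D p \<noteq> {}}"

definition line_rules :: "'a implication set" where
  "line_rules = (\<Union>C\<in>line_tops. lines (R C))"

definition conflict_rules :: "'a implication set" where
  "conflict_rules = {({r, s}, {}) | r s. (r, s) \<in> Q}"

text \<open>Since conflicts are ignored, this closure stays inside \<open>E\<close> and remains
  informative for inconsistent subsets of \<open>E\<close>.\<close>

definition gen :: "'a set \<Rightarrow> 'a set" where
  "gen A = \<Inter>{Y. Y \<subseteq> E \<and> satisfies Y (low_rules \<union> line_rules) \<and> A \<subseteq> Y}"

lemma D_sub_low: "p \<in> E \<Longrightarrow> D p \<subseteq> low p"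
  using cl_D cl_ext by blast

lemma line_rulesE:
  assumes "(A, B) \<in> line_rules"
  obtains C i j where "C \<in> line_tops" "3 \<le> length (R C)" "i < j" "j < length (R C)"
    "A = {R C ! i, R C ! j}" "B = {line_third (R C) i j}" "cl A = C"
proof -
  obtain C where C: "C \<in> line_tops" "(A, B) \<in> lines (R C)"
    using assms unfolding line_rules_def by blast
  then obtain i j where ij: "3 \<le> length (R C)" "i < j" "j < length (R C)"
    "A = {R C ! i, R C ! j}" "B = {line_third (R C) i j}"
    unfolding lines_def by (auto split: if_splits)
  have "R C ! i \<noteq> R C ! j" using R_distinct[OF C(1)] ij by (simp add: nth_eq_iff_index_eq)
  then have "cl A = C" using R_pair[OF C(1)] ij by simp
  then show thesis using that C ij by blast
qed

lemma line_top_F: "C \<in> line_tops \<Longrightarrow> C \<in> F"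
  unfolding line_tops_def using pair_F by auto

lemma proper_rules_sub_cl:
  assumes "(A, B) \<in> low_rules \<union> line_rules"
  shows "B \<noteq> {} \<and> B \<subseteq> cl A \<and> cl A \<in> F"
proof (cases "(A, B) \<in> low_rules")
  case True
  then obtain p where "p \<in> E" "D p \<noteq> {}" "A = {p}" "B = D p" unfolding low_rules_def by blast
  then show ?thesis using D_sub_low low_sub single_F by blast
next
  case False
  then have "(A, B) \<in> line_rules" using assms by blast
  then obtain C i j where C: "C \<in> line_tops" "i < j" "j < length (R C)"
    "B = {line_third (R C) i j}" "cl A = C" by (rule line_rulesE)
  have "set (R C) \<subseteq> C" using R_sub[OF C(1)] unfolding rim_def by blast
  then show ?thesis using C line_third_in[OF C(2,3)] line_top_F by auto
qed

lemma proper_rules_satisfied: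
  assumes "X \<in> F"
  shows "satisfies X (low_rules \<union> line_rules)"
proof (rule satisfiesI)
  fix A B assume AB: "(A, B) \<in> low_rules \<union> line_rules" "A \<subseteq> X"
  then show "B \<noteq> {} \<and> B \<subseteq> X"
    using proper_rules_sub_cl[OF AB(1)] cl_least[OF AB(2) assms] by auto
qed

text \<open>By the induction hypothesis and \<open>closed_if_pairs\<close>, \<open>Y\<close> meets
  every closed \<open>W\<close> strictly inside \<open>cl {p, q}\<close> in a closed set. So
  \<open>Y\<close> contains the closures of its subsets of \<open>W\<close>, and rules are needed
  only for the last step up to \<open>cl {p, q}\<close>.\<close>

lemma pair_closed_if_satisfies:
  assumes Y: "Y \<subseteq> E" "satisfies Y (low_rules \<union> line_rules)"
  shows "p \<in> Y \<Longrightarrow> q \<in> Y \<Longrightarrow> consistent {p, q} \<Longrightarrow> cl {p, q} \<subseteq> Y"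
proof (induction "card (cl {p, q})" arbitrary: p q rule: less_induct)
  case less
  let ?C = "cl {p, q}"
  have CF: "?C \<in> F" using less.prems cl_F by simp
  have finC: "finite ?C" using finite_in_F[OF CF] .
  have small: "Y \<inter> W \<in> F" if W: "W \<in> F" "W \<subset> ?C" for W
  proof (rule closed_if_pairs)
    show "Y \<inter> W \<subseteq> E" using Y by blast
    fix a b assume ab: "a \<in> Y \<inter> W" "b \<in> Y \<inter> W"
    have abW: "{a, b} \<subseteq> W" using ab by blast
    have "card W < card ?C" using psubset_card_mono[OF finC W(2)] .
    moreover have "card (cl {a, b}) \<le> card W"
      using card_mono[OF finite_in_F[OF W(1)] cl_least[OF abW W(1)]] .
    ultimately have "cl {a, b} \<subseteq> Y"
      using less.hyps[of a b] ab consistentI[OF abW W(1)] by simp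
    then show "cl {a, b} \<subseteq> Y \<inter> W" using cl_least[OF abW W(1)] by simp
  qed
  have sub: "cl A \<subseteq> Y" if "A \<subseteq> Y" "A \<subseteq> W" "W \<in> F" "W \<subset> ?C" for A W
    using cl_least[of A "Y \<inter> W"] small[OF that(3,4)] that by simp
  have pqE: "p \<in> E" "q \<in> E" using less.prems Y by auto
  show ?case
  proof (cases "incomparable p q")
    case False
    then have "p \<in> cl {q} \<or> q \<in> cl {p}"
      using less.prems pqE unfolding incomparable_def by simp
    \<comment> \<open>Comparable elements: the pair has the closure of its larger member
      \<open>t\<close>. The rule for \<open>t\<close> puts \<open>D t\<close> into \<open>Y\<close>,
      and \<open>D t\<close> generates the smaller closed set \<open>low t\<close>.\<close>
    then obtain t where t: "t = p \<or> t = q" "{p, q} \<subseteq> cl {t}"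
      using in_cl_single[of p] in_cl_single[of q] by (metis empty_subsetI insert_subset)
    have tY: "t \<in> Y" "t \<in> E" using t pqE less.prems by auto
    have eq: "?C = cl {t}"
      using cl_trans[OF t(2)] cl_mono[of "{t}" "{p, q}"] t(1) by auto
    have "low t \<subset> ?C" unfolding eq using low_sub low_notin in_cl_single by blast
    moreover have "D t \<subseteq> Y"
    proof (cases "D t = {}")
      case False
      then have "({t}, D t) \<in> low_rules \<union> line_rules" using tY unfolding low_rules_def by blast
      from satisfiesD[OF Y(2) this] show ?thesis using tY by simp
    qed simp
    ultimately have "low t \<subseteq> Y"
      using sub[OF _ D_sub_low[OF tY(2)] low_F[OF tY(2)]] cl_D[OF tY(2)] by simp
    then show ?thesis using tY unfolding eq cl_single_eq by simp
  next
    case True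
    note inc = True
    have C: "?C \<in> line_tops" using True unfolding line_tops_def by blast
    have pn: "cl {p} \<subset> ?C" "cl {q} \<subset> ?C"
      using lows_sub[OF inc] pair_in[of p q] pair_in[of q p] inc unfolding incomparable_def by blast+
    have "cl {p} \<subseteq> Y" by (rule sub[OF _ cl_ext single_F pn(1)]) (use less.prems pqE in auto)
    moreover have "cl {q} \<subseteq> Y" by (rule sub[OF _ cl_ext single_F pn(2)]) (use less.prems pqE in auto)
    ultimately have lowY: "low p \<union> low q \<subseteq> Y" using low_sub by blast
    have "core p q \<subset> ?C" using core_sub[OF inc] branches_pq(1)[OF inc] pair_in(1) by blast
    then have coreY: "core p q \<subseteq> Y" unfolding core_def
      using sub[OF lowY, of "core p q"] core_F[OF inc] cl_ext[of "low p \<union> low q"]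
      unfolding core_def by simp
    have branchY: "branch p q r \<subseteq> Y" if r: "r \<in> Y" "r \<in> rim ?C" for r
    proof -
      have r': "r \<in> ?C" "r \<notin> core p q" using r(2) rim_eq[OF inc] by auto
      have "branch p q r \<subset> ?C"
        using branch_sub[OF inc r'] branch_neq[OF inc r'] by blast
      moreover have "insert r (core p q) \<subseteq> branch p q r"
        using branch_in[OF inc r'] core_sub_branch[OF inc r'] by simp
      ultimately show ?thesis
        using sub[of "insert r (core p q)" "branch p q r"] branch_F[OF inc r'] coreY r(1)
      unfolding branch_def[OF inc] by simp
    qed
    have rep: "\<exists>s\<in>set (R ?C). branch p q r = branch p q s" if r: "r \<in> rim ?C" for r
    proof -
      obtain s where s: "s \<in> set (R ?C)" "cl {r, s} \<noteq> ?C" using R_cover[OF C r] by blast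
      have "s \<in> rim ?C" using R_sub[OF C] s by blast
      then have "branch p q r = branch p q s"
        using cl_pair_eq_iff[OF inc, of r s] r s(2) unfolding rim_eq[OF inc] by blast
      then show ?thesis using s by blast
    qed
    have R_core: "s \<in> ?C" "s \<notin> core p q" "s \<in> rim ?C" if "s \<in> set (R ?C)" for s
      using that R_sub[OF C] unfolding rim_eq[OF inc] by auto
    have pqr: "p \<in> rim ?C" "q \<in> rim ?C"
      unfolding rim_eq[OF inc] using pair_in branches_pq[OF inc] by auto
    \<comment> \<open>The branches of \<open>p\<close> and \<open>q\<close> differ and are contained
      in \<open>Y\<close>, hence so are their representatives. Two representatives give all others
      by the line rules, and these bring the remaining branches into \<open>Y\<close>.\<close>
    obtain s where s: "s \<in> set (R ?C)" "branch p q p = branch p q s" using rep[OF pqr(1)] by blast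
    obtain t where t: "t \<in> set (R ?C)" "branch p q q = branch p q t" using rep[OF pqr(2)] by blast
    have st: "s \<noteq> t" using s t branches_pq(3)[OF inc] by auto
    have sY: "s \<in> Y"
      using branchY[OF less.prems(1) pqr(1)] s(2) branch_in[OF inc R_core(1,2)[OF s(1)]] by blast
    have tY: "t \<in> Y"
      using branchY[OF less.prems(2) pqr(2)] t(2) branch_in[OF inc R_core(1,2)[OF t(1)]] by blast
    have RY: "set (R ?C) \<subseteq> Y"
    proof (cases "length (R ?C) < 3")
      case True
      have "card {s, t} = 2" using st by simp
      moreover have "card (set (R ?C)) \<le> 2" using True card_length[of "R ?C"] by linarith
      ultimately have "{s, t} = set (R ?C)"
        using s t by (intro card_seteq) auto
      then have "set (R ?C) = {s, t}" by (rule sym)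
      then show ?thesis using sY tY by simp
    next
      case False
      obtain i where i: "i < length (R ?C)" "R ?C ! i = s" using s(1) by (auto simp: in_set_conv_nth)
      obtain j where j: "j < length (R ?C)" "R ?C ! j = t" using t(1) by (auto simp: in_set_conv_nth)
      have sat: "satisfies Y (lines (R ?C))"
        using Y(2) C unfolding satisfies_def line_rules_def by blast
      have n: "3 \<le> length (R ?C)" using False by simp
      have "i \<noteq> j" using i j st by auto
      then show ?thesis
        using lines_generate[OF sat n, of i j] lines_generate[OF sat n, of j i] i j sY tY
        by (meson linorder_neqE_nat)
    qed
    show ?thesis
    proof
      fix r assume r: "r \<in> ?C"
      show "r \<in> Y"
      proof (cases "r \<in> core p q")
        case True
        then show ?thesis using coreY by blast
      next
        case False
        then have "r \<in> rim ?C" using r rim_eq[OF inc] by blast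
        then obtain u where u: "u \<in> set (R ?C)" "branch p q r = branch p q u" using rep by blast
        then have "branch p q u \<subseteq> Y" using branchY[of u] RY R_core(3)[OF u(1)] by blast
        then show ?thesis using branch_in[OF inc r False] u(2) by blast
      qed
    qed
  qed
qed

text \<open>Only \<open>A\<close> has to be consistent, not \<open>Y\<close>. The intersection
  \<open>Y \<inter> cl A\<close> is tested for closedness by pairs, all of which are consistent as
  they lie in \<open>cl A\<close>.\<close>

lemma cl_closed_if_satisfies:
  assumes Y: "Y \<subseteq> E" "satisfies Y (low_rules \<union> line_rules)" and A: "A \<subseteq> Y" "consistent A"
  shows "cl A \<subseteq> Y"
proof -
  have F: "cl A \<in> F" using A cl_F by blast
  have "Y \<inter> cl A \<in> F"
  proof (rule closed_if_pairs)
    show "Y \<inter> cl A \<subseteq> E" using Y by blast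
    fix p q assume pq: "p \<in> Y \<inter> cl A" "q \<in> Y \<inter> cl A"
    then have s: "{p, q} \<subseteq> cl A" by simp
    have "cl {p, q} \<subseteq> Y"
      using pair_closed_if_satisfies[OF Y] pq consistentI[OF s F] by simp
    then show "cl {p, q} \<subseteq> Y \<inter> cl A" using cl_least[OF s F] by simp
  qed
  then show ?thesis using cl_least[of A "Y \<inter> cl A"] A cl_ext[of A] by simp
qed

lemma gen_least: "Y \<subseteq> E \<Longrightarrow> satisfies Y (low_rules \<union> line_rules) \<Longrightarrow> A \<subseteq> Y \<Longrightarrow> gen A \<subseteq> Y"
  unfolding gen_def by blast

lemma E_satisfies: "satisfies E (low_rules \<union> line_rules)"
proof (rule satisfiesI)
  fix A B assume AB: "(A, B) \<in> low_rules \<union> line_rules"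
  then show "B \<noteq> {} \<and> B \<subseteq> E"
    using proper_rules_sub_cl[OF AB] F_sub[of "cl A"] by auto
qed

lemma gen_sub_E: "A \<subseteq> E \<Longrightarrow> gen A \<subseteq> E"
  using gen_least[OF order_refl E_satisfies] .

lemma gen_ext: "A \<subseteq> gen A"
  unfolding gen_def by blast

lemma gen_satisfies: "A \<subseteq> E \<Longrightarrow> satisfies (gen A) (low_rules \<union> line_rules)"
proof (rule satisfiesI)
  fix U B assume U: "(U, B) \<in> low_rules \<union> line_rules" "U \<subseteq> gen A"
  have "B \<subseteq> Y" if "Y \<subseteq> E" "satisfies Y (low_rules \<union> line_rules)" "A \<subseteq> Y" for Y
    using satisfiesD[OF that(2) U(1)] U(2) gen_least[OF that] by simp
  then show "B \<noteq> {} \<and> B \<subseteq> gen A"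
    using proper_rules_sub_cl[OF U(1)] unfolding gen_def by blast
qed

end

text \<open>The two conditions make \<open>(r, s) \<mapsto> gen {r, s}\<close> a bijection from
  \<open>Q\<close> onto the minimal inconsistent subsets of \<open>E\<close> that satisfy the proper
  rules. Pairs are ordered, so irredundance also excludes having both \<open>(r, s)\<close> and
  \<open>(s, r)\<close>.\<close>

locale optimal_data = base_data +
  assumes Q_cover: "p \<in> E \<Longrightarrow> q \<in> E \<Longrightarrow> cl {p, q} \<notin> F \<Longrightarrow> \<exists>(r, s)\<in>Q. {r, s} \<subseteq> gen {p, q}"
    and Q_irredundant: "(r, s) \<in> Q \<Longrightarrow> (r', s') \<in> Q \<Longrightarrow> {r', s'} \<subseteq> gen {r, s} \<Longrightarrow> (r', s') = (r, s)"
begin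

definition base :: "'a implication set" where
  "base = low_rules \<union> line_rules \<union> conflict_rules"

lemma Q_pair_in_inconsistent:
  assumes Y: "Y \<subseteq> E" "satisfies Y (low_rules \<union> line_rules)" and A: "A \<subseteq> Y" "\<not> consistent A"
  shows "\<exists>(r, s)\<in>Q. {r, s} \<subseteq> Y"
proof -
  have "\<not> (\<forall>p\<in>A. \<forall>q\<in>A. consistent {p, q})"
    using consistent_if_pairs[of A] A order_trans[OF A(1) Y(1)] by metis
  then obtain p q where pq: "p \<in> A" "q \<in> A" "\<not> consistent {p, q}" by blast
  then have n: "cl {p, q} \<notin> F" using consistent_iff by simp
  have pqY: "{p, q} \<subseteq> Y" using pq(1,2) A(1) by blast
  then have "p \<in> E" "q \<in> E" using Y(1) by auto
  from Q_cover[OF this n] obtain r s where "(r, s) \<in> Q" "{r, s} \<subseteq> gen {p, q}" by auto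
  moreover have "gen {p, q} \<subseteq> Y" by (rule gen_least[OF Y pqY])
  ultimately show ?thesis by (intro bexI[of _ "(r, s)"]) auto
qed

lemma closed_sets_base: "closed_sets E base = F"
proof (intro equalityI subsetI)
  fix X assume X: "X \<in> F"
  have "satisfies X conflict_rules"
  proof (rule satisfiesI)
    fix A B assume "(A, B) \<in> conflict_rules" "A \<subseteq> X"
    then obtain r s where "(r, s) \<in> Q" "{r, s} \<subseteq> X" unfolding conflict_rules_def by blast
    then have False using Q_sub[of r s] cl_F_sub[of "{r, s}", OF _ X] by simp
    then show "B \<noteq> {} \<and> B \<subseteq> X" ..
  qed
  then show "X \<in> closed_sets E base"
    unfolding closed_sets_eq base_def using X F_sub proper_rules_satisfied satisfies_Un by blast
next
  fix X assume "X \<in> closed_sets E base"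
  then have X: "X \<subseteq> E" "satisfies X (low_rules \<union> line_rules)" "satisfies X conflict_rules"
    unfolding closed_sets_eq base_def satisfies_Un by auto
  have "consistent X"
  proof (rule ccontr)
    assume "\<not> consistent X"
    then obtain r s where rs: "(r, s) \<in> Q" "{r, s} \<subseteq> X"
      using Q_pair_in_inconsistent[OF X(1,2) order_refl] by blast
    then have "({r, s}, {}) \<in> conflict_rules" unfolding conflict_rules_def by blast
    from satisfiesD[OF X(3) this rs(2)] show False by simp
  qed
  then have "cl X \<subseteq> X" "cl X \<in> F" using cl_closed_if_satisfies[OF X(1,2) order_refl] cl_F by auto
  then show "X \<in> F" using cl_ext[of X] by (metis equalityI)
qed

lemma implications_on_base: "implications_on E base"
proof -
  have "A \<subseteq> E \<and> B \<subseteq> E" if "(A, B) \<in> base" for A B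
  proof (cases "(A, B) \<in> low_rules \<union> line_rules")
    case True
    then have "B \<subseteq> cl A" "cl A \<in> F" using proper_rules_sub_cl by auto
    then show ?thesis using F_sub cl_ext by blast
  next
    case False
    then show ?thesis using that Q_sub unfolding base_def conflict_rules_def by blast
  qed
  then show ?thesis unfolding implications_on_def by blast
qed

lemma implicational_base_base: "implicational_base E F base"
  unfolding implicational_base_def using implications_on_base closed_sets_base by simp

end


section \<open>Lower bounds\<close>

abbreviation isize :: "'a implication \<Rightarrow> nat" where
  "isize \<equiv> \<lambda>(A, B). card A + card B"

lemma sum_isize_inj_le:
  fixes g :: "'b \<Rightarrow> 'a implication" and h :: "'b \<Rightarrow> 'a implication"
  assumes P: "finite P" and S: "finite S" and h: "h ` P \<subseteq> S" "inj_on h P"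
    and le: "\<And>x. x \<in> P \<Longrightarrow> isize (g x) \<le> isize (h x)"
  shows "sum isize (g ` P) \<le> sum isize S"
proof -
  have "sum isize (g ` P) \<le> sum (isize \<circ> g) P" by (rule sum_image_le[OF P]) simp
  also have "\<dots> \<le> sum (isize \<circ> h) P" by (rule sum_mono) (use le in simp)
  also have "\<dots> = sum isize (h ` P)" by (rule sum.reindex[OF h(2), symmetric])
  also have "\<dots> \<le> sum isize S" by (rule sum_mono2[OF S h(1)]) simp
  finally show ?thesis .
qed

context optimal_data
begin

section \<open>Classwise comparison with an arbitrary base\<close>

context
  fixes \<Sigma> :: "'a implication set"
  assumes is_base: "implicational_base E F \<Sigma>"
begin

lemma base_closed: "closed_sets E \<Sigma> = F"
  using is_base unfolding implicational_base_def by simp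

lemma base_sub: "(A, B) \<in> \<Sigma> \<Longrightarrow> A \<subseteq> E \<and> B \<subseteq> E"
  using is_base unfolding implicational_base_def implications_on_def by blast

lemma base_finite: "finite \<Sigma>"
proof -
  have "\<Sigma> \<subseteq> Pow E \<times> Pow E" using base_sub by auto
  then show ?thesis using finite_E by (meson finite_Pow_iff finite_SigmaI finite_subset)
qed

lemma base_sub_cl:
  assumes "(A, B) \<in> \<Sigma>" "consistent A"
  shows "B \<noteq> {}" "B \<subseteq> cl A"
  using satisfiesD[OF satisfies_if_closed[OF base_closed cl_F[OF assms(2)]] assms(1) cl_ext] by auto

definition in_class :: "'a set \<Rightarrow> 'a implication set" where
  "in_class C = {\<sigma> \<in> \<Sigma>. cl (fst \<sigma>) = C}"

lemma in_class_finite: "finite (in_class C)"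
  unfolding in_class_def using base_finite by simp

text \<open>The right-hand sides of the implications in the class of \<open>cl {p}\<close> generate \<open>low p\<close>:
  if they only generated a smaller closed set \<open>M\<close>, then \<open>insert p M\<close> would be closed.\<close>

lemma low_rule_le:
  assumes p: "p \<in> E" and ne: "D p \<noteq> {}"
  shows "isize ({p}, D p) \<le> sum isize (in_class (cl {p}))"
proof -
  let ?S = "in_class (cl {p})"
  \<comment> \<open>Right-hand sides in this class may repeat \<open>p\<close>, which does not
    belong to \<open>low p\<close>.\<close>
  define G where "G = (\<Union>\<sigma>\<in>?S. snd \<sigma>) - {p}"
  have Bsub: "B \<subseteq> cl {p}" "B \<noteq> {}" if "(A, B) \<in> ?S" for A B
  proof -
    have AB: "(A, B) \<in> \<Sigma>" "cl A = cl {p}" using that unfolding in_class_def by auto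
    have "consistent A" using AB(2) single_F[OF p] consistent_iff by simp
    from base_sub_cl[OF AB(1) this] AB(2) show "B \<subseteq> cl {p}" "B \<noteq> {}" by auto
  qed
  have Gsub: "G \<subseteq> low p"
  proof
    fix x assume "x \<in> G"
    then obtain A B where "(A, B) \<in> ?S" "x \<in> B" "x \<noteq> p" unfolding G_def by auto
    then show "x \<in> low p" using Bsub(1) cl_single_eq[of p] by blast
  qed
  have viol: "\<exists>A B. (A, B) \<in> ?S \<and> A \<subseteq> insert p M \<and> \<not> B \<subseteq> insert p M"
    if M: "M \<in> F" "M \<subset> low p" for M
  proof -
    have "insert p M \<notin> F"
    proof
      assume "insert p M \<in> F"
      then have "cl {p} \<subseteq> insert p M" using cl_least by simp
      then show False using M cl_single_eq[of p] low_notin[of p] by blast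
    qed
    moreover have "insert p M \<subseteq> E" using p F_sub[OF M(1)] by simp
    ultimately obtain A B where AB: "(A, B) \<in> \<Sigma>" "A \<subseteq> insert p M" "B = {} \<or> \<not> B \<subseteq> insert p M"
      by (rule violated_if_not_closed[OF base_closed])
    have Ap: "A \<subseteq> cl {p}" using AB(2) M(2) cl_single_eq[of p] by blast
    have cA: "consistent A" by (rule consistentI[OF Ap single_F[OF p]])
    have "p \<in> A"
    proof (rule ccontr)
      assume "p \<notin> A"
      then have "cl A \<subseteq> M" using AB(2) cl_least[OF _ M(1)] by blast
      then show False using base_sub_cl[OF AB(1) cA] AB(3) by blast
    qed
    then have "cl A = cl {p}" using cl_least[OF Ap single_F[OF p]] cl_mono[of "{p}" A] by blast
    then have "(A, B) \<in> ?S" unfolding in_class_def using AB by simp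
    then show ?thesis using AB base_sub_cl[OF AB(1) cA] by blast
  qed
  have low_ne: "low p \<noteq> {}" using D_sub_low[OF p] ne by blast
  have clG: "cl G = low p"
  proof (rule ccontr)
    assume n: "cl G \<noteq> low p"
    have GF: "cl G \<in> F" "cl G \<subseteq> low p"
      using cl_F_sub[OF Gsub low_F[OF p]] cl_least[OF Gsub low_F[OF p]] by auto
    then obtain A B where AB: "(A, B) \<in> ?S" "\<not> B \<subseteq> insert p (cl G)" using viol[of "cl G"] n by blast
    have "B - {p} \<subseteq> G" unfolding G_def using AB(1) by force
    then show False using AB(2) cl_ext[of G] by blast
  qed
  \<comment> \<open>The violation at \<open>M = {}\<close> supplies an implication with left-hand
    side \<open>{p}\<close>. It pays for the premise, while \<open>G\<close> pays for the right-hand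
    side.\<close>
  obtain A0 B0 where A0: "(A0, B0) \<in> ?S" "A0 \<subseteq> insert p {}"
    using viol[OF empty_F] low_ne by blast
  have A0_ne: "A0 \<noteq> {}"
  proof
    assume "A0 = {}"
    then have "cl {p} = {}" using A0(1) cl_id[OF empty_F] unfolding in_class_def by simp
    then show False using in_cl_single[of p] by simp
  qed
  have fin: "finite (snd \<sigma>)" "finite (fst \<sigma>)" if "\<sigma> \<in> ?S" for \<sigma>
    using that base_sub[of "fst \<sigma>" "snd \<sigma>"] finite_subset_E unfolding in_class_def by auto
  have "card (D p) \<le> card G"
  proof (rule irredundant_card_le[OF low_F[OF p] cl_D[OF p] D_irredundant[OF p]])
    show "finite G" using finite_subset[OF Gsub finite_in_F[OF low_F[OF p]]] .
  qed (use clG in simp_all)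
  also have "\<dots> \<le> card (\<Union>\<sigma>\<in>?S. snd \<sigma>)"
    unfolding G_def by (rule card_mono) (use in_class_finite fin in auto)
  also have "\<dots> \<le> (\<Sum>\<sigma>\<in>?S. card (snd \<sigma>))"
    by (rule card_UN_le[OF in_class_finite])
  finally have 1: "card (D p) \<le> (\<Sum>\<sigma>\<in>?S. card (snd \<sigma>))" .
  have "0 < card (fst (A0, B0))" using A0_ne fin(2)[OF A0(1)] by (simp add: card_gt_0_iff)
  also have "card (fst (A0, B0)) \<le> (\<Sum>\<sigma>\<in>?S. card (fst \<sigma>))"
    by (rule member_le_sum[OF A0(1)]) (use in_class_finite in auto)
  finally have 2: "1 \<le> (\<Sum>\<sigma>\<in>?S. card (fst \<sigma>))" by simp
  have "sum isize ?S = (\<Sum>\<sigma>\<in>?S. card (fst \<sigma>)) + (\<Sum>\<sigma>\<in>?S. card (snd \<sigma>))"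
    by (simp add: sum.distrib case_prod_beta)
  then show ?thesis using 1 2 by simp
qed

text \<open>The union of two branches is closed under all implications outside of the class of
  \<open>cl {p, q}\<close>, but not closed if there is a third branch.\<close>

lemma two_branches_violated:
  assumes inc: "incomparable p q"
    and r: "r \<in> rim (cl {p, q})" and s: "s \<in> rim (cl {p, q})" and t: "t \<in> rim (cl {p, q})"
    and rs: "branch p q r \<noteq> branch p q s" "branch p q r \<noteq> branch p q t" "branch p q s \<noteq> branch p q t"
  obtains A B where "(A, B) \<in> in_class (cl {p, q})" "A \<subseteq> branch p q r \<union> branch p q s"
    "\<not> A \<subseteq> branch p q r" "\<not> A \<subseteq> branch p q s" "B \<noteq> {}"
proof -
  let ?C = "cl {p, q}" and ?Br = "branch p q r" and ?Bs = "branch p q s"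
  have r': "r \<in> ?C" "r \<notin> core p q" and s': "s \<in> ?C" "s \<notin> core p q" and t': "t \<in> ?C" "t \<notin> core p q"
    using r s t rim_eq[OF inc] by auto
  note Br = branch_F[OF inc r'] branch_sub[OF inc r'] branch_in[OF inc r'] core_sub_branch[OF inc r']
  note Bs = branch_F[OF inc s'] branch_sub[OF inc s'] branch_in[OF inc s'] core_sub_branch[OF inc s']
  have "?Br \<union> ?Bs \<notin> F"
  proof
    assume F: "?Br \<union> ?Bs \<in> F"
    have "{r, s} \<subseteq> ?Br \<union> ?Bs" using Br(3) Bs(3) by simp
    moreover have "cl {r, s} = ?C" using cl_pair_eq_iff[OF inc r' s'] rs(1) by simp
    ultimately have "?C \<subseteq> ?Br \<union> ?Bs" using cl_least[OF _ F, of "{r, s}"] by simp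
    then have "t \<in> ?Br \<or> t \<in> ?Bs" using t'(1) by blast
    then show False using branch_eq[OF inc r' t'(2)] branch_eq[OF inc s' t'(2)] rs by auto
  qed
  moreover have "?Br \<union> ?Bs \<subseteq> E" using F_sub[OF Br(1)] F_sub[OF Bs(1)] by simp
  ultimately obtain A B where AB: "(A, B) \<in> \<Sigma>" "A \<subseteq> ?Br \<union> ?Bs" "B = {} \<or> \<not> B \<subseteq> ?Br \<union> ?Bs"
    by (rule violated_if_not_closed[OF base_closed])
  have AC: "A \<subseteq> ?C" using AB(2) Br(2) Bs(2) by blast
  have cA: "consistent A" by (rule sub_pair(1)[OF inc AC])
  have not_sub: "\<not> A \<subseteq> Z" if "Z \<in> F" "Z \<subseteq> ?Br \<union> ?Bs" for Z
  proof
    assume "A \<subseteq> Z"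
    then have "B \<subseteq> Z" using base_sub_cl[OF AB(1) cA] cl_least[OF _ that(1)] by blast
    then show False using AB(3) base_sub_cl[OF AB(1) cA] that(2) by blast
  qed
  have nr: "\<not> A \<subseteq> ?Br" and ns: "\<not> A \<subseteq> ?Bs"
    using not_sub[OF Br(1)] not_sub[OF Bs(1)] by simp_all
  \<comment> \<open>If \<open>cl A\<close> were proper, an element of \<open>A\<close> outside
    \<open>?Br\<close>, and hence outside the core, would force all of \<open>A\<close> into its own
    branch \<open>?Bs\<close>.\<close>
  have "cl A = ?C"
  proof (rule ccontr)
    assume n: "cl A \<noteq> ?C"
    obtain x where x: "x \<in> A" "x \<notin> ?Br" using nr by blast
    then have xs: "x \<in> ?Bs" "x \<notin> core p q" using AB(2) Br(4) by auto
    have "A \<subseteq> branch p q x" by (rule branch_of_proper[OF inc AC n x(1) xs(2)])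
    also have "branch p q x = ?Bs" by (rule branch_eq[OF inc s' xs(2,1)])
    finally show False using ns by simp
  qed
  then have "(A, B) \<in> in_class ?C" unfolding in_class_def using AB(1) by simp
  then show thesis using that[of A B] AB(2) nr ns base_sub_cl(1)[OF AB(1) cA] by simp
qed

text \<open>Each pair of branches is charged to an implication whose premise lies in their union but
  in neither of them. The premise determines both branches, because distinct branches are disjoint
  outside the core, so no implication is charged twice.\<close>

lemma line_rules_le:
  assumes C: "C \<in> line_tops"
  shows "sum isize (lines (R C)) \<le> sum isize (in_class C)"
proof (cases "length (R C) < 3")
  case True
  then show ?thesis by (simp add: lines_def)
next
  case False
  obtain p q where inc: "incomparable p q" and Cpq: "C = cl {p, q}"
    using C unfolding line_tops_def by blast
  let ?r = "\<lambda>i. R C ! i" and ?n = "length (R C)"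
  let ?b = "\<lambda>i. branch p q (R C ! i)"
  have rim: "?r i \<in> rim (cl {p, q})" if "i < ?n" for i
    using R_sub[OF C] that nth_mem Cpq by blast
  have rim': "?r i \<in> cl {p, q}" "?r i \<notin> core p q" if "i < ?n" for i
    using rim[OF that] rim_eq[OF inc] by auto
  have b_neq: "?b i \<noteq> ?b j" if "i < ?n" "j < ?n" "i \<noteq> j" for i j
  proof -
    have "?r i \<noteq> ?r j" using R_distinct[OF C] that by (simp add: nth_eq_iff_index_eq)
    then have "cl {?r i, ?r j} = cl {p, q}" using R_pair[OF C] that Cpq by simp
    then show ?thesis using cl_pair_eq_iff[OF inc rim'[OF that(1)] rim'[OF that(2)]] by simp
  qed
  define P where "P = {(i, j). i < j \<and> j < ?n}"
  define g :: "nat \<times> nat \<Rightarrow> 'a implication" where "g = (\<lambda>(i, j). ({?r i, ?r j}, {line_third (R C) i j}))"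
  define good :: "nat \<times> nat \<Rightarrow> 'a implication \<Rightarrow> bool"
    where "good = (\<lambda>(i, j) (A, B). A \<subseteq> ?b i \<union> ?b j \<and> \<not> A \<subseteq> ?b i \<and> \<not> A \<subseteq> ?b j \<and> B \<noteq> {})"
  have finP: "finite P"
    by (rule finite_subset[of _ "{..<?n} \<times> {..<?n}"]) (auto simp: P_def)
  have lines: "lines (R C) = g ` P"
    unfolding lines_def g_def P_def using False by (auto simp: image_iff)
  have "\<exists>\<sigma>. \<sigma> \<in> in_class C \<and> good x \<sigma>" if xP: "x \<in> P" for x
  proof -
    obtain i j where x: "x = (i, j)" "i < j" "j < ?n" using xP unfolding P_def by auto
    have "\<exists>k<?n. k \<noteq> i \<and> k \<noteq> j"
    proof (rule ccontr)
      assume "\<not> ?thesis"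
      then have "{..<?n} \<subseteq> {i, j}" by blast
      then have "card {..<?n} \<le> card {i, j}" by (intro card_mono) auto
      also have "\<dots> \<le> 2" by (simp add: card_insert_if)
      finally show False using False by simp
    qed
    then obtain k where k: "k < ?n" "k \<noteq> i" "k \<noteq> j" by blast
    have i: "i < ?n" using x by simp
    obtain A B where "(A, B) \<in> in_class (cl {p, q})" "A \<subseteq> ?b i \<union> ?b j"
      "\<not> A \<subseteq> ?b i" "\<not> A \<subseteq> ?b j" "B \<noteq> {}"
      by (rule two_branches_violated[OF inc rim[OF i] rim[OF x(3)] rim[OF k(1)]
            b_neq[OF i x(3)] b_neq[OF i k(1)] b_neq[OF x(3) k(1)]])
        (use x k in auto)
    then show ?thesis unfolding good_def x(1) Cpq by (intro exI[of _ "(A, B)"]) simp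
  qed
  then obtain h where h: "\<And>x. x \<in> P \<Longrightarrow> h x \<in> in_class C" "\<And>x. x \<in> P \<Longrightarrow> good x (h x)"
    by metis
  have core_b: "core p q \<subseteq> ?b i" if "i < ?n" for i
    by (rule core_sub_branch[OF inc rim'[OF that]])
  \<comment> \<open>Missing some branch keeps \<open>x\<close> out of the core, and outside the core
    an element has only one branch.\<close>
  have only: "k = i" if "i < ?n" "k < ?n" "j < ?n" "x \<in> ?b i" "x \<in> ?b k" "x \<notin> ?b j" for i j k x
  proof (rule ccontr)
    have xc: "x \<notin> core p q" using core_b that by blast
    assume "k \<noteq> i"
    moreover have "branch p q x = ?b i" by (rule branch_eq[OF inc rim'[OF that(1)] xc that(4)])
    moreover have "branch p q x = ?b k" by (rule branch_eq[OF inc rim'[OF that(2)] xc that(5)])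
    ultimately show False using b_neq[OF that(2,1)] by simp
  qed
  have inj: "inj_on h P"
  proof (rule inj_onI)
    fix x y assume xy: "x \<in> P" "y \<in> P" "h x = h y"
    obtain i j where x: "x = (i, j)" "i < j" "j < ?n" using xy(1) unfolding P_def by auto
    obtain k l where y: "y = (k, l)" "k < l" "l < ?n" using xy(2) unfolding P_def by auto
    obtain A B where AB: "h x = (A, B)" by (cases "h x") auto
    have 1: "A \<subseteq> ?b i \<union> ?b j" "\<not> A \<subseteq> ?b i" "\<not> A \<subseteq> ?b j"
      using h(2)[OF xy(1)] AB x unfolding good_def by auto
    have 2: "A \<subseteq> ?b k \<union> ?b l"
      using h(2)[OF xy(2)] AB xy(3) y unfolding good_def by auto
    obtain u where u: "u \<in> A" "u \<notin> ?b i" using 1 by blast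
    obtain v where v: "v \<in> A" "v \<notin> ?b j" using 1 by blast
    have ib: "i < ?n" "k < ?n" using x y by auto
    have "k = j \<or> l = j" using u 1(1) 2 only[of j k i u] only[of j l i u] x y ib by blast
    moreover have "k = i \<or> l = i" using v 1(1) 2 only[of i k j v] only[of i l j v] x y ib by blast
    ultimately show "x = y" using x y by auto
  qed
  have big: "isize (g x) \<le> isize (h x)" if xP: "x \<in> P" for x
  proof -
    obtain i j where x: "x = (i, j)" "i < j" "j < ?n" using xP unfolding P_def by auto
    obtain A B where AB: "h x = (A, B)" by (cases "h x") auto
    have "(A, B) \<in> \<Sigma>" using h(1)[OF xP] AB unfolding in_class_def by simp
    then have fin: "finite A" "finite B" using base_sub[of A B] finite_subset_E by auto
    have 1: "A \<subseteq> ?b i \<union> ?b j" "\<not> A \<subseteq> ?b i" "\<not> A \<subseteq> ?b j" "B \<noteq> {}"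
      using h(2)[OF xP] AB x unfolding good_def by auto
    obtain u where u: "u \<in> A" "u \<notin> ?b i" using 1 by blast
    obtain v where v: "v \<in> A" "v \<notin> ?b j" using 1 by blast
    \<comment> \<open>\<open>u\<close> is in branch \<open>j\<close> but not in branch
      \<open>i\<close>, and \<open>v\<close> the other way round. Two premises and a nonempty
      right-hand side give the bound 3.\<close>
    have "u \<noteq> v" using u v 1(1) by blast
    then have "card {u, v} = 2" by simp
    moreover have "card {u, v} \<le> card A" using u v fin by (intro card_mono) auto
    moreover have "0 < card B" using 1(4) fin by (simp add: card_gt_0_iff)
    moreover have "isize (g x) \<le> 3" unfolding g_def x by (simp add: card_insert_if)
    ultimately show ?thesis using AB by simp
  qed
  have hP: "h ` P \<subseteq> in_class C" using h(1) by blast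
  show ?thesis unfolding lines by (rule sum_isize_inj_le[OF finP in_class_finite hP inj big])
qed

lemma Q_finite: "finite Q"
  by (rule finite_subset[of _ "E \<times> E"]) (use Q_sub finite_E in auto)

text \<open>\<open>gen {r, s}\<close> satisfies the proper rules but is not closed, so an
  implication violated there has an inconsistent premise. If two pairs shared it, the premise would
  lie in both generated sets. Their intersection would then contain a pair of \<open>Q\<close>,
  which by irredundance equals both.\<close>

lemma conflict_rules_le: "sum isize conflict_rules \<le> sum isize (in_class UNIV)"
proof -
  define g :: "'a \<times> 'a \<Rightarrow> 'a implication" where "g = (\<lambda>(r, s). ({r, s}, {}))"
  define good :: "'a \<times> 'a \<Rightarrow> 'a implication \<Rightarrow> bool"
    where "good = (\<lambda>(r, s) \<sigma>. fst \<sigma> \<subseteq> gen {r, s})"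
  have "conflict_rules = g ` Q" unfolding conflict_rules_def g_def by auto
  have "\<exists>\<sigma>. \<sigma> \<in> in_class UNIV \<and> good x \<sigma>" if xQ: "x \<in> Q" for x
  proof -
    obtain r s where x: "x = (r, s)" by (cases x) auto
    have rs: "r \<in> E" "s \<in> E" "cl {r, s} \<notin> F" using Q_sub xQ x by auto
    let ?Y = "gen {r, s}"
    have YE: "?Y \<subseteq> E" and sat: "satisfies ?Y (low_rules \<union> line_rules)"
      using gen_sub_E[of "{r, s}"] gen_satisfies[of "{r, s}"] rs by auto
    have "?Y \<notin> F" using cl_F_sub[OF gen_ext] rs(3) by blast
    then obtain A B where AB: "(A, B) \<in> \<Sigma>" "A \<subseteq> ?Y" "B = {} \<or> \<not> B \<subseteq> ?Y"
      using YE by (rule violated_if_not_closed[OF base_closed])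
    have "\<not> consistent A"
    proof
      assume c: "consistent A"
      show False
        using base_sub_cl[OF AB(1) c] cl_closed_if_satisfies[OF YE sat AB(2) c] AB(3) by blast
    qed
    then have "(A, B) \<in> in_class UNIV" unfolding in_class_def using AB(1) cl_inconsistent by simp
    then show ?thesis using AB(2) unfolding good_def x by (intro exI[of _ "(A, B)"]) simp
  qed
  then obtain h where h: "\<And>x. x \<in> Q \<Longrightarrow> h x \<in> in_class UNIV" "\<And>x. x \<in> Q \<Longrightarrow> good x (h x)"
    by metis
  have incons: "\<not> consistent (fst (h x))" "h x \<in> \<Sigma>" if "x \<in> Q" for x
    using h(1)[OF that] consistent_iff' unfolding in_class_def by auto
  have inj: "inj_on h Q"
  proof (rule inj_onI)
    fix x y assume xy: "x \<in> Q" "y \<in> Q" "h x = h y"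
    obtain r s where x: "x = (r, s)" by (cases x) auto
    obtain r' s' where y: "y = (r', s')" by (cases y) auto
    have E: "{r, s} \<subseteq> E" "{r', s'} \<subseteq> E" using Q_sub xy x y by auto
    let ?Y = "gen {r, s} \<inter> gen {r', s'}"
    have YE: "?Y \<subseteq> E" using gen_sub_E[OF E(1)] by blast
    have sat: "satisfies ?Y (low_rules \<union> line_rules)"
      by (rule satisfies_Int[OF gen_satisfies[OF E(1)] gen_satisfies[OF E(2)]])
    have "fst (h x) \<subseteq> ?Y"
      using h(2)[OF xy(1)] h(2)[OF xy(2)] xy(3) unfolding good_def x y by auto
    from Q_pair_in_inconsistent[OF YE sat this incons(1)[OF xy(1)]]
    obtain c d where cd: "(c, d) \<in> Q" "{c, d} \<subseteq> ?Y" by auto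
    have "(c, d) = (r, s)" using Q_irredundant[of r s c d] cd xy(1) x by simp
    moreover have "(c, d) = (r', s')" using Q_irredundant[of r' s' c d] cd xy(2) y by simp
    ultimately show "x = y" using x y by simp
  qed
  have big: "isize (g x) \<le> isize (h x)" if xQ: "x \<in> Q" for x
  proof -
    obtain A B where AB: "h x = (A, B)" by (cases "h x") auto
    have i: "\<not> consistent A" using incons(1)[OF xQ] AB by simp
    have AE: "A \<subseteq> E" using base_sub[of A B] incons(2)[OF xQ] AB by simp
    \<comment> \<open>The empty set and all singletons of \<open>E\<close> are consistent.\<close>
    have "2 \<le> card A"
    proof (rule ccontr)
      assume "\<not> 2 \<le> card A"
      then have "card A = 0 \<or> card A = Suc 0" by linarith
      then have "A = {} \<or> (\<exists>a. A = {a})"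
        using finite_subset_E[OF AE] by (auto simp: card_Suc_eq)
      then show False using i consistent_empty consistent_single AE by auto
    qed
    moreover have "isize (g x) \<le> 2" unfolding g_def by (cases x) (simp add: card_insert_if)
    ultimately show ?thesis using AB by simp
  qed
  have hQ: "h ` Q \<subseteq> in_class UNIV" using h(1) by blast
  show ?thesis unfolding \<open>conflict_rules = g ` Q\<close>
    by (rule sum_isize_inj_le[OF Q_finite in_class_finite hQ inj big])
qed

text \<open>The three kinds of rules never meet in a class: the closure of a single element is
  join-irreducible, that of an incomparable pair is not, and neither is \<open>UNIV\<close>.\<close>

lemma base_class_sub:
  "{\<gamma> \<in> base. cl (fst \<gamma>) = C} \<subseteq> (if C = UNIV then conflict_rules else if C \<in> line_tops then lines (R C)
     else {({p}, D p) | p. p \<in> E \<and> D p \<noteq> {} \<and> cl {p} = C})"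
proof (rule subsetI)
  fix \<gamma> assume \<gamma>: "\<gamma> \<in> {\<gamma> \<in> base. cl (fst \<gamma>) = C}"
  then consider (low) "\<gamma> \<in> low_rules" | (line) "\<gamma> \<in> line_rules" | (conf) "\<gamma> \<in> conflict_rules"
    unfolding base_def by blast
  then show "\<gamma> \<in> (if C = UNIV then conflict_rules else if C \<in> line_tops then lines (R C)
     else {({p}, D p) | p. p \<in> E \<and> D p \<noteq> {} \<and> cl {p} = C})"
  proof cases
    case low
    then obtain p where p: "\<gamma> = ({p}, D p)" "p \<in> E" "D p \<noteq> {}" unfolding low_rules_def by blast
    then have C: "C = cl {p}" using \<gamma> by simp
    have "cl {p} \<notin> line_tops"
    proof
      assume "cl {p} \<in> line_tops"
      then obtain a b where ab: "incomparable a b" "cl {p} = cl {a, b}" unfolding line_tops_def by blast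
      then have "p \<in> cl {a, b}" using in_cl_single[of p] by simp
      from single_neq_pair[OF ab(1) this] ab(2) show False by simp
    qed
    moreover have "cl {p} \<noteq> UNIV" using single_F[OF p(2)] UNIV_notin_F by metis
    ultimately show ?thesis using p C by auto
  next
    case line
    obtain A B where AB: "\<gamma> = (A, B)" by (cases \<gamma>) auto
    obtain C' i j where C': "C' \<in> line_tops" "3 \<le> length (R C')" "i < j" "j < length (R C')"
      "A = {R C' ! i, R C' ! j}" "B = {line_third (R C') i j}" "cl A = C'"
      using line[unfolded AB] by (rule line_rulesE)
    then have "C' = C" using \<gamma> AB by simp
    moreover have "C' \<noteq> UNIV" using line_top_F[OF C'(1)] UNIV_notin_F by metis
    ultimately show ?thesis using C' unfolding AB lines_def by auto
  next
    case conf
    then obtain r s where "(r, s) \<in> Q" "\<gamma> = ({r, s}, {})" unfolding conflict_rules_def by auto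
    then have "C = UNIV" using \<gamma> Q_sub[of r s] cl_inconsistent consistent_iff by simp
    then show ?thesis using conf by simp
  qed
qed

lemma base_class_le:
  assumes "finite base"
  shows "sum isize {\<gamma> \<in> base. cl (fst \<gamma>) = C} \<le> sum isize (in_class C)"
proof -
  let ?S = "{\<gamma> \<in> base. cl (fst \<gamma>) = C}"
  have le: "sum isize ?S \<le> sum isize T" if "?S \<subseteq> T" "T \<subseteq> base" for T
    using finite_subset[OF that(2) assms] that(1) by (rule sum_mono2) simp
  consider (conf) "C = UNIV" | (line) "C \<noteq> UNIV" "C \<in> line_tops" | (low) "C \<noteq> UNIV" "C \<notin> line_tops" by blast
  then show ?thesis
  proof cases
    case conf
    then show ?thesis
      using le[of conflict_rules] base_class_sub[of C] conflict_rules_le unfolding base_def by simp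
  next
    case line
    then have "lines (R C) \<subseteq> base" unfolding base_def line_rules_def by blast
    then have "sum isize ?S \<le> sum isize (lines (R C))" using le base_class_sub[of C] line by simp
    also have "\<dots> \<le> sum isize (in_class C)" by (rule line_rules_le[OF line(2)])
    finally show ?thesis .
  next
    case low
    show ?thesis
    proof (cases "?S = {}")
      case True
      then show ?thesis by (simp only: sum.empty)
    next
      case False
      have S: "?S \<subseteq> {({p}, D p) | p. p \<in> E \<and> D p \<noteq> {} \<and> cl {p} = C}"
        using base_class_sub[of C] low by simp
      obtain \<gamma> where "\<gamma> \<in> ?S" using False by blast
      then have "\<gamma> \<in> {({p}, D p) | p. p \<in> E \<and> D p \<noteq> {} \<and> cl {p} = C}" by (rule subsetD[OF S])
      then obtain p where p: "p \<in> E" "D p \<noteq> {}" "cl {p} = C" by blast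
      have "?S \<subseteq> {({p}, D p)}"
      proof
        fix \<gamma> assume "\<gamma> \<in> ?S"
        then have "\<gamma> \<in> {({p}, D p) | p. p \<in> E \<and> D p \<noteq> {} \<and> cl {p} = C}" by (rule subsetD[OF S])
        then obtain p' where p': "\<gamma> = ({p'}, D p')" "cl {p'} = C" by blast
        then have "p = p'" using cl_single_inj[OF p(1), of p'] p(3) by simp
        then show "\<gamma> \<in> {({p}, D p)}" using p'(1) by simp
      qed
      moreover have "{({p}, D p)} \<subseteq> base" using p unfolding base_def low_rules_def by blast
      ultimately show ?thesis using le[of "{({p}, D p)}"] low_rule_le[OF p(1,2)] p(3) by simp
    qed
  qed
qed

lemma base_size_le:
  assumes fin: "finite base"
  shows "implications_size base \<le> implications_size \<Sigma>"
proof -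
  let ?k = "\<lambda>\<gamma>. cl (fst \<gamma>)"
  let ?T = "?k ` base \<union> ?k ` \<Sigma>"
  have T: "finite ?T" using fin base_finite by simp
  have "sum isize base = (\<Sum>C\<in>?T. sum isize {\<gamma> \<in> base. ?k \<gamma> = C})"
    by (rule sum.group[symmetric]) (use fin T in auto)
  also have "\<dots> \<le> (\<Sum>C\<in>?T. sum isize {\<gamma> \<in> \<Sigma>. ?k \<gamma> = C})"
    by (rule sum_mono) (use base_class_le[OF fin] in \<open>simp add: in_class_def\<close>)
  also have "\<dots> = sum isize \<Sigma>"
    by (rule sum.group) (use base_finite T in auto)
  finally show ?thesis unfolding implications_size_def .
qed

end

theorem optimal_base_base: "optimal_base E F base"
proof -
  have "base \<subseteq> Pow E \<times> Pow E"
    using implications_on_base unfolding implications_on_def by auto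
  then have "finite base" using finite_E by (meson finite_Pow_iff finite_SigmaI finite_subset)
  then show ?thesis
    unfolding optimal_base_def using implicational_base_base base_size_le by blast
qed

end


section \<open>From modular semilattices to closure systems\<close>

lemma is_join_inclusion_order:
  assumes "A \<subseteq> F"
  shows "is_join (inclusion_order F) s A \<longleftrightarrow> s \<in> F \<and> \<Union>A \<subseteq> s \<and> (\<forall>T\<in>F. \<Union>A \<subseteq> T \<longrightarrow> s \<subseteq> T)"
proof -
  have "A \<inter> F = A" using assms by blast
  then have "Upper (inclusion_order F) A = {T \<in> F. \<Union>A \<subseteq> T}"
    unfolding Upper_def inclusion_order_def by auto
  then show ?thesis
    unfolding is_join_def least_def inclusion_order_def by auto
qed

lemma least_inclusion_order:
  "least (inclusion_order F) s (carrier (inclusion_order F)) \<longleftrightarrow> s \<in> F \<and> (\<forall>T\<in>F. s \<subseteq> T)"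
  unfolding least_def inclusion_order_def by auto

lemma least_Upper_principal_ideal:
  assumes "X \<in> F" "Y \<in> F" "X \<subseteq> W" "Y \<subseteq> W"
  shows "least (principal_ideal (inclusion_order F) W) s (Upper (principal_ideal (inclusion_order F) W) {X, Y}) \<longleftrightarrow>
    s \<in> F \<and> s \<subseteq> W \<and> X \<union> Y \<subseteq> s \<and> (\<forall>T. T \<in> F \<and> T \<subseteq> W \<and> X \<union> Y \<subseteq> T \<longrightarrow> s \<subseteq> T)"
proof -
  have "{X, Y} \<inter> {x \<in> F. x \<subseteq> W} = {X, Y}" using assms by blast
  then have "Upper (principal_ideal (inclusion_order F) W) {X, Y} = {T. T \<in> F \<and> T \<subseteq> W \<and> X \<union> Y \<subseteq> T}"
    unfolding Upper_def principal_ideal_def inclusion_order_def by auto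
  then show ?thesis
    unfolding least_def principal_ideal_def inclusion_order_def by auto
qed

lemma greatest_Lower_principal_ideal:
  assumes "X \<in> F" "Y \<in> F" "X \<subseteq> W" "Y \<subseteq> W"
  shows "greatest (principal_ideal (inclusion_order F) W) s (Lower (principal_ideal (inclusion_order F) W) {X, Y}) \<longleftrightarrow>
    s \<in> F \<and> s \<subseteq> X \<inter> Y \<and> (\<forall>T. T \<in> F \<and> T \<subseteq> X \<inter> Y \<longrightarrow> T \<subseteq> s)"
proof -
  have "{X, Y} \<inter> {x \<in> F. x \<subseteq> W} = {X, Y}" using assms by blast
  then have "Lower (principal_ideal (inclusion_order F) W) {X, Y} = {T. T \<in> F \<and> T \<subseteq> X \<inter> Y}"
    using assms unfolding Lower_def principal_ideal_def inclusion_order_def by auto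
  then show ?thesis
    using assms unfolding greatest_def principal_ideal_def inclusion_order_def by auto
qed

text \<open>The join is a choice among least upper bounds, so it is evaluated through their
  uniqueness.\<close>

lemma join_principal_ideal:
  assumes s: "s \<in> F" "s \<subseteq> W" "X \<union> Y \<subseteq> s" "\<And>T. T \<in> F \<Longrightarrow> X \<union> Y \<subseteq> T \<Longrightarrow> s \<subseteq> T" and XY: "X \<in> F" "Y \<in> F"
  shows "X \<squnion>\<^bsub>principal_ideal (inclusion_order F) W\<^esub> Y = s"
proof -
  have W: "X \<subseteq> W" "Y \<subseteq> W" using s by auto
  show ?thesis
    unfolding join_def sup_def least_Upper_principal_ideal[OF XY W]
    by (rule some_equality) (use s in \<open>simp, metis subset_antisym\<close>)
qed

lemma meet_principal_ideal:
  assumes XY: "X \<in> F" "Y \<in> F" "X \<inter> Y \<in> F" "X \<subseteq> W" "Y \<subseteq> W"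
  shows "X \<sqinter>\<^bsub>principal_ideal (inclusion_order F) W\<^esub> Y = X \<inter> Y"
  unfolding meet_def inf_def greatest_Lower_principal_ideal[OF XY(1,2,4,5)]
  by (rule some_equality) (use XY(3) in \<open>simp, metis order_refl subset_antisym\<close>)

lemma closed_sets_Int:
  assumes "X \<in> closed_sets E \<Sigma>" "Y \<in> closed_sets E \<Sigma>"
  shows "X \<inter> Y \<in> closed_sets E \<Sigma>"
  using assms satisfies_Int unfolding closed_sets_eq by blast

lemma closed_sets_Inter:
  assumes "G \<subseteq> closed_sets E \<Sigma>" "G \<noteq> {}" "finite G"
  shows "\<Inter>G \<in> closed_sets E \<Sigma>"
  using assms(3,2,1)
  by (induction G rule: finite_ne_induct) (auto intro: closed_sets_Int)

text \<open>A join exists iff the union is bounded, and then it is the hull of the union; this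
  translates the lattice conditions. The case \<open>E = {}\<close> is kept apart because there may
  then be no closed set at all.\<close>

lemma modular_family_closed_sets:
  fixes E :: "'a set"
  assumes E: "finite E" "E \<noteq> UNIV" "E \<noteq> {}"
    and simple: "simple_implications E \<Sigma>"
    and mod: "modular_semilattice (inclusion_order (closed_sets E \<Sigma>))"
  shows "modular_family E (closed_sets E \<Sigma>)"
proof -
  define F where "F = closed_sets E \<Sigma>"
  let ?L = "inclusion_order F"
  let ?cl = "\<lambda>A. (\<lambda>V. V \<in> F) hull A"
  have FE: "X \<subseteq> E" if "X \<in> F" for X using that unfolding F_def closed_sets_eq by blast
  have Int: "X \<inter> Y \<in> F" if "X \<in> F" "Y \<in> F" for X Y
    using closed_sets_Int that unfolding F_def by blast
  have finF: "finite F"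
    by (rule finite_subset[of _ "Pow E"]) (use FE E in auto)
  have clF: "?cl A \<in> F" if "A \<subseteq> W" "W \<in> F" for A W
    unfolding hull_def F_def
    by (rule closed_sets_Inter) (use that finF in \<open>auto simp: F_def\<close>)
  have cl_least: "?cl A \<subseteq> W" if "A \<subseteq> W" "W \<in> F" for A W
    using that by (intro hull_minimal)
  have cl_ext: "A \<subseteq> ?cl A" for A by (rule hull_subset)
  have join: "is_join ?L s A \<longleftrightarrow> s = ?cl (\<Union>A) \<and> (\<exists>W\<in>F. \<Union>A \<subseteq> W)" if A: "A \<subseteq> F" for A s
  proof
    assume "is_join ?L s A"
    then have s: "s \<in> F" "\<Union>A \<subseteq> s" "\<And>T. T \<in> F \<Longrightarrow> \<Union>A \<subseteq> T \<Longrightarrow> s \<subseteq> T"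
      using is_join_inclusion_order[OF A] by auto
    have "s = ?cl (\<Union>A)"
      by (rule equalityI[OF s(3)[OF clF[OF s(2,1)] cl_ext] cl_least[OF s(2,1)]])
    then show "s = ?cl (\<Union>A) \<and> (\<exists>W\<in>F. \<Union>A \<subseteq> W)" using s by blast
  next
    assume "s = ?cl (\<Union>A) \<and> (\<exists>W\<in>F. \<Union>A \<subseteq> W)"
    then obtain W where W: "s = ?cl (\<Union>A)" "W \<in> F" "\<Union>A \<subseteq> W" by blast
    show "is_join ?L s A"
      unfolding is_join_inclusion_order[OF A] W(1) using clF[OF W(3,2)] cl_ext cl_least by auto
  qed
  have bij: "bij_betw (\<lambda>e. ?cl {e}) E (join_irreducibles ?L)"
    using simple unfolding simple_implications_def hull_def F_def by simp
  have irr: "?cl {e} \<in> F" "\<not> (\<forall>T\<in>F. ?cl {e} \<subseteq> T)"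
    "\<And>a b. a \<in> F \<Longrightarrow> b \<in> F \<Longrightarrow> is_join ?L (?cl {e}) {a, b} \<Longrightarrow> ?cl {e} = a \<or> ?cl {e} = b"
    if e: "e \<in> E" for e
  proof -
    have "?cl {e} \<in> join_irreducibles ?L" using bij_betwE[OF bij] e by blast
    then show "?cl {e} \<in> F" "\<not> (\<forall>T\<in>F. ?cl {e} \<subseteq> T)"
      "\<And>a b. a \<in> F \<Longrightarrow> b \<in> F \<Longrightarrow> is_join ?L (?cl {e}) {a, b} \<Longrightarrow> ?cl {e} = a \<or> ?cl {e} = b"
      unfolding join_irreducibles_def least_inclusion_order by (auto simp: inclusion_order_def)
  qed
  have inj: "e = d" if "e \<in> E" "d \<in> E" "?cl {e} = ?cl {d}" for e d
    using inj_onD[OF bij_betw_imp_inj_on[OF bij] that(3,1,2)] .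
  have empty: "{} \<in> F"
  proof -
    obtain e0 where "e0 \<in> E" using E(3) by blast
    then have ne: "F \<noteq> {}" using irr(1) by blast
    have I: "\<Inter>F \<in> F" using closed_sets_Inter[of F E \<Sigma>] ne finF unfolding F_def by blast
    \<comment> \<open>An element common to all closed sets would generate the minimum of
      \<open>F\<close>, which is excluded from the irreducibles.\<close>
    have "e \<notin> \<Inter>F" for e
    proof
      assume e: "e \<in> \<Inter>F"
      then have "e \<in> E" using I FE by blast
      moreover have "?cl {e} \<subseteq> T" if "T \<in> F" for T
        by (rule cl_least[OF _ that]) (use e that in blast)
      ultimately show False using irr(2)[of e] by simp
    qed
    then have "\<Inter>F = {}" by blast
    then show ?thesis using I by simp
  qed
  have lower: "?cl {e} - {e} \<in> F" if e: "e \<in> E" for e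
  proof -
    let ?L' = "?cl {e} - {e}"
    have c: "?cl {e} \<in> F" "e \<in> ?cl {e}" using irr(1)[OF e] cl_ext by auto
    \<comment> \<open>A maximal closed \<open>S\<close> inside \<open>?L'\<close> absorbs each
      \<open>d \<in> ?L'\<close>: by injectivity \<open>?cl {d}\<close> differs from
      \<open>?cl {e}\<close>, so by irreducibility the join of \<open>S\<close> and
      \<open>?cl {d}\<close> is not \<open>?cl {e}\<close>. It therefore misses \<open>e\<close> and
      stays inside \<open>?L'\<close>.\<close>
    obtain S where S: "S \<in> F" "S \<subseteq> ?L'"
      and mx: "\<And>T. T \<in> F \<Longrightarrow> T \<subseteq> ?L' \<Longrightarrow> S \<subseteq> T \<Longrightarrow> S = T"
    proof -
      have "finite {S \<in> F. S \<subseteq> ?L'}" "{S \<in> F. S \<subseteq> ?L'} \<noteq> {}" using finF empty by auto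
      from finite_has_maximal[OF this] obtain S where S: "S \<in> {S \<in> F. S \<subseteq> ?L'}"
        and m: "\<forall>T\<in>{S \<in> F. S \<subseteq> ?L'}. S \<subseteq> T \<longrightarrow> S = T" by (rule bexE)
      have "S = T" if "T \<in> F" "T \<subseteq> ?L'" "S \<subseteq> T" for T using bspec[OF m, of T] that by blast
      with S show thesis using that[of S] by blast
    qed
    have "?L' \<subseteq> S"
    proof
      fix d assume d: "d \<in> ?L'"
      have Sd: "S \<union> ?cl {d} \<subseteq> ?cl {e}" using S(2) cl_least[OF _ c(1), of "{d}"] d by auto
      have dF: "?cl {d} \<in> F" using clF[OF _ c(1), of "{d}"] d by simp
      have ned: "?cl {e} \<noteq> ?cl {d}" using inj[OF e, of d] d FE[OF c(1)] by auto
      have neS: "?cl {e} \<noteq> S" using S(2) c(2) by blast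
      note T = clF[OF Sd c(1)] cl_least[OF Sd c(1)]
      have "\<not> is_join ?L (?cl {e}) {S, ?cl {d}}" using irr(3)[OF e S(1) dF] ned neS by blast
      moreover have "\<exists>W\<in>F. \<Union>{S, ?cl {d}} \<subseteq> W" using Sd c(1) by (intro bexI[of _ "?cl {e}"]) simp_all
      moreover have "{S, ?cl {d}} \<subseteq> F" using S(1) dF by simp
      ultimately have "?cl {e} \<noteq> ?cl (\<Union>{S, ?cl {d}})" using join by metis
      then have "?cl {e} \<noteq> ?cl (S \<union> ?cl {d})" by simp
      then have "e \<notin> ?cl (S \<union> ?cl {d})" using cl_least[OF _ T(1), of "{e}"] T(2) by blast
      then have "?cl (S \<union> ?cl {d}) \<subseteq> ?L'" using T(2) by blast
      from mx[OF T(1) this] have "S = ?cl (S \<union> ?cl {d})" using cl_ext[of "S \<union> ?cl {d}"] by blast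
      then show "d \<in> S" using cl_ext[of "S \<union> ?cl {d}"] cl_ext[of "{d}"] by blast
    qed
    then have "S = ?L'" using S(2) by (intro equalityI)
    then show ?thesis using S(1) by simp
  qed
  have mod': "modular_lattice (principal_ideal ?L a)" if "a \<in> F" for a
    using mod that unfolding modular_semilattice_def F_def by (simp add: inclusion_order_def)
  show ?thesis unfolding F_def[symmetric]
  proof (unfold_locales, fact E(1), fact E(2))
    show "?cl (X \<union> (Y \<inter> Z)) = ?cl (X \<union> Y) \<inter> Z"
      if "W \<in> F" "X \<in> F" "Y \<in> F" "Z \<in> F" "X \<subseteq> Z" "Y \<subseteq> W" "Z \<subseteq> W" for W X Y Z
    proof -
      let ?P = "principal_ideal ?L W"
      note YZ = Int[OF that(3,4)]
      have XY: "X \<union> Y \<subseteq> W" and XYZ: "X \<union> (Y \<inter> Z) \<subseteq> W" using that by auto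
      have 1: "X \<squnion>\<^bsub>?P\<^esub> (Y \<inter> Z) = ?cl (X \<union> (Y \<inter> Z))"
        by (rule join_principal_ideal[OF clF[OF XYZ that(1)] cl_least[OF XYZ that(1)] cl_ext _ that(2) YZ])
          (rule cl_least)
      have 2: "X \<squnion>\<^bsub>?P\<^esub> Y = ?cl (X \<union> Y)"
        by (rule join_principal_ideal[OF clF[OF XY that(1)] cl_least[OF XY that(1)] cl_ext _ that(2,3)])
          (rule cl_least)
      have 3: "Y \<sqinter>\<^bsub>?P\<^esub> Z = Y \<inter> Z"
        by (rule meet_principal_ideal[OF that(3,4) YZ that(6,7)])
      have 4: "?cl (X \<union> Y) \<sqinter>\<^bsub>?P\<^esub> Z = ?cl (X \<union> Y) \<inter> Z"
        by (rule meet_principal_ideal[OF clF[OF XY that(1)] that(4) Int[OF clF[OF XY that(1)] that(4)]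
              cl_least[OF XY that(1)] that(7)])
      have "X \<in> carrier ?P" "Y \<in> carrier ?P" "Z \<in> carrier ?P" "X \<sqsubseteq>\<^bsub>?P\<^esub> Z"
        using that unfolding principal_ideal_def inclusion_order_def by auto
      then have "X \<squnion>\<^bsub>?P\<^esub> (Y \<sqinter>\<^bsub>?P\<^esub> Z) = (X \<squnion>\<^bsub>?P\<^esub> Y) \<sqinter>\<^bsub>?P\<^esub> Z"
        using mod'[OF that(1)] unfolding modular_lattice_def by blast
      then show ?thesis unfolding 1 2 3 4 .
    qed
    show "\<exists>W\<in>F. X \<union> Y \<union> Z \<subseteq> W"
      if "X \<in> F" "Y \<in> F" "Z \<in> F" "\<exists>W\<in>F. X \<union> Y \<subseteq> W" "\<exists>W\<in>F. Y \<union> Z \<subseteq> W" "\<exists>W\<in>F. X \<union> Z \<subseteq> W" for X Y Z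
    proof -
      have "\<exists>s. is_join ?L s {X, Y}" "\<exists>s. is_join ?L s {Y, Z}" "\<exists>s. is_join ?L s {X, Z}"
        using join[of "{X, Y}"] join[of "{Y, Z}"] join[of "{X, Z}"] that by simp_all
      moreover have "carrier ?L = F" unfolding inclusion_order_def by simp
      ultimately have "\<exists>s. is_join ?L s {X, Y, Z}"
        using mod that(1-3) unfolding modular_semilattice_def F_def[symmetric] by metis
      then show ?thesis using join[of "{X, Y, Z}"] that(1-3) by (simp add: Un_assoc)
    qed
  qed (fact FE empty Int irr(1) lower)+
qed


section \<open>Computing the base with lists\<close>

text \<open>\<open>ks\<close> holds the elements kept so far. Redundancy of \<open>x\<close> is
  judged against all other entries still present, both kept and pending.\<close>

fun greedy_aux :: "('a list \<Rightarrow> 'a \<Rightarrow> bool) \<Rightarrow> 'a list \<Rightarrow> 'a list \<Rightarrow> 'a list" where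
  "greedy_aux red ks [] = ks"
| "greedy_aux red ks (x # xs) = greedy_aux red (if red (ks @ xs) x then ks else x # ks) xs"

definition greedy :: "('a list \<Rightarrow> 'a \<Rightarrow> bool) \<Rightarrow> 'a list \<Rightarrow> 'a list" where
  "greedy red xs = greedy_aux red [] xs"

lemma greedy_aux_invariant:
  assumes step: "\<And>S x. red S x \<Longrightarrow> I (insert x (set S)) \<Longrightarrow> I (set S)"
  shows "I (set ks \<union> set xs) \<Longrightarrow> I (set (greedy_aux red ks xs))"
proof (induction xs arbitrary: ks)
  case (Cons x xs)
  show ?case
  proof (cases "red (ks @ xs) x")
    case True
    have "I (set ks \<union> set xs)" using step[OF True] Cons.prems by simp
    then show ?thesis using Cons.IH True by simp
  next
    case False
    have "I (set (x # ks) \<union> set xs)" using Cons.prems by simp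
    then show ?thesis using Cons.IH[of "x # ks"] False by simp
  qed
qed simp

lemma greedy_invariant:
  assumes "\<And>S x. red S x \<Longrightarrow> I (insert x (set S)) \<Longrightarrow> I (set S)" "I (set xs)"
  shows "I (set (greedy red xs))"
  unfolding greedy_def using greedy_aux_invariant[of red I "[]" xs] assms by simp

lemma set_greedy: "set (greedy red xs) \<subseteq> set xs"
  by (rule greedy_invariant) auto

text \<open>An element is kept when it is irredundant over the entries present at that moment. Later
  removals only shrink this set, and \<open>red\<close> is monotone. The decomposition is by
  occurrences, so a second copy of \<open>x\<close> counts among the others.\<close>

lemma greedy_aux_irredundant:
  assumes mono: "\<And>S S' x. set S \<subseteq> set S' \<Longrightarrow> red S x \<Longrightarrow> red S' x"
  shows "(\<And>ys x zs. ks = ys @ x # zs \<Longrightarrow> \<not> red (ys @ zs @ xs) x) \<Longrightarrow>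
    greedy_aux red ks xs = ys @ x # zs \<Longrightarrow> \<not> red (ys @ zs) x"
proof (induction xs arbitrary: ks)
  case Nil
  then show ?case by simp
next
  case (Cons y xs)
  show ?case
  proof (cases "red (ks @ xs) y")
    case True
    show ?thesis
    proof (rule Cons.IH[of ks])
      fix ys' x' zs' assume ks: "ks = ys' @ x' # zs'"
      have s: "set (ys' @ zs' @ xs) \<subseteq> set (ys' @ zs' @ y # xs)" by auto
      show "\<not> red (ys' @ zs' @ xs) x'" using mono[OF s] Cons.prems(1)[OF ks] by blast
    qed (use Cons.prems(2) True in simp)
  next
    case False
    show ?thesis
    proof (rule Cons.IH[of "y # ks"])
      fix ys' x' zs' assume ks: "y # ks = ys' @ x' # zs'"
      show "\<not> red (ys' @ zs' @ xs) x'"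
      proof (cases ys')
        case Nil
        then show ?thesis using ks False by simp
      next
        case (Cons u us)
        then have ks': "ks = us @ x' # zs'" "u = y" using ks by auto
        have s: "set (ys' @ zs' @ xs) \<subseteq> set (us @ zs' @ y # xs)" using Cons ks' by auto
        show ?thesis using mono[OF s] Cons.prems(1)[OF ks'(1)] by blast
      qed
    qed (use Cons.prems(2) False in simp)
  qed
qed

lemma greedy_irredundant:
  assumes "\<And>S S' x. set S \<subseteq> set S' \<Longrightarrow> red S x \<Longrightarrow> red S' x" "greedy red xs = ys @ x # zs"
  shows "\<not> red (ys @ zs) x"
  using greedy_aux_irredundant[of red "[]" xs ys x zs] assms unfolding greedy_def by simp

lemma greedy_aux_cong:
  assumes "\<And>S x. set S \<subseteq> A \<Longrightarrow> x \<in> A \<Longrightarrow> red S x = red' S x"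
  shows "set ks \<subseteq> A \<Longrightarrow> set xs \<subseteq> A \<Longrightarrow> greedy_aux red ks xs = greedy_aux red' ks xs"
  by (induction xs arbitrary: ks) (auto simp: assms)

lemma greedy_cong:
  assumes "\<And>S x. set S \<subseteq> set xs \<Longrightarrow> x \<in> set xs \<Longrightarrow> red S x = red' S x"
  shows "greedy red xs = greedy red' xs"
  unfolding greedy_def by (rule greedy_aux_cong[OF assms]) auto

text \<open>Filtering \<open>es\<close> instead of appending right-hand sides keeps every iterate at
  most as large as \<open>es\<close>. The time bound relies on this.\<close>

definition closure_step :: "'a list \<Rightarrow> ('a list \<times> 'a list) list \<Rightarrow> 'a list \<Rightarrow> 'a list" where
  "closure_step es ps A =
     filter (\<lambda>e. e \<in> set A \<or> (\<exists>p\<in>set ps. set (fst p) \<subseteq> set A \<and> e \<in> set (snd p))) es"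

text \<open>The outer \<open>es\<close> is only a counter: \<open>length es\<close> rounds reach the
  fixed point. Rules with empty right-hand side add nothing here; conflicts are tested on the
  result.\<close>

definition closure_list :: "'a list \<Rightarrow> ('a list \<times> 'a list) list \<Rightarrow> 'a list \<Rightarrow> 'a list" where
  "closure_list es ps X = fold (\<lambda>_. closure_step es ps) es (filter (\<lambda>e. e \<in> set X) es)"

lemma fold_const_funpow: "fold (\<lambda>_. f) xs a = (f ^^ length xs) a"
  by (induction xs arbitrary: a) (auto simp: funpow_swap1)

text \<open>Until a fixed point is reached, every round adds an element of \<open>E\<close>.\<close>

lemma inflationary_fixpoint:
  fixes T :: "'a set \<Rightarrow> 'a set"
  assumes E: "finite E" and T: "\<And>S. S \<subseteq> E \<Longrightarrow> S \<subseteq> T S \<and> T S \<subseteq> E" and S: "S \<subseteq> E" and n: "card E \<le> n"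
  shows "T ((T ^^ n) S) = (T ^^ n) S"
proof -
  have sub: "(T ^^ i) S \<subseteq> E" for i by (induction i) (use S T in auto)
  have "T ((T ^^ i) S) = (T ^^ i) S \<or> i < card ((T ^^ Suc i) S)" for i
  proof (induction i)
    case 0
    show ?case
    proof (cases "T S = S")
      case False
      then have "S \<subset> T S" using T[OF S] by blast
      then have "card S < card (T S)"
        using psubset_card_mono[of "T S" S] finite_subset[OF _ E] T[OF S] by blast
      then show ?thesis by simp
    qed simp
  next
    case (Suc i)
    let ?U = "(T ^^ Suc i) S"
    show ?case
    proof (cases "T ?U = ?U")
      case False
      have "T ((T ^^ i) S) \<noteq> (T ^^ i) S"
      proof
        assume "T ((T ^^ i) S) = (T ^^ i) S"
        then have "?U = (T ^^ i) S" by simp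
        then show False using False \<open>T ((T ^^ i) S) = (T ^^ i) S\<close> by simp
      qed
      then have "i < card ?U" using Suc by blast
      moreover have "?U \<subset> T ?U" using T[OF sub, of "Suc i"] False by blast
      then have "card ?U < card (T ?U)"
        using psubset_card_mono[of "T ?U" ?U] finite_subset[OF _ E] T[OF sub, of "Suc i"] by blast
      ultimately show ?thesis by simp
    qed simp
  qed
  from this[of n] show ?thesis
  proof
    assume "n < card ((T ^^ Suc n) S)"
    also have "\<dots> \<le> card E" by (rule card_mono[OF E sub])
    finally show ?thesis using n by simp
  qed
qed

context
  fixes es :: "'a list" and ps :: "('a list \<times> 'a list) list"
begin

private definition T :: "'a set \<Rightarrow> 'a set" where
  "T S = {e \<in> set es. e \<in> S \<or> (\<exists>p\<in>set ps. set (fst p) \<subseteq> S \<and> e \<in> set (snd p))}"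

private lemma set_closure_list: "set (closure_list es ps X) = (T ^^ length es) (set X \<inter> set es)"
proof -
  have "set ((closure_step es ps ^^ n) A) = (T ^^ n) (set A)" for n A
    by (induction n) (auto simp: T_def closure_step_def)
  then show ?thesis unfolding closure_list_def fold_const_funpow by (simp add: Int_def conj_commute)
qed

private lemma T_closure_list: "T (set (closure_list es ps X)) = set (closure_list es ps X)"
  unfolding set_closure_list
  by (rule inflationary_fixpoint[of "set es"]) (auto simp: T_def card_length)

lemma closure_list_sub: "set (closure_list es ps X) \<subseteq> set es"
  using T_closure_list[of X] unfolding T_def by blast

lemma closure_list_ext:
  assumes "set X \<subseteq> set es"
  shows "set X \<subseteq> set (closure_list es ps X)"
proof -
  have "set X \<subseteq> (T ^^ n) (set X \<inter> set es)" for n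
    by (induction n) (use assms in \<open>auto simp: T_def\<close>)
  then show ?thesis unfolding set_closure_list by blast
qed

lemma closure_list_closed:
  "(as, bs) \<in> set ps \<Longrightarrow> set as \<subseteq> set (closure_list es ps X) \<Longrightarrow> set bs \<subseteq> set es \<Longrightarrow>
    set bs \<subseteq> set (closure_list es ps X)"
  using T_closure_list[of X] unfolding T_def by fastforce

lemma closure_list_least:
  assumes X: "set X \<inter> set es \<subseteq> Z" and Z: "\<And>as bs. (as, bs) \<in> set ps \<Longrightarrow> set as \<subseteq> Z \<Longrightarrow> set bs \<subseteq> Z"
  shows "set (closure_list es ps X) \<subseteq> Z"
proof -
  have "(T ^^ n) (set X \<inter> set es) \<subseteq> Z" for n
  proof (induction n)
    case (Suc n)
    have "T S \<subseteq> Z" if "S \<subseteq> Z" for S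
      unfolding T_def using that Z by force
    then show ?case using Suc by simp
  qed (use X in simp)
  then show ?thesis unfolding set_closure_list by blast
qed

lemma closure_list_mono:
  assumes "set X \<subseteq> set Y"
  shows "set (closure_list es ps X) \<subseteq> set (closure_list es ps Y)"
proof -
  have "mono T" unfolding mono_def T_def by blast
  then have "mono (T ^^ n)" for n by (rule mono_pow)
  then show ?thesis unfolding set_closure_list by (rule monoD) (use assms in blast)
qed

end

section \<open>The algorithm on lists\<close>

definition conflicting :: "('a list \<times> 'a list) list \<Rightarrow> 'a list \<Rightarrow> bool" where
  "conflicting ps A \<longleftrightarrow> (\<exists>p\<in>set ps. snd p = [] \<and> set (fst p) \<subseteq> set A)"

definition lower_list :: "'a list \<Rightarrow> ('a list \<times> 'a list) list \<Rightarrow> 'a \<Rightarrow> 'a list" where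
  "lower_list es ps p = greedy (\<lambda>S d. d \<in> set (closure_list es ps S))
     (filter (\<lambda>e. e \<noteq> p) (closure_list es ps [p]))"

definition low_list :: "'a list \<Rightarrow> ('a list \<times> 'a list) list \<Rightarrow> ('a list \<times> 'a list) list" where
  "low_list es ps = filter (\<lambda>r. snd r \<noteq> []) (map (\<lambda>p. ([p], lower_list es ps p)) es)"

definition spans :: "'a list \<Rightarrow> ('a list \<times> 'a list) list \<Rightarrow> 'a \<times> 'a \<Rightarrow> 'a \<Rightarrow> 'a \<Rightarrow> bool" where
  "spans es ps pq r s \<longleftrightarrow> fst pq \<in> set (closure_list es ps [r, s]) \<and> snd pq \<in> set (closure_list es ps [r, s])"

definition rim_list :: "'a list \<Rightarrow> ('a list \<times> 'a list) list \<Rightarrow> 'a \<times> 'a \<Rightarrow> 'a list" where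
  "rim_list es ps pq = filter (\<lambda>r. r \<in> set (closure_list es ps [fst pq, snd pq]) \<and>
     (\<exists>s\<in>set (closure_list es ps [fst pq, snd pq]). spans es ps pq r s)) es"

definition reps_list :: "'a list \<Rightarrow> ('a list \<times> 'a list) list \<Rightarrow> 'a \<times> 'a \<Rightarrow> 'a list" where
  "reps_list es ps pq = greedy (\<lambda>S r. \<exists>s\<in>set S. \<not> spans es ps pq r s) (rim_list es ps pq)"

definition after :: "'a \<Rightarrow> 'a list \<Rightarrow> 'a list" where
  "after x R = tl (dropWhile (\<lambda>y. y \<noteq> x) R)"

text \<open>\<open>line_third\<close> in terms of entries instead of positions, which spares the
  program index arithmetic. For distinct lists with at least three entries the two agree.\<close>

definition third :: "'a list \<Rightarrow> 'a \<Rightarrow> 'a \<Rightarrow> 'a" where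
  "third R x y = (if after y R \<noteq> [] then hd (after y R) else if x = hd R then hd (tl R) else hd R)"

definition lines_list :: "'a list \<Rightarrow> ('a list \<times> 'a list) list" where
  "lines_list R = (if tl (tl R) = [] then [] else
     map (\<lambda>x. ([fst x, snd x], [third R (fst x) (snd x)]))
       (filter (\<lambda>x. snd x \<in> set (after (fst x) R)) (List.product R R)))"

definition incomparable_list :: "'a list \<Rightarrow> ('a list \<times> 'a list) list \<Rightarrow> 'a \<times> 'a \<Rightarrow> bool" where
  "incomparable_list es ps pq \<longleftrightarrow> \<not> conflicting ps (closure_list es ps [fst pq, snd pq]) \<and>
     fst pq \<notin> set (closure_list es ps [snd pq]) \<and> snd pq \<notin> set (closure_list es ps [fst pq])"

definition line_list :: "'a list \<Rightarrow> ('a list \<times> 'a list) list \<Rightarrow> ('a list \<times> 'a list) list" where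
  "line_list es ps = concat (map (\<lambda>pq. lines_list (reps_list es ps pq))
     (filter (incomparable_list es ps) (List.product es es)))"

definition proper_list :: "'a list \<Rightarrow> ('a list \<times> 'a list) list \<Rightarrow> ('a list \<times> 'a list) list" where
  "proper_list es ps = low_list es ps @ line_list es ps"

text \<open>The given rules \<open>ps\<close> decide which pairs are inconsistent; redundancy is
  measured by the new proper rules \<open>rs\<close>, whose closure is \<open>gen\<close>.\<close>

definition conflict_pairs :: "'a list \<Rightarrow> ('a list \<times> 'a list) list \<Rightarrow> ('a list \<times> 'a list) list \<Rightarrow> ('a \<times> 'a) list" where
  "conflict_pairs es ps rs = greedy (\<lambda>S x. \<exists>y\<in>set S.
      fst y \<in> set (closure_list es rs [fst x, snd x]) \<and> snd y \<in> set (closure_list es rs [fst x, snd x]))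
    (filter (\<lambda>x. conflicting ps (closure_list es ps [fst x, snd x])) (List.product es es))"

text \<open>For \<open>es = []\<close> all sets in an admissible \<open>ps\<close> are empty, so its
  size is 0 and the input itself is optimal.\<close>

definition optimum_list :: "'a list \<Rightarrow> ('a list \<times> 'a list) list \<Rightarrow> ('a list \<times> 'a list) list" where
  "optimum_list es ps = (if es = [] then ps else
     proper_list es ps @ map (\<lambda>x. ([fst x, snd x], [])) (conflict_pairs es ps (proper_list es ps)))"

lemma after_nth:
  assumes "distinct R" "i < length R"
  shows "after (R ! i) R = drop (Suc i) R"
proof -
  have "dropWhile (\<lambda>y. y \<noteq> R ! i) R = drop i R"
    using assms
  proof (induction R arbitrary: i)
    case (Cons x R)
    then show ?case by (cases i) auto
  qed simp
  then show ?thesis unfolding after_def by (simp add: drop_Suc tl_drop)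
qed

lemma third_nth:
  assumes "distinct R" "i < j" "j < length R" "3 \<le> length R"
  shows "third R (R ! i) (R ! j) = line_third R i j"
proof -
  have hd: "hd R = R ! 0" "hd (tl R) = R ! 1"
    using assms(4) by (cases R; cases "tl R"; simp)+
  have "0 < length R" "i < length R" using assms(2,3) by auto
  then have "R ! i = R ! 0 \<longleftrightarrow> i = 0" using nth_eq_iff_index_eq[OF assms(1)] by blast
  then show ?thesis
    unfolding third_def line_third_def after_nth[OF assms(1,3)] hd by (simp add: hd_drop_conv_nth)
qed

abbreviation family :: "('a list \<times> 'a list) list \<Rightarrow> 'a implication set" where
  "family ps \<equiv> (\<lambda>(as, bs). (set as, set bs)) ` set ps"

lemma image_Collect_pair:
  "(\<lambda>x. g (fst x) (snd x)) ` {x \<in> A \<times> B. P (fst x) (snd x)} = {g x y | x y. x \<in> A \<and> y \<in> B \<and> P x y}"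
  by force

lemma family_lines_list:
  assumes R: "distinct R"
  shows "family (lines_list R) = lines R"
proof (cases "length R < 3")
  case True
  then have "tl (tl R) = []" by (cases R; cases "tl R") auto
  then show ?thesis using True unfolding lines_list_def lines_def by simp
next
  case False
  then have "length (tl (tl R)) \<noteq> 0" by simp
  then have ne: "tl (tl R) \<noteq> []" "3 \<le> length R" using False by (simp_all del: length_tl)
  have fam: "family (lines_list R) =
    {({x, y}, {third R x y}) | x y. x \<in> set R \<and> y \<in> set R \<and> y \<in> set (after x R)}"
  proof -
    have "family (lines_list R) = (\<lambda>x. ({fst x, snd x}, {third R (fst x) (snd x)})) `
        {x \<in> set R \<times> set R. snd x \<in> set (after (fst x) R)}"
      unfolding lines_list_def using ne(1) by (simp add: image_image)
    also have "\<dots> = {({x, y}, {third R x y}) | x y. x \<in> set R \<and> y \<in> set R \<and> y \<in> set (after x R)}"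
      by (rule image_Collect_pair[where g = "\<lambda>x y. ({x, y}, {third R x y})"
            and P = "\<lambda>x y. y \<in> set (after x R)"])
    finally show ?thesis .
  qed
  have nth: "R ! j \<in> set (after (R ! i) R) \<longleftrightarrow> i < j" if ij: "i < length R" "j < length R" for i j
  proof
    assume "R ! j \<in> set (after (R ! i) R)"
    then obtain k where "k < length R - Suc i" "R ! j = R ! (Suc i + k)"
      unfolding after_nth[OF R ij(1)] by (auto simp: in_set_conv_nth)
    then have "j = Suc i + k" using R ij by (simp add: nth_eq_iff_index_eq)
    then show "i < j" by simp
  next
    assume "i < j"
    then have "drop (Suc i) R ! (j - Suc i) = R ! j" "j - Suc i < length (drop (Suc i) R)"
      using ij by auto
    then show "R ! j \<in> set (after (R ! i) R)"
      unfolding after_nth[OF R ij(1)] by (metis nth_mem)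
  qed
  have lines: "lines R = {({R ! i, R ! j}, {line_third R i j}) | i j. i < j \<and> j < length R}"
    unfolding lines_def using False by simp
  show ?thesis
  proof (intro equalityI subsetI)
    fix \<sigma> assume "\<sigma> \<in> family (lines_list R)"
    then obtain x y where xy: "\<sigma> = ({x, y}, {third R x y})" "x \<in> set R" "y \<in> set R" "y \<in> set (after x R)"
      unfolding fam by blast
    obtain i where i: "i < length R" "x = R ! i" using xy(2) by (auto simp: in_set_conv_nth)
    obtain j where j: "j < length R" "y = R ! j" using xy(3) by (auto simp: in_set_conv_nth)
    have ij: "i < j" using nth[OF i(1) j(1)] xy(4) i j by simp
    then have "\<sigma> = ({R ! i, R ! j}, {line_third R i j})"
      using third_nth[OF R ij j(1) ne(2)] xy(1) i j by simp
    then show "\<sigma> \<in> lines R" unfolding lines using ij j(1) by blast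
  next
    fix \<sigma> assume "\<sigma> \<in> lines R"
    then obtain i j where ij: "i < j" "j < length R" "\<sigma> = ({R ! i, R ! j}, {line_third R i j})"
      unfolding lines by blast
    have i: "i < length R" using ij by simp
    have "\<sigma> = ({R ! i, R ! j}, {third R (R ! i) (R ! j)})"
      using third_nth[OF R ij(1,2) ne(2)] ij(3) by simp
    moreover have "R ! i \<in> set R" "R ! j \<in> set R" using i ij(2) by auto
    moreover have "R ! j \<in> set (after (R ! i) R)" using nth[OF i ij(2)] ij(1) by simp
    ultimately show "\<sigma> \<in> family (lines_list R)" unfolding fam by blast
  qed
qed

section \<open>Correctness of the list algorithm\<close>

locale list_instance = modular_family +
  fixes es :: "'a list" and ps :: "('a list \<times> 'a list) list"
  assumes set_es: "set es = E" and implications: "implications_on E (family ps)"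
    and closed: "closed_sets E (family ps) = F"
begin

lemma rule_sub: "(as, bs) \<in> set ps \<Longrightarrow> set as \<subseteq> E \<and> set bs \<subseteq> E"
  using implications unfolding implications_on_def by fastforce

lemma closure_closed:
  "(as, bs) \<in> set ps \<Longrightarrow> set as \<subseteq> set (closure_list es ps X) \<Longrightarrow> set bs \<subseteq> set (closure_list es ps X)"
  using closure_list_closed[of as bs ps es X] rule_sub[of as bs] set_es by blast

lemma closure_in_F_iff: "set (closure_list es ps X) \<in> F \<longleftrightarrow> \<not> conflicting ps (closure_list es ps X)"
proof -
  let ?C = "set (closure_list es ps X)"
  have "?C \<in> F \<longleftrightarrow> satisfies ?C (family ps)"
    unfolding closed[symmetric] closed_sets_eq using closure_list_sub[of es ps X] set_es by simp
  also have "\<dots> \<longleftrightarrow> \<not> conflicting ps (closure_list es ps X)"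
  proof
    assume s: "satisfies ?C (family ps)"
    show "\<not> conflicting ps (closure_list es ps X)"
    proof
      assume "conflicting ps (closure_list es ps X)"
      then obtain as where as: "(as, []) \<in> set ps" "set as \<subseteq> ?C" unfolding conflicting_def by auto
      then have "(set as, {}) \<in> family ps" by force
      from satisfiesD[OF s this as(2)] show False by simp
    qed
  next
    assume n: "\<not> conflicting ps (closure_list es ps X)"
    show "satisfies ?C (family ps)"
    proof (rule satisfiesI)
      fix A B assume AB: "(A, B) \<in> family ps" "A \<subseteq> ?C"
      then obtain as bs where p: "(as, bs) \<in> set ps" "A = set as" "B = set bs" by auto
      have "bs \<noteq> []" using n p(1,2) AB(2) unfolding conflicting_def by force
      then show "B \<noteq> {} \<and> B \<subseteq> ?C" using closure_closed[OF p(1)] AB(2) p by simp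
    qed
  qed
  finally show ?thesis .
qed

lemma closure_sub_closed:
  assumes W: "W \<in> F" and X: "set X \<subseteq> W"
  shows "set (closure_list es ps X) \<subseteq> W"
proof (rule closure_list_least)
  fix as bs assume p: "(as, bs) \<in> set ps" "set as \<subseteq> W"
  have "(set as, set bs) \<in> family ps" using p(1) by force
  from satisfiesD[OF satisfies_if_closed[OF closed W] this p(2)] show "set bs \<subseteq> W" by simp
qed (use X in blast)

text \<open>If \<open>cl (set X)\<close> is closed, chaining never leaves it, and no conflict rule
  applies inside it. Conversely, a chained set without conflict is a closed set above
  \<open>X\<close>.\<close>

lemma closure_consistent_iff:
  assumes X: "set X \<subseteq> E"
  shows "conflicting ps (closure_list es ps X) \<longleftrightarrow> cl (set X) \<notin> F"
proof
  assume c: "conflicting ps (closure_list es ps X)"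
  show "cl (set X) \<notin> F"
  proof
    assume F: "cl (set X) \<in> F"
    have s: "set (closure_list es ps X) \<subseteq> cl (set X)" by (rule closure_sub_closed[OF F cl_ext])
    obtain as where as: "(as, []) \<in> set ps" "set as \<subseteq> cl (set X)"
      using c s unfolding conflicting_def by force
    then have "(set as, {}) \<in> family ps" by force
    from satisfiesD[OF satisfies_if_closed[OF closed F] this as(2)] show False by simp
  qed
next
  assume n: "cl (set X) \<notin> F"
  show "conflicting ps (closure_list es ps X)"
  proof (rule ccontr)
    assume "\<not> conflicting ps (closure_list es ps X)"
    then have "set (closure_list es ps X) \<in> F" using closure_in_F_iff by simp
    then show False using n cl_F_sub closure_list_ext[of X es ps] X set_es by blast
  qed
qed

lemma set_closure_eq:
  assumes "cl (set X) \<in> F"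
  shows "set (closure_list es ps X) = cl (set X)"
proof
  have X: "set X \<subseteq> E" using F_sub[OF assms] cl_ext[of "set X"] by blast
  show "set (closure_list es ps X) \<subseteq> cl (set X)" by (rule closure_sub_closed[OF assms cl_ext])
  have "set (closure_list es ps X) \<in> F"
    using closure_in_F_iff closure_consistent_iff[OF X] assms by simp
  then show "cl (set X) \<subseteq> set (closure_list es ps X)"
    using cl_least[OF closure_list_ext] X set_es by simp
qed

lemma set_closure_single: "p \<in> E \<Longrightarrow> set (closure_list es ps [p]) = cl {p}"
  using set_closure_eq[of "[p]"] single_F by simp

definition Dset :: "'a \<Rightarrow> 'a set" where "Dset p = set (lower_list es ps p)"

lemma Dset:
  assumes p: "p \<in> E"
  shows "cl (Dset p) = low p" "d \<in> Dset p \<Longrightarrow> cl (Dset p - {d}) \<noteq> low p"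
proof -
  let ?red = "\<lambda>S d. d \<in> set (closure_list es ps S)"
  let ?K = "filter (\<lambda>e. e \<noteq> p) (closure_list es ps [p])"
  have K: "set ?K = low p" unfolding low_def using set_closure_single[OF p] by auto
  \<comment> \<open>All subsets of \<open>low p\<close> are consistent, so here chaining computes
    \<open>cl\<close>.\<close>
  have closure: "set (closure_list es ps S) = cl (set S)" if "set S \<subseteq> low p" for S
    by (rule set_closure_eq[OF cl_F_sub[OF that low_F[OF p]]])
  have "Dset p \<subseteq> low p \<and> cl (Dset p) = low p"
    unfolding Dset_def lower_list_def
  proof (rule greedy_invariant[of ?red "\<lambda>A. A \<subseteq> low p \<and> cl A = low p"])
    fix S x assume red: "?red S x" and I: "insert x (set S) \<subseteq> low p \<and> cl (insert x (set S)) = low p"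
    then have "x \<in> cl (set S)" using closure[of S] by simp
    then show "set S \<subseteq> low p \<and> cl (set S) = low p" using I hull_redundant[of x _ "set S"] by simp
  next
    show "set ?K \<subseteq> low p \<and> cl (set ?K) = low p" unfolding K using cl_id[OF low_F[OF p]] by simp
  qed
  then have sub: "Dset p \<subseteq> low p" and gen: "cl (Dset p) = low p" by auto
  show "cl (Dset p) = low p" by (rule gen)
  assume d: "d \<in> Dset p"
  then obtain ys zs where D: "lower_list es ps p = ys @ d # zs"
    unfolding Dset_def by (metis in_set_conv_decomp)
  have "\<not> ?red (ys @ zs) d"
  proof (rule greedy_irredundant[of ?red ?K])
    show "?red S' x" if "set S \<subseteq> set S'" "?red S x" for S S' x
      using closure_list_mono[OF that(1)] that(2) by blast
    show "greedy ?red ?K = ys @ d # zs" using D unfolding lower_list_def .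
  qed
  moreover have s: "set (ys @ zs) \<subseteq> Dset p" unfolding Dset_def D by auto
  then have "set (ys @ zs) \<subseteq> low p" using sub by blast
  ultimately have "d \<notin> cl (set (ys @ zs))" using closure by blast
  moreover have "Dset p - {d} \<subseteq> set (ys @ zs)" unfolding Dset_def D by auto
  ultimately have "d \<notin> cl (Dset p - {d})" using cl_mono[of "Dset p - {d}" "set (ys @ zs)"] by blast
  then show "cl (Dset p - {d}) \<noteq> low p" using d sub by blast
qed

definition reps :: "'a set \<Rightarrow> 'a list" where
  "reps C = greedy (\<lambda>S r. \<exists>s\<in>set S. cl {r, s} \<noteq> C) (filter (\<lambda>r. r \<in> rim C) es)"

lemma spans_iff:
  assumes inc: "incomparable p q" and rs: "r \<in> cl {p, q}" "s \<in> cl {p, q}"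
  shows "spans es ps (p, q) r s \<longleftrightarrow> cl {r, s} = cl {p, q}"
proof -
  have s: "{r, s} \<subseteq> cl {p, q}" using rs by simp
  note f = sub_pair[OF inc s]
  have "spans es ps (p, q) r s \<longleftrightarrow> {p, q} \<subseteq> cl {r, s}"
    unfolding spans_def using set_closure_eq[of "[r, s]"] f(3) by simp
  also have "\<dots> \<longleftrightarrow> cl {p, q} \<subseteq> cl {r, s}" using cl_subset_iff[OF f(3)] by simp
  finally show ?thesis using f(2) by blast
qed

lemma rim_sub_E:
  assumes "incomparable p q"
  shows "rim (cl {p, q}) \<subseteq> E" "rim (cl {p, q}) \<subseteq> cl {p, q}"
  using F_sub[OF pair_F[OF assms]] unfolding rim_def by auto

text \<open>The representatives depend only on \<open>cl {p, q}\<close> and on the order of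
  \<open>es\<close>. Hence all pairs with the same closure produce the same rules, which collapse in
  the family.\<close>

lemma reps_list_eq:
  assumes inc: "incomparable p q"
  shows "reps_list es ps (p, q) = reps (cl {p, q})"
proof -
  let ?C = "cl {p, q}"
  have C: "set (closure_list es ps [p, q]) = ?C"
    using set_closure_eq[of "[p, q]"] pair_F[OF inc] by simp
  have "r \<in> ?C \<and> (\<exists>s\<in>?C. spans es ps (p, q) r s) \<longleftrightarrow> r \<in> rim ?C" for r
    using spans_iff[OF inc] unfolding rim_def by blast
  then have rim: "rim_list es ps (p, q) = filter (\<lambda>r. r \<in> rim ?C) es"
    unfolding rim_list_def fst_conv snd_conv C by simp
  show ?thesis
    unfolding reps_list_def reps_def rim
  proof (rule greedy_cong)
    fix S x assume S: "set S \<subseteq> set (filter (\<lambda>r. r \<in> rim ?C) es)" "x \<in> set (filter (\<lambda>r. r \<in> rim ?C) es)"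
    have "x \<in> ?C" "set S \<subseteq> ?C" using S rim_sub_E[OF inc] by auto
    then show "(\<exists>s\<in>set S. \<not> spans es ps (p, q) x s) = (\<exists>s\<in>set S. cl {x, s} \<noteq> ?C)"
      using spans_iff[OF inc] by blast
  qed
qed

text \<open>For elements of the rim, inequality with \<open>cl {p, q}\<close> means sharing a
  branch.\<close>

lemma cl_pair_neq_trans:
  assumes inc: "incomparable p q"
    and "r \<in> rim (cl {p, q})" "x \<in> rim (cl {p, q})" "s \<in> rim (cl {p, q})"
    and "cl {r, x} \<noteq> cl {p, q}" "cl {x, s} \<noteq> cl {p, q}"
  shows "cl {r, s} \<noteq> cl {p, q}"
  using assms cl_pair_eq_iff[OF inc, of r x] cl_pair_eq_iff[OF inc, of x s] cl_pair_eq_iff[OF inc, of r s]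
  unfolding rim_eq[OF inc] by simp

lemma reps:
  assumes inc: "incomparable p q"
  defines "C \<equiv> cl {p, q}"
  shows "distinct (reps C)" "set (reps C) \<subseteq> rim C"
    "r \<in> set (reps C) \<Longrightarrow> s \<in> set (reps C) \<Longrightarrow> r \<noteq> s \<Longrightarrow> cl {r, s} = C"
    "r \<in> rim C \<Longrightarrow> \<exists>s\<in>set (reps C). cl {r, s} \<noteq> C"
proof -
  let ?red = "\<lambda>S r. \<exists>s\<in>set S. cl {r, s} \<noteq> C"
  let ?K = "filter (\<lambda>r. r \<in> rim C) es"
  have K: "set ?K = rim C" using rim_sub_E[OF inc] set_es unfolding C_def by auto
  have single: "cl {r, r} \<noteq> C" if "r \<in> rim C" for r
    using single_neq_pair[OF inc, of r] that rim_sub_E(2)[OF inc] unfolding C_def by auto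
  show sub: "set (reps C) \<subseteq> rim C" unfolding reps_def using set_greedy[of ?red ?K] K by simp
  have irr: "\<not> ?red (ys @ zs) x" if "reps C = ys @ x # zs" for ys x zs
    by (rule greedy_irredundant[of ?red ?K]) (use that in \<open>auto simp: reps_def\<close>)
  show "distinct (reps C)"
  proof (rule ccontr)
    assume "\<not> distinct (reps C)"
    then obtain xs ys zs y where d: "reps C = xs @ [y] @ ys @ [y] @ zs"
      using not_distinct_decomp by blast
    then have "reps C = xs @ y # (ys @ y # zs)" by simp
    \<comment> \<open>One copy of a repeated entry is redundant because of the other one, as
      \<open>cl {y, y}\<close> is never \<open>C\<close>. This also removes repetitions coming from
      \<open>es\<close>.\<close>
    from irr[OF this] have "cl {y, y} = C" by simp
    moreover have "y \<in> rim C" using sub d by auto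
    ultimately show False using single by blast
  qed
  show "cl {r, s} = C" if rs: "r \<in> set (reps C)" "s \<in> set (reps C)" "r \<noteq> s"
  proof -
    obtain ys zs where d: "reps C = ys @ r # zs" using rs(1) by (metis in_set_conv_decomp)
    then have "s \<in> set (ys @ zs)" using rs(2,3) by auto
    then show ?thesis using irr[OF d] by blast
  qed
  have "set (reps C) \<subseteq> rim C \<and> (\<forall>r\<in>rim C. \<exists>s\<in>set (reps C). cl {r, s} \<noteq> C)"
    unfolding reps_def
  proof (rule greedy_invariant[of ?red "\<lambda>A. A \<subseteq> rim C \<and> (\<forall>r\<in>rim C. \<exists>s\<in>A. cl {r, s} \<noteq> C)"])
    fix S x
    assume red: "?red S x" and I: "insert x (set S) \<subseteq> rim C \<and> (\<forall>r\<in>rim C. \<exists>s\<in>insert x (set S). cl {r, s} \<noteq> C)"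
    obtain s where s: "s \<in> set S" "cl {x, s} \<noteq> C" using red by blast
    have "\<exists>s\<in>set S. cl {r, s} \<noteq> C" if r: "r \<in> rim C" for r
    proof -
      obtain s' where s': "s' \<in> insert x (set S)" "cl {r, s'} \<noteq> C" using I r by blast
      show ?thesis
      proof (cases "s' = x")
        case True
        \<comment> \<open>Elements represented by the removed \<open>x\<close> are passed on to
          \<open>s\<close>, which lies in the branch of \<open>x\<close>.\<close>
        have "cl {r, s} \<noteq> C"
          using cl_pair_neq_trans[OF inc, of r x s] r I s s'(2) True unfolding C_def by auto
        then show ?thesis using s(1) by blast
      next
        case False
        then show ?thesis using s' by blast
      qed
    qed
    then show "set S \<subseteq> rim C \<and> (\<forall>r\<in>rim C. \<exists>s\<in>set S. cl {r, s} \<noteq> C)" using I by blast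
  next
    show "set ?K \<subseteq> rim C \<and> (\<forall>r\<in>rim C. \<exists>s\<in>set ?K. cl {r, s} \<noteq> C)"
      unfolding K using single by blast
  qed
  then show "r \<in> rim C \<Longrightarrow> \<exists>s\<in>set (reps C). cl {r, s} \<noteq> C" by blast
qed

definition Qset :: "('a \<times> 'a) set" where
  "Qset = set (conflict_pairs es ps (proper_list es ps))"

abbreviation inconsistent_pairs :: "('a \<times> 'a) list" where
  "inconsistent_pairs \<equiv> filter (\<lambda>x. conflicting ps (closure_list es ps [fst x, snd x])) (List.product es es)"

lemma set_inconsistent_pairs:
  "set inconsistent_pairs = {(p, q). p \<in> E \<and> q \<in> E \<and> cl {p, q} \<notin> F}"
  using closure_consistent_iff[of "[p, q]" for p q] set_es by auto

lemma Qset_sub: "Qset \<subseteq> set inconsistent_pairs"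
  unfolding Qset_def conflict_pairs_def by (rule set_greedy)

sublocale base_data E F Dset reps Qset
proof (unfold_locales)
  show "\<And>p. p \<in> E \<Longrightarrow> cl (Dset p) = low p" by (rule Dset(1))
  show "\<And>p d. p \<in> E \<Longrightarrow> d \<in> Dset p \<Longrightarrow> cl (Dset p - {d}) \<noteq> low p" by (rule Dset(2))
  fix C assume "C \<in> line_tops"
  then obtain p q where inc: "incomparable p q" and C: "C = cl {p, q}"
    unfolding line_tops_def by blast
  show "distinct (reps C)" "set (reps C) \<subseteq> rim C" unfolding C by (rule reps[OF inc])+
  show "cl {r, s} = C" if "r \<in> set (reps C)" "s \<in> set (reps C)" "r \<noteq> s" for r s
    using that unfolding C by (rule reps(3)[OF inc])
  show "\<exists>s\<in>set (reps C). cl {r, s} \<noteq> C" if "r \<in> rim C" for r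
    using that unfolding C by (rule reps(4)[OF inc])
next
  show "r \<in> E \<and> s \<in> E \<and> cl {r, s} \<notin> F" if "(r, s) \<in> Qset" for r s
    using that Qset_sub unfolding set_inconsistent_pairs by blast
qed

lemma family_low_list: "family (low_list es ps) = low_rules"
proof -
  have "set (low_list es ps) = (\<lambda>p. ([p], lower_list es ps p)) ` {p \<in> E. lower_list es ps p \<noteq> []}"
    unfolding low_list_def using set_es by auto
  then have "family (low_list es ps) = (\<lambda>p. ({p}, Dset p)) ` {p \<in> E. Dset p \<noteq> {}}"
    unfolding Dset_def by (simp add: image_image)
  also have "\<dots> = low_rules" unfolding low_rules_def by blast
  finally show ?thesis .
qed

lemma incomparable_list_iff:
  assumes "p \<in> E" "q \<in> E"
  shows "incomparable_list es ps (p, q) \<longleftrightarrow> incomparable p q"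
  using assms closure_consistent_iff[of "[p, q]"] set_closure_single consistent_iff
  unfolding incomparable_list_def incomparable_def by simp

lemma family_line_list: "family (line_list es ps) = line_rules"
proof -
  have "set (filter (incomparable_list es ps) (List.product es es)) = {(p, q). incomparable p q}"
    using incomparable_list_iff set_es unfolding incomparable_def by auto
  then have "family (line_list es ps) = (\<Union>pq\<in>{(p, q). incomparable p q}. family (lines_list (reps_list es ps pq)))"
    unfolding line_list_def by (simp add: image_UN)
  also have "\<dots> = (\<Union>pq\<in>{(p, q). incomparable p q}. lines (reps (cl {fst pq, snd pq})))"
  proof (rule SUP_cong[OF refl])
    fix pq assume "pq \<in> {(p, q). incomparable p q}"
    then obtain p q where "pq = (p, q)" "incomparable p q" by blast
    then show "family (lines_list (reps_list es ps pq)) = lines (reps (cl {fst pq, snd pq}))"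
      using reps_list_eq family_lines_list[OF reps(1)] by simp
  qed
  also have "\<dots> = line_rules" unfolding line_rules_def line_tops_def by force
  finally show ?thesis .
qed

lemma family_proper_list: "family (proper_list es ps) = low_rules \<union> line_rules"
  unfolding proper_list_def using family_low_list family_line_list by (simp add: image_Un)

text \<open>No proper rule has an empty right-hand side, so the chained set satisfies all of them
  and no conflict test is involved.\<close>

lemma set_closure_proper:
  assumes A: "set A \<subseteq> E"
  shows "set (closure_list es (proper_list es ps) A) = gen (set A)"
proof
  let ?C = "set (closure_list es (proper_list es ps) A)"
  show "?C \<subseteq> gen (set A)"
  proof (rule closure_list_least)
    show "set A \<inter> set es \<subseteq> gen (set A)" using gen_ext by blast
    fix as bs assume p: "(as, bs) \<in> set (proper_list es ps)" "set as \<subseteq> gen (set A)"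
    have "(set as, set bs) \<in> family (proper_list es ps)" using p(1) by force
    then show "set bs \<subseteq> gen (set A)"
      using satisfiesD[OF gen_satisfies[OF A] _ p(2)] unfolding family_proper_list by blast
  qed
  show "gen (set A) \<subseteq> ?C"
  proof (rule gen_least)
    show "?C \<subseteq> E" using closure_list_sub set_es by metis
    show "set A \<subseteq> ?C" using closure_list_ext A set_es by metis
    show "satisfies ?C (low_rules \<union> line_rules)"
    proof (rule satisfiesI)
      fix U B assume UB: "(U, B) \<in> low_rules \<union> line_rules" "U \<subseteq> ?C"
      then obtain as bs where p: "(as, bs) \<in> set (proper_list es ps)" "U = set as" "B = set bs"
        unfolding family_proper_list[symmetric] by auto
      have B: "B \<noteq> {}" "B \<subseteq> E" using proper_rules_sub_cl[OF UB(1)] F_sub by blast+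
      then show "B \<noteq> {} \<and> B \<subseteq> ?C" using closure_list_closed[OF p(1)] UB(2) p set_es by simp
    qed
  qed
qed

lemma Bex_mono: "A \<subseteq> B \<Longrightarrow> \<exists>x\<in>A. P x \<Longrightarrow> \<exists>x\<in>B. P x"
  by blast

sublocale optimal_data E F Dset reps Qset
proof
  let ?rs = "proper_list es ps"
  let ?red = "\<lambda>S x. \<exists>y\<in>set S. fst y \<in> set (closure_list es ?rs [fst x, snd x]) \<and>
    snd y \<in> set (closure_list es ?rs [fst x, snd x])"
  have red: "?red S (p, q) \<longleftrightarrow> (\<exists>(r, s)\<in>set S. {r, s} \<subseteq> gen {p, q})" if "p \<in> E" "q \<in> E" for S p q
    using set_closure_proper[of "[p, q]"] that by (simp add: case_prod_beta)
  have Q: "Qset = set (greedy ?red inconsistent_pairs)" unfolding Qset_def conflict_pairs_def ..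
  define P where "P = {(p, q). p \<in> E \<and> q \<in> E \<and> cl {p, q} \<notin> F}"
  let ?I = "\<lambda>A. A \<subseteq> P \<and> (\<forall>(p, q)\<in>P. \<exists>(r, s)\<in>A. {r, s} \<subseteq> gen {p, q})"
  have "?I Qset" unfolding Q
  proof (rule greedy_invariant[of ?red ?I])
    fix S x assume r: "?red S x" and I: "?I (insert x (set S))"
    obtain u v where x: "x = (u, v)" by (cases x) auto
    have uv: "u \<in> E" "v \<in> E" using I x unfolding P_def by auto
    then have uvE: "{u, v} \<subseteq> E" by simp
    obtain c d where cd: "(c, d) \<in> set S" "{c, d} \<subseteq> gen {u, v}" using r red[OF uv] x by auto
    have cover: "\<exists>(r, s)\<in>set S. {r, s} \<subseteq> gen {p, q}" if pq: "(p, q) \<in> P" for p q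
    proof -
      have E: "{p, q} \<subseteq> E" using pq unfolding P_def by auto
      have "\<exists>(r, s)\<in>insert x (set S). {r, s} \<subseteq> gen {p, q}"
        using bspec[OF conjunct2[OF I] pq] by (simp only: prod.case)
      then obtain r s where rs: "(r, s) \<in> insert x (set S)" "{r, s} \<subseteq> gen {p, q}"
        by blast
      show ?thesis
      proof (cases "(r, s) = x")
        case True
        \<comment> \<open>Whatever the removed pair covered is covered by the pair that made it
          redundant, because \<open>gen {p, q}\<close> satisfies the proper rules.\<close>
        then have "{u, v} \<subseteq> gen {p, q}" using rs(2) x by simp
        from gen_least[OF gen_sub_E[OF E] gen_satisfies[OF E] this]
        have "{c, d} \<subseteq> gen {p, q}" using cd(2) by (rule order_trans[rotated])
        then show ?thesis using cd(1) by (intro bexI[of _ "(c, d)"]) auto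
      next
        case False
        then show ?thesis using rs by (intro bexI[of _ "(r, s)"]) auto
      qed
    qed
    show "?I (set S)"
    proof (intro conjI ballI)
      show "set S \<subseteq> P" using conjunct1[OF I] by simp
      fix y assume y: "y \<in> P"
      obtain p q where pq: "y = (p, q)" by (cases y)
      show "case y of (p, q) \<Rightarrow> \<exists>(r, s)\<in>set S. {r, s} \<subseteq> gen {p, q}"
        using cover[of p q] y unfolding pq prod.case .
    qed
  next
    show "?I (set inconsistent_pairs)" unfolding set_inconsistent_pairs P_def[symmetric]
    proof (intro conjI ballI order_refl)
      fix y assume y: "y \<in> P"
      obtain p q where pq: "y = (p, q)" by (cases y)
      show "case y of (p, q) \<Rightarrow> \<exists>(r, s)\<in>P. {r, s} \<subseteq> gen {p, q}"
        unfolding pq prod.case by (rule bexI[of _ "(p, q)"]) (use gen_ext[of "{p, q}"] y pq in simp_all)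
    qed
  qed
  then show "\<exists>(r, s)\<in>Qset. {r, s} \<subseteq> gen {p, q}" if "p \<in> E" "q \<in> E" "cl {p, q} \<notin> F" for p q
    using that unfolding P_def by auto
  show "(r', s') = (r, s)"
    if Qs: "(r, s) \<in> Qset" "(r', s') \<in> Qset" and g: "{r', s'} \<subseteq> gen {r, s}" for r s r' s'
  proof (rule ccontr)
    assume n: "(r', s') \<noteq> (r, s)"
    obtain ys zs where d: "greedy ?red inconsistent_pairs = ys @ (r, s) # zs"
      using split_list[OF Qs(1)[unfolded Q]] by (elim exE)
    have "\<not> ?red (ys @ zs) (r, s)"
    proof (rule greedy_irredundant[of ?red inconsistent_pairs])
      show "?red S' x" if "set S \<subseteq> set S'" "?red S x" for S S' x
        using Bex_mono[OF that] .
    qed (rule d)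
    moreover have "(r', s') \<in> set (ys @ (r, s) # zs)" using Qs(2) unfolding Q d .
    then have "(r', s') \<in> set (ys @ zs)" using n by auto
    moreover have "r \<in> E" "s \<in> E" using Q_sub[OF Qs(1)] by auto
    ultimately show False using red[of r s "ys @ zs"] g by auto
  qed
qed

lemma optimal_base_optimum_list:
  assumes "es \<noteq> []"
  shows "optimal_base E F (family (optimum_list es ps))"
proof -
  have "family (map (\<lambda>x. ([fst x, snd x], [])) (conflict_pairs es ps (proper_list es ps))) = conflict_rules"
  proof -
    have "family (map (\<lambda>x. ([fst x, snd x], [])) (conflict_pairs es ps (proper_list es ps))) =
        (\<lambda>x. ({fst x, snd x}, {})) ` Qset"
      unfolding Qset_def by (simp add: image_image)
    also have "\<dots> = conflict_rules" unfolding conflict_rules_def by force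
    finally show ?thesis .
  qed
  then have "family (optimum_list es ps) = base"
    unfolding optimum_list_def base_def using assms family_proper_list by (simp add: image_Un)
  then show ?thesis using optimal_base_base by simp
qed

end

theorem optimal_base_optimum_list:
  fixes es :: "'a list"
  assumes E: "set es = E" "E \<noteq> UNIV" and impl: "implications_on E (family ps)"
    and simple: "simple_implications E (family ps)"
    and mod: "modular_semilattice (inclusion_order (closed_sets E (family ps)))"
  shows "optimal_base E (closed_sets E (family ps)) (family (optimum_list es ps))"
proof (cases "es = []")
  case True
  have "card (fst \<sigma>) + card (snd \<sigma>) = 0" if "\<sigma> \<in> family ps" for \<sigma>
    using impl that True E(1) unfolding implications_on_def by auto
  then have "implications_size (family ps) = 0"
    unfolding implications_size_def by (simp add: case_prod_beta)
  then show ?thesis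
    using True impl unfolding optimal_base_def implicational_base_def optimum_list_def by simp
next
  case False
  have "modular_family E (closed_sets E (family ps))"
    by (rule modular_family_closed_sets[OF _ E(2) _ simple mod]) (use E(1) False in auto)
  then interpret list_instance E "closed_sets E (family ps)" es ps
    using E(1) impl by (intro list_instance.intro list_instance_axioms.intro) auto
  show ?thesis using optimal_base_optimum_list[OF False] .
qed


section \<open>Polynomial-time functions on trees\<close>

lemma poly_mono_nat: "x \<le> y \<Longrightarrow> poly (q :: nat poly) x \<le> poly q y"
  by (induction q) (auto intro!: add_mono mult_mono)

definition poly_bounded :: "(tree \<Rightarrow> nat) \<Rightarrow> bool" where
  "poly_bounded h \<longleftrightarrow> (\<exists>q. \<forall>x. h x \<le> poly q (nodes x))"

lemma poly_bounded_mono: "poly_bounded g \<Longrightarrow> (\<And>x. h x \<le> g x) \<Longrightarrow> poly_bounded h"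
  unfolding poly_bounded_def by (meson order_trans)

lemma poly_bounded_const: "poly_bounded (\<lambda>x. k)"
  unfolding poly_bounded_def by (rule exI[of _ "[:k:]"]) simp

lemma poly_bounded_nodes: "poly_bounded nodes"
  unfolding poly_bounded_def by (rule exI[of _ "[:0, 1:]"]) simp

lemma poly_bounded_add:
  assumes "poly_bounded f" "poly_bounded g"
  shows "poly_bounded (\<lambda>x. f x + g x)"
proof -
  obtain q r where "\<And>x. f x \<le> poly q (nodes x)" "\<And>x. g x \<le> poly r (nodes x)"
    using assms unfolding poly_bounded_def by blast
  then have "f x + g x \<le> poly (q + r) (nodes x)" for x by (simp add: add_mono)
  then show ?thesis unfolding poly_bounded_def by blast
qed

lemma poly_bounded_mult:
  assumes "poly_bounded f" "poly_bounded g"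
  shows "poly_bounded (\<lambda>x. f x * g x)"
proof -
  obtain q r where "\<And>x. f x \<le> poly q (nodes x)" "\<And>x. g x \<le> poly r (nodes x)"
    using assms unfolding poly_bounded_def by blast
  then have "f x * g x \<le> poly (q * r) (nodes x)" for x by (simp add: mult_mono)
  then show ?thesis unfolding poly_bounded_def by blast
qed

lemma poly_bounded_poly:
  assumes "poly_bounded f"
  shows "poly_bounded (\<lambda>x. poly q (f x))"
proof -
  obtain r where "\<And>x. f x \<le> poly r (nodes x)"
    using assms unfolding poly_bounded_def by blast
  then have "poly q (f x) \<le> poly (pcompose q r) (nodes x)" for x
    by (simp add: poly_pcompose poly_mono_nat)
  then show ?thesis unfolding poly_bounded_def by blast
qed

lemmas poly_bounded_intros = poly_bounded_const poly_bounded_nodes poly_bounded_add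
  poly_bounded_mult poly_bounded_poly

text \<open>The bound is required on all trees, including those that encode nothing, so that
  composition needs no side conditions.\<close>

definition poly_time :: "(tree \<Rightarrow> tree) \<Rightarrow> bool" where
  "poly_time f \<longleftrightarrow> (\<exists>c q. \<forall>x. \<exists>t. runs c x t (f x) \<and> t \<le> poly q (nodes x))"

lemma poly_timeI:
  assumes "poly_bounded h" "\<And>x. \<exists>t. runs c x t (f x) \<and> t \<le> h x"
  shows "poly_time f"
  using assms unfolding poly_time_def poly_bounded_def by (meson order_trans)

lemma poly_timeE:
  assumes "poly_time f"
  obtains c q where "\<forall>x. \<exists>t. runs c x t (f x) \<and> t \<le> poly q (nodes x)"
  using assms unfolding poly_time_def by blast

lemma nodes_eval_le: "nodes (eval_expr e x) \<le> expr_cost e x"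
  by (cases e) auto

text \<open>Every value is charged its size. Hence polynomial-time functions have polynomially large
  values, which is what composition needs.\<close>

lemma runs_size: "runs c x t y \<Longrightarrow> nodes y \<le> nodes x + t"
proof (induction rule: runs.induct)
  case (Assign e x)
  then show ?case using nodes_eval_le[of e x] by simp
qed auto

lemma poly_time_size:
  assumes "poly_time f"
  shows "poly_bounded (\<lambda>x. nodes (f x))"
proof -
  obtain c q where cq: "\<forall>x. \<exists>t. runs c x t (f x) \<and> t \<le> poly q (nodes x)"
    using assms by (rule poly_timeE)
  have "nodes (f x) \<le> nodes x + poly q (nodes x)" for x
  proof -
    obtain t where "runs c x t (f x)" "t \<le> poly q (nodes x)" using cq by blast
    then show ?thesis using runs_size[of c x t "f x"] by simp
  qed
  then show ?thesis
    by (rule poly_bounded_mono[rotated]) (intro poly_bounded_intros)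
qed

lemma poly_bounded_cost: "poly_bounded (expr_cost e)"
proof (induction e)
  case EVar
  show ?case using poly_bounded_nodes by (rule poly_bounded_mono) simp
next
  case ENil
  show ?case using poly_bounded_const[of 1] by (rule poly_bounded_mono) simp
next
  case (ECons e f)
  have "poly_bounded (\<lambda>x. 2 * (expr_cost e x + expr_cost f x) + 1)"
    by (intro poly_bounded_intros ECons)
  then show ?case
  proof (rule poly_bounded_mono)
    show "expr_cost (ECons e f) x \<le> 2 * (expr_cost e x + expr_cost f x) + 1" for x
      using nodes_eval_le[of e x] nodes_eval_le[of f x] by simp
  qed
next
  case (EHd e)
  have "poly_bounded (\<lambda>x. 2 * expr_cost e x + 1)" by (intro poly_bounded_intros EHd)
  then show ?case
  proof (rule poly_bounded_mono)
    show "expr_cost (EHd e) x \<le> 2 * expr_cost e x + 1" for x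
      using nodes_eval_le[of e x] by (cases "eval_expr e x") auto
  qed
next
  case (ETl e)
  have "poly_bounded (\<lambda>x. 2 * expr_cost e x + 1)" by (intro poly_bounded_intros ETl)
  then show ?case
  proof (rule poly_bounded_mono)
    show "expr_cost (ETl e) x \<le> 2 * expr_cost e x + 1" for x
      using nodes_eval_le[of e x] by (cases "eval_expr e x") auto
  qed
qed

lemma poly_time_expr: "poly_time (eval_expr e)"
proof (rule poly_timeI)
  show "poly_bounded (\<lambda>x. 1 + expr_cost e x)" by (intro poly_bounded_intros poly_bounded_cost)
  show "\<exists>t. runs (Assign e) x t (eval_expr e x) \<and> t \<le> 1 + expr_cost e x" for x
    using runs.Assign by blast
qed

lemma poly_time_exprI:
  assumes "\<And>x. f x = eval_expr e x"
  shows "poly_time f"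
proof -
  have "f = eval_expr e" using assms by (rule ext)
  then show ?thesis using poly_time_expr by simp
qed

lemma poly_time_comp:
  assumes "poly_time g" "poly_time f"
  shows "poly_time (\<lambda>x. g (f x))"
proof -
  obtain c q where f: "\<forall>x. \<exists>t. runs c x t (f x) \<and> t \<le> poly q (nodes x)"
    using assms(2) by (rule poly_timeE)
  obtain d r where g: "\<forall>x. \<exists>t. runs d x t (g x) \<and> t \<le> poly r (nodes x)"
    using assms(1) by (rule poly_timeE)
  show ?thesis
  proof (rule poly_timeI)
    show "poly_bounded (\<lambda>x. 1 + poly q (nodes x) + poly r (nodes (f x)))"
      by (intro poly_bounded_intros poly_time_size assms)
    fix x
    obtain t where t: "runs c x t (f x)" "t \<le> poly q (nodes x)" using f by blast
    obtain u where u: "runs d (f x) u (g (f x))" "u \<le> poly r (nodes (f x))" using g by blast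
    show "\<exists>t. runs (Seq c d) x t (g (f x)) \<and> t \<le> 1 + poly q (nodes x) + poly r (nodes (f x))"
      using runs.Seq[OF t(1) u(1)] t(2) u(2) by (intro exI[of _ "1 + t + u"]) simp
  qed
qed

text \<open>A program is relocated to the left component of the store, so that the right component
  can hold data across its execution.\<close>

fun lift_expr :: "expr \<Rightarrow> expr" where
  "lift_expr EVar = EHd EVar"
| "lift_expr ENil = ENil"
| "lift_expr (ECons e f) = ECons (lift_expr e) (lift_expr f)"
| "lift_expr (EHd e) = EHd (lift_expr e)"
| "lift_expr (ETl e) = ETl (lift_expr e)"

fun lift_prog :: "prog \<Rightarrow> prog" where
  "lift_prog (Assign e) = Assign (ECons (lift_expr e) (ETl EVar))"
| "lift_prog (Seq c d) = Seq (lift_prog c) (lift_prog d)"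
| "lift_prog (While e c) = While (lift_expr e) (lift_prog c)"

lemma eval_lift_expr: "eval_expr (lift_expr e) (Node x z) = eval_expr e x"
  by (induction e) auto

lemma nodes_pos: "0 < nodes x"
  by (cases x) auto

text \<open>A variable access becomes \<open>EHd EVar\<close> and costs
  \<open>1 + 2 * nodes x + nodes z\<close> instead of \<open>nodes x\<close>. As
  \<open>nodes x\<close> is positive, the factor \<open>nodes z + 3\<close> suffices.\<close>

lemma cost_lift_expr: "expr_cost (lift_expr e) (Node x z) \<le> expr_cost e x * (nodes z + 3)"
proof (induction e)
  case EVar
  obtain k where "nodes x = Suc k" using nodes_pos[of x] by (cases "nodes x") auto
  then show ?case by (simp add: algebra_simps)
next
  case (ECons e f)
  then show ?case by (simp add: eval_lift_expr algebra_simps)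
qed (simp_all add: eval_lift_expr algebra_simps)

text \<open>A single \<open>K\<close> serves all subruns: by \<open>runs_size\<close>, store size
  plus remaining cost never exceeds its initial value. The factor 10 leaves room for rebuilding the
  pair in each assignment.\<close>

lemma runs_lift_prog:
  "runs c x t y \<Longrightarrow> 10 * (nodes x + t + nodes z + 1) \<le> K \<Longrightarrow>
    \<exists>u. runs (lift_prog c) (Node x z) u (Node y z) \<and> u \<le> t * K"
proof (induction rule: runs.induct)
  case (Assign e x)
  let ?e = "ECons (lift_expr e) (ETl EVar)"
  have "1 + expr_cost ?e (Node x z) \<le> expr_cost e x * (nodes z + 4) + (nodes x + 3 * nodes z + 3)"
    using cost_lift_expr[of e x z] nodes_eval_le[of e x] by (simp add: eval_lift_expr algebra_simps)
  also have "\<dots> \<le> expr_cost e x * K + K"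
    by (intro add_mono mult_le_mono2) (use Assign in auto)
  finally show ?case
    using runs.Assign[of ?e "Node x z"] by (auto simp: eval_lift_expr algebra_simps)
next
  case (Seq c x t y d u w)
  obtain t' where t': "runs (lift_prog c) (Node x z) t' (Node y z)" "t' \<le> t * K"
    using Seq by auto
  obtain u' where u': "runs (lift_prog d) (Node y z) u' (Node w z)" "u' \<le> u * K"
    using Seq runs_size[OF Seq.hyps(1)] by auto
  have "1 + t' + u' \<le> (1 + t + u) * K"
    using t'(2) u'(2) Seq.prems by (simp add: algebra_simps)
  then show ?case using runs.Seq[OF t'(1) u'(1)] by auto
next
  case (While_end e x c)
  have "expr_cost (lift_expr e) (Node x z) \<le> expr_cost e x * K"
    by (rule order_trans[OF cost_lift_expr mult_le_mono2]) (use While_end.prems in simp)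
  then have "1 + expr_cost (lift_expr e) (Node x z) \<le> (1 + expr_cost e x) * K"
    using While_end.prems by (simp add: algebra_simps)
  then show ?case
    using runs.While_end[of "lift_expr e" "Node x z" "lift_prog c"] While_end.hyps
    by (auto simp: eval_lift_expr)
next
  case (While_step e x c t y u w)
  obtain t' where t': "runs (lift_prog c) (Node x z) t' (Node y z)" "t' \<le> t * K"
    using While_step by auto
  obtain u' where u': "runs (lift_prog (While e c)) (Node y z) u' (Node w z)" "u' \<le> u * K"
    using While_step runs_size[OF While_step.hyps(2)] by auto
  have "expr_cost (lift_expr e) (Node x z) \<le> expr_cost e x * K"
    by (rule order_trans[OF cost_lift_expr mult_le_mono2]) (use While_step.prems in simp)
  then have "1 + expr_cost (lift_expr e) (Node x z) + t' + u' \<le> (1 + expr_cost e x + t + u) * K"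
    using t'(2) u'(2) While_step.prems by (simp add: algebra_simps)
  moreover have "runs (lift_prog (While e c)) (Node x z) (1 + expr_cost (lift_expr e) (Node x z) + t' + u') (Node w z)"
    using runs.While_step[of "lift_expr e" "Node x z" "lift_prog c"] While_step.hyps(1) t'(1) u'(1)
    by (simp add: eval_lift_expr)
  ultimately show ?case by blast
qed

lemma poly_time_id: "poly_time (\<lambda>x. x)"
  by (rule poly_time_exprI[of _ EVar]) simp

lemma poly_time_Leaf: "poly_time (\<lambda>x. Leaf)"
  by (rule poly_time_exprI[of _ ENil]) simp

lemma poly_time_left: "poly_time f \<Longrightarrow> poly_time (\<lambda>x. left (f x))"
  using poly_time_comp[OF poly_time_expr[of "EHd EVar"]] by simp

lemma poly_time_right: "poly_time f \<Longrightarrow> poly_time (\<lambda>x. right (f x))"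
  using poly_time_comp[OF poly_time_expr[of "ETl EVar"]] by simp

lemma poly_time_first:
  assumes "poly_time f"
  shows "poly_time (\<lambda>z. Node (f (left z)) (right z))"
proof -
  obtain c q where f: "\<forall>x. \<exists>t. runs c x t (f x) \<and> t \<le> poly q (nodes x)"
    using assms by (rule poly_timeE)
  \<comment> \<open>This assignment turns the store \<open>Leaf\<close> into
    \<open>Node Leaf Leaf\<close>, so that the relocated program always finds a pair.\<close>
  let ?e = "ECons (EHd EVar) (ETl EVar)"
  have le: "nodes (left z) \<le> nodes z" "nodes (right z) \<le> nodes z" for z by (cases z; simp)+
  let ?m = "\<lambda>z. 10 * (nodes z + poly q (nodes z) + nodes z + 1)"
  show ?thesis
  proof (rule poly_timeI)
    show "poly_bounded (\<lambda>z. 1 + (1 + expr_cost ?e z) + poly q (nodes z) * ?m z)"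
      by (intro poly_bounded_intros poly_bounded_cost)
    fix z
    obtain t where t: "runs c (left z) t (f (left z))" "t \<le> poly q (nodes (left z))" using f by blast
    have tz: "t \<le> poly q (nodes z)" using t(2) poly_mono_nat[OF le(1), of q z] by simp
    have "10 * (nodes (left z) + t + nodes (right z) + 1) \<le> ?m z"
      by (intro mult_le_mono2 add_mono le tz order_refl)
    then obtain u where u: "runs (lift_prog c) (Node (left z) (right z)) u (Node (f (left z)) (right z))"
      "u \<le> t * ?m z"
      using runs_lift_prog[OF t(1)] by blast
    have "u \<le> poly q (nodes z) * ?m z"
      using u(2) mult_le_mono1[OF tz] by (rule order_trans)
    moreover have "runs (Seq (Assign ?e) (lift_prog c)) z (1 + (1 + expr_cost ?e z) + u) (Node (f (left z)) (right z))"
      using runs.Seq[OF runs.Assign[of ?e z], of "lift_prog c"] u(1) by simp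
    ultimately show "\<exists>t. runs (Seq (Assign ?e) (lift_prog c)) z t (Node (f (left z)) (right z)) \<and>
        t \<le> 1 + (1 + expr_cost ?e z) + poly q (nodes z) * ?m z"
      by (intro exI[of _ "1 + (1 + expr_cost ?e z) + u"]) simp
  qed
qed

text \<open>The input is duplicated; \<open>f\<close> works on the left copy, then the components
  are swapped, \<open>g\<close> works on the other copy, and they are swapped back.\<close>

lemma poly_time_Node:
  assumes "poly_time f" "poly_time g"
  shows "poly_time (\<lambda>x. Node (f x) (g x))"
proof -
  have "poly_time (\<lambda>x. Node x x)" by (rule poly_time_exprI[of _ "ECons EVar EVar"]) simp
  from poly_time_comp[OF poly_time_first[OF assms(1)] this]
  have 1: "poly_time (\<lambda>x. Node (f x) x)" by simp
  have swap: "poly_time (\<lambda>x. Node (right x) (left x))"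
    by (rule poly_time_exprI[of _ "ECons (ETl EVar) (EHd EVar)"]) simp
  from poly_time_comp[OF swap 1] have "poly_time (\<lambda>x. Node x (f x))" by simp
  from poly_time_comp[OF poly_time_first[OF assms(2)] this]
  have "poly_time (\<lambda>x. Node (g x) (f x))" by simp
  from poly_time_comp[OF swap this] show ?thesis by simp
qed

section \<open>Loops, conditionals and folds\<close>

lemma runs_While_funpow:
  assumes c: "\<And>x. \<exists>t. runs c x t (b x) \<and> t \<le> poly q (nodes x)"
    and e: "\<And>x. expr_cost e x \<le> poly r (nodes x)"
  shows "eval_expr e ((b ^^ n) x) = Leaf \<Longrightarrow> (\<And>i. i < n \<Longrightarrow> eval_expr e ((b ^^ i) x) \<noteq> Leaf) \<Longrightarrow>
    (\<And>i. i \<le> n \<Longrightarrow> nodes ((b ^^ i) x) \<le> s) \<Longrightarrow>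
    \<exists>t. runs (While e c) x t ((b ^^ n) x) \<and> t \<le> (n + 1) * (1 + poly r s + poly q s)"
proof (induction n arbitrary: x)
  case 0
  have "expr_cost e x \<le> poly r s" using e[of x] poly_mono_nat[OF 0(3)[of 0], of r] by simp
  then show ?case using runs.While_end[of e x c] 0(1) by auto
next
  case (Suc n)
  have sw: "(b ^^ i) (b x) = (b ^^ Suc i) x" for i by (simp add: funpow_swap1)
  obtain u where u: "runs (While e c) (b x) u ((b ^^ n) (b x))" "u \<le> (n + 1) * (1 + poly r s + poly q s)"
    using Suc.IH[of "b x"] Suc.prems unfolding sw by (metis Suc_less_eq Suc_le_mono)
  obtain t where t: "runs c x t (b x)" "t \<le> poly q (nodes x)" using c by blast
  have "nodes x \<le> s" using Suc.prems(3)[of 0] by simp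
  then have "t \<le> poly q s" "expr_cost e x \<le> poly r s"
    using t(2) e[of x] poly_mono_nat order_trans by blast+
  then have "1 + expr_cost e x + t + u \<le> (Suc n + 1) * (1 + poly r s + poly q s)"
    using u(2) by (simp add: algebra_simps)
  moreover have "runs (While e c) x (1 + expr_cost e x + t + u) ((b ^^ Suc n) x)"
    using runs.While_step[OF _ t(1) u(1)] Suc.prems(2)[of 0] sw by simp
  ultimately show ?case by blast
qed

text \<open>A bound \<open>N\<close> on the number of rounds does not suffice, since a
  polynomial-time body may double the store each time. Hence \<open>S\<close> bounds all
  intermediate stores.\<close>

lemma poly_time_While:
  assumes b: "poly_time b" and N: "poly_bounded N" and S: "poly_bounded S"
    and f: "\<And>x. \<exists>n\<le>N x. f x = (b ^^ n) x \<and> eval_expr e ((b ^^ n) x) = Leaf \<and>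
      (\<forall>i<n. eval_expr e ((b ^^ i) x) \<noteq> Leaf) \<and> (\<forall>i\<le>n. nodes ((b ^^ i) x) \<le> S x)"
  shows "poly_time f"
proof -
  obtain c q where c: "\<forall>x. \<exists>t. runs c x t (b x) \<and> t \<le> poly q (nodes x)"
    using b by (rule poly_timeE)
  obtain r where r: "\<And>x. expr_cost e x \<le> poly r (nodes x)"
    using poly_bounded_cost[of e] unfolding poly_bounded_def by blast
  show ?thesis
  proof (rule poly_timeI)
    show "poly_bounded (\<lambda>x. (N x + 1) * (1 + poly r (S x) + poly q (S x)))"
      by (intro poly_bounded_intros N S)
    fix x
    obtain n where n: "n \<le> N x" "f x = (b ^^ n) x" "eval_expr e ((b ^^ n) x) = Leaf"
      "\<And>i. i < n \<Longrightarrow> eval_expr e ((b ^^ i) x) \<noteq> Leaf" "\<And>i. i \<le> n \<Longrightarrow> nodes ((b ^^ i) x) \<le> S x"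
      using f[of x] by blast
    obtain t where t: "runs (While e c) x t ((b ^^ n) x)" "t \<le> (n + 1) * (1 + poly r (S x) + poly q (S x))"
      using runs_While_funpow[OF c[rule_format] r n(3-5)] by blast
    have "(n + 1) * (1 + poly r (S x) + poly q (S x)) \<le> (N x + 1) * (1 + poly r (S x) + poly q (S x))"
      using n(1) by (intro mult_le_mono1) simp
    then have "t \<le> (N x + 1) * (1 + poly r (S x) + poly q (S x))"
      using t(2) by (rule order_trans[rotated])
    then show "\<exists>t. runs (While e c) x t (f x) \<and> t \<le> (N x + 1) * (1 + poly r (S x) + poly q (S x))"
      using t(1) n(2) by metis
  qed
qed

definition tif :: "tree \<Rightarrow> tree \<Rightarrow> tree \<Rightarrow> tree" where
  "tif c a b = (if c = Leaf then b else a)"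

text \<open>A conditional is a loop that clears its own flag.\<close>

lemma poly_time_once:
  assumes h: "poly_time h" "\<And>z. left (h z) = Leaf"
  shows "poly_time (\<lambda>z. if left z = Leaf then z else h z)"
proof (rule poly_time_While[where b = h and e = "EHd EVar" and N = "\<lambda>z. 1" and
      S = "\<lambda>z. nodes z + nodes (h z)"])
  show "poly_bounded (\<lambda>z. nodes z + nodes (h z))" by (intro poly_bounded_intros poly_time_size h)
  fix z
  show "\<exists>n\<le>1. (if left z = Leaf then z else h z) = (h ^^ n) z \<and> eval_expr (EHd EVar) ((h ^^ n) z) = Leaf \<and>
      (\<forall>i<n. eval_expr (EHd EVar) ((h ^^ i) z) \<noteq> Leaf) \<and> (\<forall>i\<le>n. nodes ((h ^^ i) z) \<le> nodes z + nodes (h z))"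
  proof (cases "left z = Leaf")
    case True
    then show ?thesis by (intro exI[of _ 0]) simp
  next
    case False
    have "i = 0 \<or> i = 1" if "i \<le> 1" for i :: nat using that by linarith
    then show ?thesis using False h(2) by (intro exI[of _ 1]) (auto simp: le_Suc_eq)
  qed
qed (intro h poly_bounded_intros)+

lemma poly_time_tif:
  assumes c: "poly_time c" and a: "poly_time a" and b: "poly_time b"
  shows "poly_time (\<lambda>x. tif (c x) (a x) (b x))"
proof -
  let ?t = "Node Leaf Leaf"
  \<comment> \<open>The store holds the condition, a flag for the other case, and the data. The
    first loop treats the positive case and clears the flag as well; \<open>?sw\<close> then moves
    the flag to the front for the second loop.\<close>
  let ?A = "\<lambda>z. Node Leaf (Node Leaf (a (right (right z))))"
  let ?sw = "\<lambda>z. Node (left (right z)) (Node Leaf (right (right z)))"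
  let ?B = "\<lambda>z. Node Leaf (Node Leaf (b (right (right z))))"
  let ?loop = "\<lambda>h z. if left z = Leaf then z else h z"
  have A: "poly_time ?A" and B: "poly_time ?B" and sw: "poly_time ?sw"
    by (intro poly_time_Node poly_time_Leaf poly_time_left poly_time_right poly_time_id
        poly_time_comp[OF a] poly_time_comp[OF b])+
  have s: "poly_time (\<lambda>x. Node (c x) (Node ?t x))"
    by (intro poly_time_Node poly_time_Leaf poly_time_id c)
  have 1: "poly_time (?loop ?A)" by (rule poly_time_once[OF A]) simp
  have 2: "poly_time (?loop ?B)" by (rule poly_time_once[OF B]) simp
  have "poly_time (\<lambda>x. right (right (?loop ?B (?sw (?loop ?A (Node (c x) (Node ?t x)))))))"
    by (intro poly_time_right poly_time_comp[OF 2] poly_time_comp[OF sw] poly_time_comp[OF 1] s)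
  moreover have "right (right (?loop ?B (?sw (?loop ?A (Node (c x) (Node ?t x)))))) = tif (c x) (a x) (b x)" for x
    by (simp add: tif_def)
  ultimately show ?thesis by simp
qed

fun tfold :: "(tree \<Rightarrow> tree \<Rightarrow> tree) \<Rightarrow> tree \<Rightarrow> tree \<Rightarrow> tree" where
  "tfold g Leaf a = a"
| "tfold g (Node e l) a = tfold g l (g e a)"

text \<open>\<open>m\<close> stays fixed while the list shrinks, so that each round has the same
  bound \<open>poly q (nodes x + m)\<close> on the growth of the accumulator.\<close>

lemma tfold_loop:
  fixes g :: "tree \<Rightarrow> tree \<Rightarrow> tree \<Rightarrow> tree"
  assumes bound: "\<And>e acc. nodes (g x e acc) \<le> nodes acc + poly q (nodes x + nodes e)"
  defines "b \<equiv> \<lambda>s. Node (left s) (Node (right (left (right s))) (g (left s) (left (left (right s))) (right (right s))))"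
  shows "nodes l \<le> m \<Longrightarrow> \<exists>n\<le>nodes l. (b ^^ n) (Node x (Node l a)) = Node x (Node Leaf (tfold (g x) l a)) \<and>
    (\<forall>i<n. left (right ((b ^^ i) (Node x (Node l a)))) \<noteq> Leaf) \<and>
    (\<forall>i\<le>n. nodes ((b ^^ i) (Node x (Node l a))) \<le> 2 + nodes x + nodes l + nodes a + nodes l * poly q (nodes x + m))"
proof (induction l arbitrary: a)
  case Leaf
  then show ?case by (intro exI[of _ 0]) simp
next
  case (Node e l)
  let ?s = "Node x (Node (Node e l) a)" and ?s' = "Node x (Node l (g x e a))"
  have bs: "b ?s = ?s'" unfolding b_def by simp
  obtain n where n: "n \<le> nodes l" "(b ^^ n) ?s' = Node x (Node Leaf (tfold (g x) l (g x e a)))"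
    "\<And>i. i < n \<Longrightarrow> left (right ((b ^^ i) ?s')) \<noteq> Leaf"
    "\<And>i. i \<le> n \<Longrightarrow> nodes ((b ^^ i) ?s') \<le> 2 + nodes x + nodes l + nodes (g x e a) + nodes l * poly q (nodes x + m)"
    using Node.IH(2)[of "g x e a"] Node.prems by auto
  have sw: "(b ^^ Suc i) ?s = (b ^^ i) ?s'" for i by (simp add: funpow_swap1 bs)
  have "poly q (nodes x + nodes e) \<le> poly q (nodes x + m)"
    by (rule poly_mono_nat) (use Node.prems in simp)
  then have ga: "nodes (g x e a) \<le> nodes a + poly q (nodes x + m)"
    using bound[of e a] by simp
  show ?case
  proof (intro exI[of _ "Suc n"] conjI allI impI)
    show "Suc n \<le> nodes (Node e l)" using n(1) by simp
    show "(b ^^ Suc n) ?s = Node x (Node Leaf (tfold (g x) (Node e l) a))"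
      unfolding sw n(2) by simp
    show "left (right ((b ^^ i) ?s)) \<noteq> Leaf" if "i < Suc n" for i
    proof (cases i)
      case (Suc j)
      then show ?thesis using n(3)[of j] that sw by simp
    qed simp
    show "nodes ((b ^^ i) ?s) \<le> 2 + nodes x + nodes (Node e l) + nodes a + nodes (Node e l) * poly q (nodes x + m)"
      if "i \<le> Suc n" for i
    proof (cases i)
      case (Suc j)
      then have "nodes ((b ^^ i) ?s) \<le> 2 + nodes x + nodes l + nodes (g x e a) + nodes l * poly q (nodes x + m)"
        using n(4)[of j] that sw by simp
      then show ?thesis using ga by (simp add: algebra_simps)
    qed simp
  qed
qed

text \<open>The growth of the accumulator is bounded by an amount independent of the accumulator
  itself; multiplicative growth would compound exponentially. The environment \<open>x\<close> stays
  in the store throughout, so \<open>g\<close> may use it.\<close>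

lemma poly_time_tfold:
  fixes g :: "tree \<Rightarrow> tree \<Rightarrow> tree \<Rightarrow> tree"
  assumes g: "poly_time (\<lambda>w. g (left w) (left (right w)) (right (right w)))"
    and bound: "\<And>x e acc. nodes (g x e acc) \<le> nodes acc + poly q (nodes x + nodes e)"
    and l: "poly_time l" and a: "poly_time a"
  shows "poly_time (\<lambda>x. tfold (g x) (l x) (a x))"
proof -
  define b where "b = (\<lambda>s. Node (left s) (Node (right (left (right s))) (g (left s) (left (left (right s))) (right (right s)))))"
  \<comment> \<open>The effect of the loop on every store, also on those that are not of the
    intended shape.\<close>
  define F where "F = (\<lambda>s. if left (right s) = Leaf then s
    else Node (left s) (Node Leaf (tfold (g (left s)) (left (right s)) (right (right s)))))"
  have pb: "poly_time b"
  proof -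
    let ?w = "\<lambda>s. Node (left s) (Node (left (left (right s))) (right (right s)))"
    have "poly_time ?w"
      by (intro poly_time_Node poly_time_left poly_time_right poly_time_id)
    from poly_time_comp[OF g this]
    have "poly_time (\<lambda>s. g (left s) (left (left (right s))) (right (right s)))" by simp
    then show ?thesis unfolding b_def
      by (intro poly_time_Node poly_time_left poly_time_right poly_time_id)
  qed
  have pF: "poly_time F"
  proof (rule poly_time_While[OF pb, where e = "EHd (ETl EVar)" and N = nodes
        and S = "\<lambda>s. nodes s + nodes s * poly q (nodes s)"])
    show "poly_bounded nodes" "poly_bounded (\<lambda>s. nodes s + nodes s * poly q (nodes s))"
      by (intro poly_bounded_intros)+
    fix s
    show "\<exists>n\<le>nodes s. F s = (b ^^ n) s \<and> eval_expr (EHd (ETl EVar)) ((b ^^ n) s) = Leaf \<and>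
      (\<forall>i<n. eval_expr (EHd (ETl EVar)) ((b ^^ i) s) \<noteq> Leaf) \<and>
      (\<forall>i\<le>n. nodes ((b ^^ i) s) \<le> nodes s + nodes s * poly q (nodes s))"
    proof (cases "left (right s) = Leaf")
      case True
      then show ?thesis by (intro exI[of _ 0]) (simp add: F_def)
    next
      case False
      then obtain x l a where s: "s = Node x (Node l a)"
        by (cases s; cases "right s") auto
      obtain n where n: "n \<le> nodes l" "(b ^^ n) s = Node x (Node Leaf (tfold (g x) l a))"
        "\<And>i. i < n \<Longrightarrow> left (right ((b ^^ i) s)) \<noteq> Leaf"
        "\<And>i. i \<le> n \<Longrightarrow> nodes ((b ^^ i) s) \<le> 2 + nodes x + nodes l + nodes a + nodes l * poly q (nodes x + nodes l)"
        using tfold_loop[of g x q l "nodes l" a] bound unfolding b_def s by blast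
      have "poly q (nodes x + nodes l) \<le> poly q (nodes s)" by (rule poly_mono_nat) (simp add: s)
      then have "nodes l * poly q (nodes x + nodes l) \<le> nodes s * poly q (nodes s)"
        by (intro mult_le_mono) (simp_all add: s)
      then have "nodes ((b ^^ i) s) \<le> nodes s + nodes s * poly q (nodes s)" if "i \<le> n" for i
        using n(4)[OF that] by (simp add: s)
      moreover have "F s = (b ^^ n) s" using False n(2) by (simp add: F_def s)
      moreover have "n \<le> nodes s" using n(1) by (simp add: s)
      ultimately show ?thesis using n(2,3) by (intro exI[of _ n]) simp
    qed
  qed
  have "poly_time (\<lambda>x. Node x (Node (l x) (a x)))"
    by (intro poly_time_Node poly_time_id l a)
  from poly_time_right[OF poly_time_right[OF poly_time_comp[OF pF this]]]
  have "poly_time (\<lambda>x. right (right (F (Node x (Node (l x) (a x))))))" .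
  moreover have "right (right (F (Node x (Node (l x) (a x))))) = tfold (g x) (l x) (a x)" for x
    by (simp add: F_def)
  ultimately show ?thesis by simp
qed


section \<open>List operations on trees\<close>

definition tbool :: "bool \<Rightarrow> tree" where
  "tbool b = (if b then Node Leaf Leaf else Leaf)"

lemma tbool_Leaf [simp]: "tbool b = Leaf \<longleftrightarrow> \<not> b"
  by (simp add: tbool_def)

lemma tif_tbool [simp]: "tif (tbool b) x y = (if b then x else y)"
  by (simp add: tif_def)

definition tnot :: "tree \<Rightarrow> tree" where "tnot a = tif a Leaf (Node Leaf Leaf)"
definition tand :: "tree \<Rightarrow> tree \<Rightarrow> tree" where "tand a b = tif a (tif b (Node Leaf Leaf) Leaf) Leaf"
definition tor :: "tree \<Rightarrow> tree \<Rightarrow> tree" where "tor a b = tif a (Node Leaf Leaf) (tif b (Node Leaf Leaf) Leaf)"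

lemma tnot_tbool [simp]: "tnot (tbool a) = tbool (\<not> a)"
  by (simp add: tnot_def tbool_def tif_def)

lemma tand_tbool [simp]: "tand (tbool a) (tbool b) = tbool (a \<and> b)"
  by (simp add: tand_def tbool_def tif_def)

lemma tor_tbool [simp]: "tor (tbool a) (tbool b) = tbool (a \<or> b)"
  by (simp add: tor_def tbool_def tif_def)

lemma tnot_enc_list [simp]: "tnot (enc_list f xs) = tbool (xs = [])"
  by (cases xs) (simp_all add: tnot_def tif_def tbool_def)

lemma poly_time_tt: "poly_time (\<lambda>x. Node Leaf Leaf)"
  by (intro poly_time_Node poly_time_Leaf)

lemma poly_time_tnot: "poly_time a \<Longrightarrow> poly_time (\<lambda>x. tnot (a x))"
  unfolding tnot_def by (intro poly_time_tif poly_time_Leaf poly_time_tt)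

lemma poly_time_tand: "poly_time a \<Longrightarrow> poly_time b \<Longrightarrow> poly_time (\<lambda>x. tand (a x) (b x))"
  unfolding tand_def by (intro poly_time_tif poly_time_Leaf poly_time_tt)

lemma poly_time_tor: "poly_time a \<Longrightarrow> poly_time b \<Longrightarrow> poly_time (\<lambda>x. tor (a x) (b x))"
  unfolding tor_def by (intro poly_time_tif poly_time_Leaf poly_time_tt)

lemmas poly_time_basic = poly_time_id poly_time_Leaf poly_time_left poly_time_right poly_time_Node
  poly_time_tif poly_time_tnot poly_time_tand poly_time_tor

text \<open>A function with an environment \<open>x\<close> and a list element \<open>e\<close> is presented as a function of
  the pair \<open>Node x e\<close>.\<close>

lemma poly_time_comp2:
  assumes "poly_time (\<lambda>w. P (left w) (right w))" "poly_time a" "poly_time b"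
  shows "poly_time (\<lambda>x. P (a x) (b x))"
  using poly_time_comp[OF assms(1) poly_time_Node[OF assms(2,3)]] by simp

definition trev :: "tree \<Rightarrow> tree" where "trev l = tfold Node l Leaf"

lemma tfold_Node_enc_list: "tfold Node (enc_list f xs) (enc_list f ys) = enc_list f (rev xs @ ys)"
proof (induction xs arbitrary: ys)
  case (Cons x xs)
  then show ?case using Cons.IH[of "x # ys"] by simp
qed simp

lemma trev_enc_list [simp]: "trev (enc_list f xs) = enc_list f (rev xs)"
  using tfold_Node_enc_list[of f xs "[]"] by (simp add: trev_def)

lemma poly_time_trev: "poly_time l \<Longrightarrow> poly_time (\<lambda>x. trev (l x))"
  unfolding trev_def
  by (rule poly_time_tfold[where g = "\<lambda>x e acc. Node e acc" and q = "[:1, 1:]"])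
    (auto intro!: poly_time_basic)

definition tapp :: "tree \<Rightarrow> tree \<Rightarrow> tree" where "tapp a b = tfold Node (trev a) b"

lemma tapp_enc_list [simp]: "tapp (enc_list f xs) (enc_list f ys) = enc_list f (xs @ ys)"
  using tfold_Node_enc_list[of f "rev xs" ys] by (simp add: tapp_def)

lemma nodes_tfold_Node: "nodes (tfold Node l a) + 1 = nodes l + nodes a"
  by (induction l arbitrary: a) auto

lemma nodes_tapp: "nodes (tapp a b) + 1 = nodes a + nodes b"
  using nodes_tfold_Node[of a Leaf] nodes_tfold_Node[of "trev a" b] by (simp add: tapp_def trev_def)

lemma poly_time_tapp: "poly_time a \<Longrightarrow> poly_time b \<Longrightarrow> poly_time (\<lambda>x. tapp (a x) (b x))"
  unfolding tapp_def
  by (rule poly_time_tfold[where g = "\<lambda>x e acc. Node e acc" and q = "[:1, 1:]"])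
    (auto intro!: poly_time_basic poly_time_trev)

definition tfilter :: "(tree \<Rightarrow> tree) \<Rightarrow> tree \<Rightarrow> tree" where
  "tfilter P l = trev (tfold (\<lambda>e acc. tif (P e) (Node e acc) acc) l Leaf)"

lemma tfilter_enc_list:
  assumes "\<And>x. x \<in> set xs \<Longrightarrow> P (f x) = tbool (Q x)"
  shows "tfilter P (enc_list f xs) = enc_list f (filter Q xs)"
proof -
  have "tfold (\<lambda>e acc. tif (P e) (Node e acc) acc) (enc_list f xs) (enc_list f ys) =
      enc_list f (rev (filter Q xs) @ ys)" for ys
    using assms
  proof (induction xs arbitrary: ys)
    case (Cons x xs)
    then show ?case using Cons.IH[of "x # ys"] Cons.IH[of ys] by simp
  qed simp
  from this[of "[]"] show ?thesis by (simp add: tfilter_def)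
qed

lemma nodes_tfilter: "nodes (tfilter P l) \<le> nodes l"
proof -
  have "nodes (tfold (\<lambda>e acc. tif (P e) (Node e acc) acc) l a) + 1 \<le> nodes l + nodes a" for a
  proof (induction l arbitrary: a)
    case (Node e l)
    show ?case using Node.IH(2)[of "tif (P e) (Node e a) a"] by (simp add: tif_def split: if_splits)
  qed simp
  from this[of Leaf] show ?thesis
    using nodes_tfold_Node[of "tfold (\<lambda>e acc. tif (P e) (Node e acc) acc) l Leaf" Leaf]
    by (simp add: tfilter_def trev_def)
qed

lemma poly_time_tfilter:
  assumes P: "poly_time (\<lambda>w. P (left w) (right w))" and l: "poly_time l"
  shows "poly_time (\<lambda>x. tfilter (P x) (l x))"
  unfolding tfilter_def
  by (intro poly_time_trev poly_time_tfold[where g = "\<lambda>x e acc. tif (P x e) (Node e acc) acc" and q = "[:1, 1:]"]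
      poly_time_basic poly_time_comp2[OF P] l)
    (simp add: tif_def)

definition tex :: "(tree \<Rightarrow> tree) \<Rightarrow> tree \<Rightarrow> tree" where
  "tex P l = tfold (\<lambda>e acc. tor (P e) acc) l Leaf"

lemma tex_enc_list:
  assumes "\<And>x. x \<in> set xs \<Longrightarrow> P (f x) = tbool (Q x)"
  shows "tex P (enc_list f xs) = tbool (\<exists>x\<in>set xs. Q x)"
proof -
  have "tfold (\<lambda>e acc. tor (P e) acc) (enc_list f xs) (tbool b) = tbool ((\<exists>x\<in>set xs. Q x) \<or> b)" for b
    using assms
  proof (induction xs arbitrary: b)
    case (Cons x xs)
    then show ?case using Cons.IH[of "Q x \<or> b"] by (simp add: disj_ac)
  qed simp
  from this[of False] show ?thesis by (simp add: tex_def tbool_def)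
qed

text \<open>\<open>tor\<close> returns at most the 3 nodes of \<open>Node Leaf Leaf\<close>,
  whatever the accumulator is.\<close>

lemma poly_time_tex:
  assumes P: "poly_time (\<lambda>w. P (left w) (right w))" and l: "poly_time l"
  shows "poly_time (\<lambda>x. tex (P x) (l x))"
  unfolding tex_def
  by (intro poly_time_tfold[where g = "\<lambda>x e acc. tor (P x e) acc" and q = "[:3:]"]
      poly_time_basic poly_time_comp2[OF P] l)
    (simp add: tor_def tif_def)

definition tall :: "(tree \<Rightarrow> tree) \<Rightarrow> tree \<Rightarrow> tree" where
  "tall P l = tnot (tex (\<lambda>e. tnot (P e)) l)"

lemma tall_enc_list:
  assumes "\<And>x. x \<in> set xs \<Longrightarrow> P (f x) = tbool (Q x)"
  shows "tall P (enc_list f xs) = tbool (\<forall>x\<in>set xs. Q x)"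
  unfolding tall_def using tex_enc_list[of xs "\<lambda>e. tnot (P e)" f "\<lambda>x. \<not> Q x"] assms by simp

lemma poly_time_tall:
  assumes "poly_time (\<lambda>w. P (left w) (right w))" "poly_time l"
  shows "poly_time (\<lambda>x. tall (P x) (l x))"
  unfolding tall_def by (intro poly_time_tnot poly_time_tex assms)

definition tmap :: "(tree \<Rightarrow> tree) \<Rightarrow> tree \<Rightarrow> tree" where
  "tmap F l = trev (tfold (\<lambda>e acc. Node (F e) acc) l Leaf)"

lemma tmap_enc_list:
  assumes "\<And>x. x \<in> set xs \<Longrightarrow> F (f x) = g (h x)"
  shows "tmap F (enc_list f xs) = enc_list g (map h xs)"
proof -
  have "tfold (\<lambda>e acc. Node (F e) acc) (enc_list f xs) (enc_list g ys) = enc_list g (rev (map h xs) @ ys)" for ys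
    using assms
  proof (induction xs arbitrary: ys)
    case (Cons x xs)
    then show ?case using Cons.IH[of "h x # ys"] by simp
  qed simp
  from this[of "[]"] show ?thesis by (simp add: tmap_def)
qed

lemma poly_time_tmap:
  assumes F: "poly_time (\<lambda>w. F (left w) (right w))" and l: "poly_time l"
  shows "poly_time (\<lambda>x. tmap (F x) (l x))"
proof -
  obtain q where q: "\<And>w. nodes (F (left w) (right w)) \<le> poly q (nodes w)"
    using poly_time_size[OF F] unfolding poly_bounded_def by blast
  \<comment> \<open>\<open>q\<close> bounds the value on the pair \<open>Node x e\<close>, which has
    one node more than \<open>x\<close> and \<open>e\<close> together. The summand 1 is the new list
    cell.\<close>
  have "nodes (Node (F x e) acc) \<le> nodes acc + poly ([:1:] + pcompose q [:1, 1:]) (nodes x + nodes e)" for x e acc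
    using q[of "Node x e"] by (simp add: poly_pcompose add.assoc)
  then show ?thesis unfolding tmap_def
    by (intro poly_time_trev poly_time_tfold[where g = "\<lambda>x e acc. Node (F x e) acc"
          and q = "[:1:] + pcompose q [:1, 1:]"] poly_time_basic poly_time_comp2[OF F] l)
qed

definition tconcat :: "tree \<Rightarrow> tree" where
  "tconcat l = tfold (\<lambda>x acc. tapp x acc) (trev l) Leaf"

lemma tconcat_enc_list [simp]: "tconcat (enc_list (enc_list f) xss) = enc_list f (concat xss)"
proof -
  have "tfold (\<lambda>x acc. tapp x acc) (enc_list (enc_list f) yss) (enc_list f ys) =
      enc_list f (concat (rev yss) @ ys)" for yss ys
  proof (induction yss arbitrary: ys)
    case (Cons y yss)
    then show ?case using Cons.IH[of "y @ ys"] by simp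
  qed simp
  from this[of "rev xss" "[]"] show ?thesis by (simp add: tconcat_def)
qed

lemma poly_time_tconcat: "poly_time l \<Longrightarrow> poly_time (\<lambda>x. tconcat (l x))"
  unfolding tconcat_def
proof (rule poly_time_tfold[where g = "\<lambda>x e acc. tapp e acc" and q = "[:0, 1:]"])
  show "nodes (tapp e acc) \<le> nodes acc + poly [:0, 1:] (nodes x + nodes e)" for x e acc
    using nodes_tapp[of e acc] by simp
qed (intro poly_time_tapp poly_time_trev poly_time_basic; assumption)+

text \<open>The state pairs a true flag with the remaining digits of the second number, while the
  fold runs over those of the first. \<open>Leaf\<close> is the absorbing state of failure.\<close>

definition eq_step :: "tree \<Rightarrow> tree \<Rightarrow> tree" where
  "eq_step d s = tif (left s) (tif (right s)
     (tif (tif d (left (right s)) (tnot (left (right s)))) (Node (Node Leaf Leaf) (right (right s))) Leaf) Leaf) Leaf"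

definition teq :: "tree \<Rightarrow> tree \<Rightarrow> tree" where
  "teq a b = (let s = tfold eq_step a (Node (Node Leaf Leaf) b) in tand (left s) (tnot (right s)))"

lemma eq_step_Leaf [simp]: "eq_step d Leaf = Leaf"
  by (simp add: eq_step_def tif_def)

lemma tfold_eq_step_Leaf [simp]: "tfold eq_step a Leaf = Leaf"
  by (induction a) auto

lemma teq_simps:
  "teq Leaf Leaf = tbool True" "teq Leaf (Node e b) = tbool False" "teq (Node d a) Leaf = tbool False"
  "teq (Node (tbool p) a) (Node (tbool q) b) = (if p = q then teq a b else tbool False)"
  by (auto simp: teq_def Let_def eq_step_def tif_def tand_def tnot_def tbool_def)

lemma enc_nat_eq: "enc_nat n = (if n = 0 then Leaf else Node (tbool (odd n)) (enc_nat (n div 2)))"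
  by (subst enc_nat.simps) (simp add: tbool_def)

lemma teq_enc_nat [simp]: "teq (enc_nat a) (enc_nat b) = tbool (a = b)"
proof (induction a arbitrary: b rule: enc_nat.induct)
  case (1 a)
  have "a = b \<longleftrightarrow> (odd a \<longleftrightarrow> odd b) \<and> a div 2 = b div 2"
    by (metis bit_eq_rec)
  then show ?case
    using 1[of "b div 2"] by (auto simp: enc_nat_eq[of a] enc_nat_eq[of b] teq_simps)
qed

lemma poly_time_teq:
  assumes "poly_time a" "poly_time b"
  shows "poly_time (\<lambda>x. teq (a x) (b x))"
proof -
  have "nodes (eq_step e acc) \<le> nodes acc + poly [:3:] (nodes (x :: tree) + nodes e)" for x e acc
    by (cases acc; cases "right acc") (auto simp: eq_step_def tif_def)
  then have "poly_time (\<lambda>x. tfold eq_step (a x) (Node (Node Leaf Leaf) (b x)))"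
    by (intro poly_time_tfold[where g = "\<lambda>x e acc. eq_step e acc" and q = "[:3:]"] assms poly_time_Node poly_time_Leaf)
      (auto simp: eq_step_def intro!: poly_time_basic)
  then show ?thesis unfolding teq_def Let_def by (intro poly_time_basic)
qed

definition greedy_step :: "(tree \<Rightarrow> tree \<Rightarrow> tree) \<Rightarrow> tree \<Rightarrow> tree" where
  "greedy_step red s = Node
     (tif (red (tapp (left s) (right (right s))) (left (right s))) (left s) (Node (left (right s)) (left s)))
     (right (right s))"

text \<open>The list folded over is only a counter. The pending entries are kept in the state,
  because the redundancy test needs all of them and a fold shows just one.\<close>

definition tgreedy :: "(tree \<Rightarrow> tree \<Rightarrow> tree) \<Rightarrow> tree \<Rightarrow> tree" where
  "tgreedy red l = left (tfold (\<lambda>_. greedy_step red) l (Node Leaf l))"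

lemma tgreedy_enc_list:
  assumes "\<And>S x. set S \<subseteq> set xs \<Longrightarrow> x \<in> set xs \<Longrightarrow> tred (enc_list f S) (f x) = tbool (red S x)"
  shows "tgreedy tred (enc_list f xs) = enc_list f (greedy red xs)"
proof -
  have "set ks \<subseteq> A \<Longrightarrow> set xs \<subseteq> A \<Longrightarrow>
      tfold (\<lambda>_. greedy_step tred) (enc_list f xs) (Node (enc_list f ks) (enc_list f xs)) = Node (enc_list f (greedy_aux red ks xs)) Leaf"
    if "\<And>S x. set S \<subseteq> A \<Longrightarrow> x \<in> A \<Longrightarrow> tred (enc_list f S) (f x) = tbool (red S x)" for ks xs A
  proof (induction xs arbitrary: ks)
    case (Cons x xs)
    have "tred (enc_list f (ks @ xs)) (f x) = tbool (red (ks @ xs) x)"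
      using that[of "ks @ xs" x] Cons.prems by simp
    then show ?case
      using Cons.IH[of ks] Cons.IH[of "x # ks"] Cons.prems by (simp add: greedy_step_def)
  qed simp
  from this[of "set xs" "[]" xs] assms show ?thesis
    unfolding tgreedy_def greedy_def by simp
qed

lemma poly_time_tgreedy:
  assumes red: "poly_time (\<lambda>w. red (left w) (left (right w)) (right (right w)))" and l: "poly_time l"
  shows "poly_time (\<lambda>x. tgreedy (red x) (l x))"
proof -
  \<comment> \<open>The 4 comes from the malformed state \<open>Leaf\<close>, which may become
    \<open>Node (Node Leaf Leaf) Leaf\<close>.\<close>
  have bound: "nodes (greedy_step (red x) s) \<le> nodes s + poly [:4:] (nodes x + nodes e)" for x e s
    by (cases s; cases "right s") (auto simp: greedy_step_def tif_def)
  have red': "poly_time (\<lambda>x. red (a x) (b x) (c x))" if "poly_time a" "poly_time b" "poly_time c" for a b c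
    using poly_time_comp[OF red poly_time_Node[OF that(1) poly_time_Node[OF that(2,3)]]] by simp
  have "poly_time (\<lambda>w. greedy_step (red (left w)) (right (right w)))"
    unfolding greedy_step_def by (intro poly_time_basic poly_time_tapp red')
  then show ?thesis unfolding tgreedy_def
    by (intro poly_time_left poly_time_tfold[where g = "\<lambda>x _. greedy_step (red x)" and q = "[:4:]"]
        bound l poly_time_basic)
qed


section \<open>The program\<close>

lemmas poly_time_rules = poly_time_basic poly_time_tapp poly_time_tconcat poly_time_teq
  poly_time_tfilter poly_time_tex poly_time_tall poly_time_tmap poly_time_tgreedy

abbreviation enc_nats :: "nat list \<Rightarrow> tree" where "enc_nats \<equiv> enc_list enc_nat"

definition enc_rule :: "nat list \<times> nat list \<Rightarrow> tree" where
  "enc_rule r = Node (enc_nats (fst r)) (enc_nats (snd r))"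

definition enc_pair :: "nat \<times> nat \<Rightarrow> tree" where
  "enc_pair x = Node (enc_nat (fst x)) (enc_nat (snd x))"

abbreviation enc_rules :: "(nat list \<times> nat list) list \<Rightarrow> tree" where "enc_rules \<equiv> enc_list enc_rule"

lemma enc_implications_eq: "enc_implications = enc_rules"
proof -
  have "(\<lambda>(as, bs). Node (enc_nats as) (enc_nats bs)) = enc_rule"
    by (auto simp: enc_rule_def fun_eq_iff)
  then show ?thesis unfolding enc_implications_def by simp
qed

lemma enc_rule_sel [simp]:
  "left (enc_rule r) = enc_nats (fst r)" "right (enc_rule r) = enc_nats (snd r)"
  by (simp_all add: enc_rule_def)

lemma enc_pair_sel [simp]:
  "left (enc_pair x) = enc_nat (fst x)" "right (enc_pair x) = enc_nat (snd x)"
  by (simp_all add: enc_pair_def)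

lemma left_enc_list: "xs \<noteq> [] \<Longrightarrow> left (enc_list f xs) = f (hd xs)"
  by (cases xs) auto

lemma right_enc_list [simp]: "right (enc_list f xs) = enc_list f (tl xs)"
  by (cases xs) auto

lemma tif_enc_list: "tif (enc_list f xs) a b = (if xs = [] then b else a)"
  by (cases xs) (auto simp: tif_def)

definition tmem :: "tree \<Rightarrow> tree \<Rightarrow> tree" where "tmem x l = tex (\<lambda>y. teq x y) l"

lemma tmem_enc [simp]: "tmem (enc_nat x) (enc_nats l) = tbool (x \<in> set l)"
  unfolding tmem_def by (subst tex_enc_list[where Q = "\<lambda>y. x = y"]) auto

lemma poly_time_tmem:
  assumes "poly_time x" "poly_time l"
  shows "poly_time (\<lambda>z. tmem (x z) (l z))"
  unfolding tmem_def by (intro poly_time_rules poly_time_comp[OF assms(1)] assms)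

definition tsub :: "tree \<Rightarrow> tree \<Rightarrow> tree" where "tsub a b = tall (\<lambda>x. tmem x b) a"

lemma tsub_enc [simp]: "tsub (enc_nats a) (enc_nats b) = tbool (set a \<subseteq> set b)"
  unfolding tsub_def subset_code(1) by (rule tall_enc_list) simp

lemma poly_time_tsub:
  assumes "poly_time a" "poly_time b"
  shows "poly_time (\<lambda>z. tsub (a z) (b z))"
  unfolding tsub_def by (intro poly_time_rules poly_time_tmem poly_time_comp[OF assms(2)] assms)

definition tclosure_step :: "tree \<Rightarrow> tree \<Rightarrow> tree \<Rightarrow> tree" where
  "tclosure_step es ps A =
     tfilter (\<lambda>e. tor (tmem e A) (tex (\<lambda>p. tand (tsub (left p) A) (tmem e (right p))) ps)) es"

lemma tclosure_step_enc [simp]: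
  "tclosure_step (enc_nats es) (enc_rules ps) (enc_nats A) = enc_nats (closure_step es ps A)"
  unfolding tclosure_step_def closure_step_def
  by (rule tfilter_enc_list)
    (simp add: tex_enc_list[where Q = "\<lambda>p. set (fst p) \<subseteq> set A \<and> _ \<in> set (snd p)"])

lemma poly_time_tclosure_step:
  assumes "poly_time es" "poly_time ps" "poly_time A"
  shows "poly_time (\<lambda>z. tclosure_step (es z) (ps z) (A z))"
  unfolding tclosure_step_def
  by (intro poly_time_rules poly_time_tmem poly_time_tsub assms
      assms[THEN poly_time_comp])

definition tclosure :: "tree \<Rightarrow> tree \<Rightarrow> tree \<Rightarrow> tree" where
  "tclosure es ps X = tfold (\<lambda>_. tclosure_step es ps) es (tfilter (\<lambda>e. tmem e X) es)"

lemma tclosure_enc [simp]: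
  "tclosure (enc_nats es) (enc_rules ps) (enc_nats X) = enc_nats (closure_list es ps X)"
proof -
  have "tfold (\<lambda>_. tclosure_step (enc_nats es) (enc_rules ps)) (enc_nats xs) (enc_nats A) =
      enc_nats (fold (\<lambda>_. closure_step es ps) xs A)" for xs A
    by (induction xs arbitrary: A) auto
  moreover have "tfilter (\<lambda>e. tmem e (enc_nats X)) (enc_nats es) = enc_nats (filter (\<lambda>e. e \<in> set X) es)"
    by (rule tfilter_enc_list) simp
  ultimately show ?thesis unfolding tclosure_def closure_list_def by simp
qed

text \<open>Each round returns a filtered \<open>es\<close>, so its size is bounded independently of
  the accumulator.\<close>

lemma poly_time_tclosure:
  assumes "poly_time es" "poly_time ps" "poly_time X"
  shows "poly_time (\<lambda>z. tclosure (es z) (ps z) (X z))"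
proof -
  obtain q where q: "\<And>z. nodes (es z) \<le> poly q (nodes z)"
    using poly_time_size[OF assms(1)] unfolding poly_bounded_def by blast
  have bound: "nodes (tclosure_step (es z) (ps z) A) \<le> nodes A + poly q (nodes z + nodes e)" for z A e
  proof -
    have "nodes (tclosure_step (es z) (ps z) A) \<le> nodes (es z)"
      unfolding tclosure_step_def by (rule nodes_tfilter)
    also have "\<dots> \<le> poly q (nodes z + nodes e)"
      using q[of z] poly_mono_nat[of "nodes z" "nodes z + nodes e" q] by simp
    finally show ?thesis by simp
  qed
  show ?thesis unfolding tclosure_def
    by (intro poly_time_tfold[where g = "\<lambda>z e. tclosure_step (es z) (ps z)" and q = q] bound assms
        poly_time_tclosure_step poly_time_rules poly_time_tmem
        assms[THEN poly_time_comp])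
qed

lemmas poly_time_rules' = poly_time_rules poly_time_tmem poly_time_tsub poly_time_tclosure

abbreviation tsing :: "tree \<Rightarrow> tree" where "tsing p \<equiv> Node p Leaf"
abbreviation tdouble :: "tree \<Rightarrow> tree \<Rightarrow> tree" where "tdouble p q \<equiv> Node p (Node q Leaf)"

lemma tclosure_sing_enc [simp]:
  "tclosure (enc_nats es) (enc_rules ps) (tsing (enc_nat p)) = enc_nats (closure_list es ps [p])"
  using tclosure_enc[of es ps "[p]"] by simp

lemma tclosure_double_enc [simp]:
  "tclosure (enc_nats es) (enc_rules ps) (tdouble (enc_nat p) (enc_nat q)) = enc_nats (closure_list es ps [p, q])"
  using tclosure_enc[of es ps "[p, q]"] by simp

definition tconflicting :: "tree \<Rightarrow> tree \<Rightarrow> tree" where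
  "tconflicting ps A = tex (\<lambda>p. tand (tnot (right p)) (tsub (left p) A)) ps"

lemma tconflicting_enc [simp]: "tconflicting (enc_rules ps) (enc_nats A) = tbool (conflicting ps A)"
  unfolding tconflicting_def conflicting_def by (rule tex_enc_list) simp

lemma poly_time_tconflicting:
  assumes "poly_time ps" "poly_time A"
  shows "poly_time (\<lambda>z. tconflicting (ps z) (A z))"
  unfolding tconflicting_def
  by (intro poly_time_rules' assms assms[THEN poly_time_comp])

definition tlower :: "tree \<Rightarrow> tree \<Rightarrow> tree \<Rightarrow> tree" where
  "tlower es ps p = tgreedy (\<lambda>S d. tmem d (tclosure es ps S))
     (tfilter (\<lambda>e. tnot (teq e p)) (tclosure es ps (tsing p)))"

lemma tlower_enc [simp]: "tlower (enc_nats es) (enc_rules ps) (enc_nat p) = enc_nats (lower_list es ps p)"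
proof -
  have "tfilter (\<lambda>e. tnot (teq e (enc_nat p))) (enc_nats (closure_list es ps [p])) =
      enc_nats (filter (\<lambda>e. e \<noteq> p) (closure_list es ps [p]))"
    by (rule tfilter_enc_list) simp
  then show ?thesis unfolding tlower_def lower_list_def
    by (simp only: tclosure_sing_enc) (rule tgreedy_enc_list, simp)
qed

lemma poly_time_tlower:
  assumes "poly_time es" "poly_time ps" "poly_time p"
  shows "poly_time (\<lambda>z. tlower (es z) (ps z) (p z))"
  unfolding tlower_def
  by (intro poly_time_rules' assms
      assms[THEN poly_time_comp])

text \<open>The double negation turns a nonempty list into the truth value expected by
  \<open>tfilter_enc_list\<close>.\<close>

definition tlow :: "tree \<Rightarrow> tree \<Rightarrow> tree" where
  "tlow es ps = tfilter (\<lambda>r. tnot (tnot (right r))) (tmap (\<lambda>p. Node (tsing p) (tlower es ps p)) es)"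

lemma tlow_enc [simp]: "tlow (enc_nats es) (enc_rules ps) = enc_rules (low_list es ps)"
proof -
  have "tmap (\<lambda>p. Node (tsing p) (tlower (enc_nats es) (enc_rules ps) p)) (enc_nats es) =
      enc_rules (map (\<lambda>p. ([p], lower_list es ps p)) es)"
    by (rule tmap_enc_list) (simp add: enc_rule_def)
  then show ?thesis unfolding tlow_def low_list_def
    by (simp only:) (rule tfilter_enc_list, simp)
qed

lemma poly_time_tlow:
  assumes "poly_time es" "poly_time ps"
  shows "poly_time (\<lambda>z. tlow (es z) (ps z))"
  unfolding tlow_def
  by (intro poly_time_rules' poly_time_tlower assms assms[THEN poly_time_comp])

definition tspans :: "tree \<Rightarrow> tree \<Rightarrow> tree \<Rightarrow> tree \<Rightarrow> tree \<Rightarrow> tree" where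
  "tspans es ps pq r s =
     tand (tmem (left pq) (tclosure es ps (tdouble r s))) (tmem (right pq) (tclosure es ps (tdouble r s)))"

lemma tspans_enc [simp]:
  "tspans (enc_nats es) (enc_rules ps) (enc_pair pq) (enc_nat r) (enc_nat s) = tbool (spans es ps pq r s)"
  unfolding tspans_def spans_def by simp

lemma poly_time_tspans:
  assumes "poly_time es" "poly_time ps" "poly_time pq" "poly_time r" "poly_time s"
  shows "poly_time (\<lambda>z. tspans (es z) (ps z) (pq z) (r z) (s z))"
  unfolding tspans_def by (intro poly_time_rules' assms)

definition trim :: "tree \<Rightarrow> tree \<Rightarrow> tree \<Rightarrow> tree" where
  "trim es ps pq = tfilter (\<lambda>r. tand (tmem r (tclosure es ps (tdouble (left pq) (right pq))))
     (tex (\<lambda>s. tspans es ps pq r s) (tclosure es ps (tdouble (left pq) (right pq))))) es"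

lemma trim_enc [simp]: "trim (enc_nats es) (enc_rules ps) (enc_pair pq) = enc_nats (rim_list es ps pq)"
  unfolding trim_def rim_list_def
  by (rule tfilter_enc_list) (simp add: tex_enc_list[where Q = "spans es ps pq _"])

lemma poly_time_trim:
  assumes "poly_time es" "poly_time ps" "poly_time pq"
  shows "poly_time (\<lambda>z. trim (es z) (ps z) (pq z))"
  unfolding trim_def
  by (intro poly_time_rules' poly_time_tspans assms
      assms[THEN poly_time_comp])

definition treps :: "tree \<Rightarrow> tree \<Rightarrow> tree \<Rightarrow> tree" where
  "treps es ps pq = tgreedy (\<lambda>S r. tex (\<lambda>s. tnot (tspans es ps pq r s)) S) (trim es ps pq)"

lemma treps_enc [simp]: "treps (enc_nats es) (enc_rules ps) (enc_pair pq) = enc_nats (reps_list es ps pq)"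
  unfolding treps_def reps_list_def trim_enc
  by (rule tgreedy_enc_list) (rule tex_enc_list, simp)

lemma poly_time_treps:
  assumes "poly_time es" "poly_time ps" "poly_time pq"
  shows "poly_time (\<lambda>z. treps (es z) (ps z) (pq z))"
  unfolding treps_def
  by (intro poly_time_rules' poly_time_tspans poly_time_trim assms
      assms[THEN poly_time_comp])

text \<open>The list folded over is again a counter: each round drops the head until
  \<open>x\<close> is in front, and the remaining rounds change nothing.\<close>

definition tafter :: "tree \<Rightarrow> tree \<Rightarrow> tree" where
  "tafter x R = right (tfold (\<lambda>_ l. tif (teq (left l) x) l (right l)) R R)"

lemma tafter_enc [simp]: "tafter (enc_nat x) (enc_nats R) = enc_nats (after x R)"
proof -
  let ?g = "\<lambda>_ l. tif (teq (left l) (enc_nat x)) l (right l)"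
  have fix_Leaf: "tfold ?g (enc_nats ws) Leaf = Leaf" for ws
    by (induction ws) (auto simp: tif_def)
  have fix_x: "tfold ?g (enc_nats ws) (enc_nats (x # zs)) = enc_nats (x # zs)" for ws zs
    by (induction ws) auto
  have "length zs \<le> length ws \<Longrightarrow>
      tfold ?g (enc_nats ws) (enc_nats zs) = enc_nats (dropWhile (\<lambda>y. y \<noteq> x) zs)" for ws zs
  proof (induction ws arbitrary: zs)
    case (Cons w ws)
    show ?case
    proof (cases zs)
      case Nil
      then show ?thesis using fix_Leaf[of "w # ws"] by simp
    next
      case zs: (Cons z zs')
      show ?thesis
      proof (cases "z = x")
        case True
        then show ?thesis using fix_x[of "w # ws" zs'] zs by simp
      next
        case False
        then show ?thesis using Cons.IH[of zs'] Cons.prems zs by simp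
      qed
    qed
  qed simp
  from this[of R R] show ?thesis unfolding tafter_def after_def by simp
qed

lemma poly_time_tafter:
  assumes "poly_time x" "poly_time R"
  shows "poly_time (\<lambda>z. tafter (x z) (R z))"
  unfolding tafter_def
proof (intro poly_time_right poly_time_tfold[where g = "\<lambda>z e l. tif (teq (left l) (x z)) l (right l)" and q = 0] assms)
  show "nodes (tif (teq (left l) (x z)) l (right l)) \<le> nodes l + poly 0 (nodes z + nodes (e :: tree))" for z e l
    by (cases l) (simp_all add: tif_def)
qed (intro poly_time_rules' poly_time_comp[OF assms(1)])

definition tthird :: "tree \<Rightarrow> tree \<Rightarrow> tree \<Rightarrow> tree" where
  "tthird R x y = tif (tafter y R) (left (tafter y R)) (tif (teq x (left R)) (left (right R)) (left R))"

text \<open>The assumption ensures that every selected \<open>left\<close> belongs to a nonempty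
  list, where it agrees with \<open>hd\<close>.\<close>

lemma tthird_enc:
  assumes "tl R \<noteq> []"
  shows "tthird (enc_nats R) (enc_nat x) (enc_nat y) = enc_nat (third R x y)"
  using assms unfolding tthird_def third_def
  by (cases R) (auto simp: tif_enc_list left_enc_list simp del: enc_list.simps)

lemma poly_time_tthird:
  assumes "poly_time R" "poly_time x" "poly_time y"
  shows "poly_time (\<lambda>z. tthird (R z) (x z) (y z))"
  unfolding tthird_def by (intro poly_time_rules' poly_time_tafter assms)

definition tproduct :: "tree \<Rightarrow> tree \<Rightarrow> tree" where
  "tproduct a b = tconcat (tmap (\<lambda>x. tmap (\<lambda>y. Node x y) b) a)"

lemma tproduct_enc [simp]: "tproduct (enc_nats a) (enc_nats b) = enc_list enc_pair (List.product a b)"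
proof -
  have "tmap (\<lambda>y. Node (enc_nat x) y) (enc_nats b) = enc_list enc_pair (map (\<lambda>y. (x, y)) b)" for x
    by (rule tmap_enc_list) (simp add: enc_pair_def)
  then have "tmap (\<lambda>x. tmap (\<lambda>y. Node x y) (enc_nats b)) (enc_nats a) =
      enc_list (enc_list enc_pair) (map (\<lambda>x. map (\<lambda>y. (x, y)) b) a)"
    by (rule tmap_enc_list)
  then show ?thesis unfolding tproduct_def by (simp add: product_concat_map)
qed

lemma poly_time_tproduct:
  assumes "poly_time a" "poly_time b"
  shows "poly_time (\<lambda>z. tproduct (a z) (b z))"
  unfolding tproduct_def by (intro poly_time_rules' assms poly_time_comp[OF assms(2)])

definition tlines :: "tree \<Rightarrow> tree" where
  "tlines R = tif (right (right R))
     (tmap (\<lambda>w. Node (tdouble (left w) (right w)) (tsing (tthird R (left w) (right w))))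
       (tfilter (\<lambda>w. tmem (right w) (tafter (left w) R)) (tproduct R R))) Leaf"

lemma tlines_enc [simp]: "tlines (enc_nats R) = enc_rules (lines_list R)"
proof (cases "tl (tl R) = []")
  case True
  then show ?thesis unfolding tlines_def lines_list_def by (simp add: tif_def)
next
  case False
  then have ne: "tl R \<noteq> []" by auto
  have 1: "tfilter (\<lambda>w. tmem (right w) (tafter (left w) (enc_nats R))) (enc_list enc_pair (List.product R R)) =
      enc_list enc_pair (filter (\<lambda>x. snd x \<in> set (after (fst x) R)) (List.product R R))"
    by (rule tfilter_enc_list) simp
  have 2: "tmap (\<lambda>w. Node (tdouble (left w) (right w)) (tsing (tthird (enc_nats R) (left w) (right w))))
      (enc_list enc_pair xs) = enc_rules (map (\<lambda>x. ([fst x, snd x], [third R (fst x) (snd x)])) xs)" for xs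
    by (rule tmap_enc_list) (simp add: enc_rule_def tthird_enc[OF ne])
  show ?thesis using False unfolding tlines_def lines_list_def tproduct_enc 1 2
    by (simp add: tif_enc_list)
qed

lemma poly_time_tlines:
  assumes "poly_time R"
  shows "poly_time (\<lambda>z. tlines (R z))"
  unfolding tlines_def
  by (intro poly_time_rules' poly_time_tafter poly_time_tthird poly_time_tproduct assms poly_time_comp[OF assms])

definition tincomparable :: "tree \<Rightarrow> tree \<Rightarrow> tree \<Rightarrow> tree" where
  "tincomparable es ps pq = tand (tnot (tconflicting ps (tclosure es ps (tdouble (left pq) (right pq)))))
     (tand (tnot (tmem (left pq) (tclosure es ps (tsing (right pq)))))
           (tnot (tmem (right pq) (tclosure es ps (tsing (left pq))))))"

lemma tincomparable_enc [simp]: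
  "tincomparable (enc_nats es) (enc_rules ps) (enc_pair pq) = tbool (incomparable_list es ps pq)"
  unfolding tincomparable_def incomparable_list_def by simp

lemma poly_time_tincomparable:
  assumes "poly_time es" "poly_time ps" "poly_time pq"
  shows "poly_time (\<lambda>z. tincomparable (es z) (ps z) (pq z))"
  unfolding tincomparable_def by (intro poly_time_rules' poly_time_tconflicting assms)

definition tline :: "tree \<Rightarrow> tree \<Rightarrow> tree" where
  "tline es ps = tconcat (tmap (\<lambda>pq. tlines (treps es ps pq))
     (tfilter (\<lambda>pq. tincomparable es ps pq) (tproduct es es)))"

lemma tline_enc [simp]: "tline (enc_nats es) (enc_rules ps) = enc_rules (line_list es ps)"
proof -
  have 1: "tfilter (\<lambda>pq. tincomparable (enc_nats es) (enc_rules ps) pq) (enc_list enc_pair (List.product es es)) =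
      enc_list enc_pair (filter (incomparable_list es ps) (List.product es es))"
    by (rule tfilter_enc_list) simp
  have 2: "tmap (\<lambda>pq. tlines (treps (enc_nats es) (enc_rules ps) pq)) (enc_list enc_pair xs) =
      enc_list enc_rules (map (\<lambda>pq. lines_list (reps_list es ps pq)) xs)" for xs
    by (rule tmap_enc_list) simp
  show ?thesis unfolding tline_def line_list_def tproduct_enc 1 2 by simp
qed

lemma poly_time_tline:
  assumes "poly_time es" "poly_time ps"
  shows "poly_time (\<lambda>z. tline (es z) (ps z))"
  unfolding tline_def
  by (intro poly_time_rules' poly_time_tlines poly_time_treps poly_time_tincomparable poly_time_tproduct
      assms assms[THEN poly_time_comp])

definition tproper :: "tree \<Rightarrow> tree \<Rightarrow> tree" where
  "tproper es ps = tapp (tlow es ps) (tline es ps)"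

lemma tproper_enc [simp]: "tproper (enc_nats es) (enc_rules ps) = enc_rules (proper_list es ps)"
  unfolding tproper_def proper_list_def by simp

lemma poly_time_tproper: "poly_time es \<Longrightarrow> poly_time ps \<Longrightarrow> poly_time (\<lambda>z. tproper (es z) (ps z))"
  unfolding tproper_def by (intro poly_time_rules' poly_time_tlow poly_time_tline)

definition tconflict_pairs :: "tree \<Rightarrow> tree \<Rightarrow> tree \<Rightarrow> tree" where
  "tconflict_pairs es ps rs = tgreedy
     (\<lambda>S x. tex (\<lambda>y. tand (tmem (left y) (tclosure es rs (tdouble (left x) (right x))))
        (tmem (right y) (tclosure es rs (tdouble (left x) (right x))))) S)
     (tfilter (\<lambda>x. tconflicting ps (tclosure es ps (tdouble (left x) (right x)))) (tproduct es es))"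

lemma tconflict_pairs_enc [simp]:
  "tconflict_pairs (enc_nats es) (enc_rules ps) (enc_rules rs) = enc_list enc_pair (conflict_pairs es ps rs)"
proof -
  have "tfilter (\<lambda>x. tconflicting (enc_rules ps) (tclosure (enc_nats es) (enc_rules ps) (tdouble (left x) (right x))))
      (enc_list enc_pair (List.product es es)) =
      enc_list enc_pair (filter (\<lambda>x. conflicting ps (closure_list es ps [fst x, snd x])) (List.product es es))"
    by (rule tfilter_enc_list) simp
  then show ?thesis unfolding tconflict_pairs_def conflict_pairs_def tproduct_enc
    by (simp only:) (rule tgreedy_enc_list, rule tex_enc_list, simp)
qed

lemma poly_time_tconflict_pairs:
  assumes "poly_time es" "poly_time ps" "poly_time rs"
  shows "poly_time (\<lambda>z. tconflict_pairs (es z) (ps z) (rs z))"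
  unfolding tconflict_pairs_def
  by (intro poly_time_rules' poly_time_tconflicting poly_time_tproduct assms
      assms[THEN poly_time_comp])

definition toptimum :: "tree \<Rightarrow> tree \<Rightarrow> tree" where
  "toptimum es ps = tif es
     (tapp (tproper es ps) (tmap (\<lambda>x. Node (tdouble (left x) (right x)) Leaf) (tconflict_pairs es ps (tproper es ps)))) ps"

lemma toptimum_enc: "toptimum (enc_nats es) (enc_rules ps) = enc_rules (optimum_list es ps)"
proof -
  have "tmap (\<lambda>x. Node (tdouble (left x) (right x)) Leaf) (enc_list enc_pair xs) =
      enc_rules (map (\<lambda>x. ([fst x, snd x], [])) xs)" for xs
    by (rule tmap_enc_list) (simp add: enc_rule_def)
  then show ?thesis unfolding toptimum_def optimum_list_def by (simp add: tif_enc_list)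
qed

lemma poly_time_toptimum: "poly_time (\<lambda>z. toptimum (left z) (right z))"
  unfolding toptimum_def
  by (intro poly_time_rules' poly_time_tproper poly_time_tconflict_pairs)

theorem theorem4p4:
  shows "\<exists>(c :: prog) (q :: nat poly).
    \<forall>(E :: nat set) (\<Sigma> :: nat implication set) (es :: nat list) (ps :: implication_list).
      finite E \<and> implications_on E \<Sigma> \<and> simple_implications E \<Sigma> \<and>
      modular_semilattice (inclusion_order (closed_sets E \<Sigma>)) \<and>
      set es = E \<and> family_of ps = \<Sigma> \<longrightarrow>
      (\<exists>(out :: implication_list) (t :: nat).
         runs c (enc_instance es ps) t (enc_implications out) \<and>
         t \<le> poly q (nodes (enc_instance es ps)) \<and>
         optimal_base E (closed_sets E \<Sigma>) (family_of out))"
proof -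
  \<comment> \<open>Program and time bound come from the tree function alone and hold on every
    input. Modularity and simplicity enter only through the optimality of the output.\<close>
  obtain c q where run: "\<forall>x. \<exists>t. runs c x t (toptimum (left x) (right x)) \<and> t \<le> poly q (nodes x)"
    using poly_time_toptimum by (rule poly_timeE)
  show ?thesis
  proof (intro exI[of _ c] exI[of _ q] allI impI, elim conjE)
    fix E :: "nat set" and \<Sigma> :: "nat implication set" and es :: "nat list" and ps :: implication_list
    assume fin: "finite E" and impl: "implications_on E \<Sigma>" and simple: "simple_implications E \<Sigma>"
      and mod: "modular_semilattice (inclusion_order (closed_sets E \<Sigma>))"
      and E: "set es = E" and \<Sigma>: "family_of ps = \<Sigma>"
    \<comment> \<open>The infinite type \<open>nat\<close> supplies the point outside
      \<open>E\<close> by which inconsistent closures are recognised.\<close>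
    have "E \<noteq> UNIV" using fin by auto
    then have opt: "optimal_base E (closed_sets E \<Sigma>) (family_of (optimum_list es ps))"
      using optimal_base_optimum_list[OF E, of ps] impl simple mod \<Sigma> unfolding family_of_def by simp
    obtain t where "runs c (enc_instance es ps) t (enc_implications (optimum_list es ps))"
      "t \<le> poly q (nodes (enc_instance es ps))"
      using run[rule_format, of "enc_instance es ps"]
      by (auto simp: enc_instance_def enc_implications_eq toptimum_enc)
    then show "\<exists>out t. runs c (enc_instance es ps) t (enc_implications out) \<and>
        t \<le> poly q (nodes (enc_instance es ps)) \<and> optimal_base E (closed_sets E \<Sigma>) (family_of out)"
      using opt by blast
  qed
qed

end
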